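(* Let $\mathbf N=\big((n_1,L_1),\dots,(n_k,L_k)\big)$ be a realisable necklace and let $P\in\mathcal M_{sm}(\mathbf N)$ be an admissible cyclic polygon which is a critical point of the oriented area $\mathcal A\colon\mathcal M_{sm}(\mathbf N)\to\mathbb R$. Then $P$ is a Morse (i.e. non-degenerate critical) point of $\mathcal A$ if and only if $P$ is not bifurcating. In this case its Morse index is $$\mu_P(\mathcal A)=\frac12\sum_{j=1}^k(2n_j-1)(E_j+1)-1-2w_P-\begin{cases}0,&\text{if }\sum_{j=1}^k n_jE_j\tan A_j>0;\\1,&\text{otherwise,}\end{cases}$$ where $E_j=\varepsilon_i(P)$ and $A_j=\alpha_i(P)$ for some $i\in j^*$ (since $P$ is critical, these do not depend on the choice of $i\in j^*$).
   Context: A planar $n$-gon is a tuple $P=(p_1,\dots,p_n)\in\mathrm{Poly}_n=(\mathbb R^2)^n$; vertex indices are cyclic modulo $n$; $l_i(P)=|p_{i+1}-p_i|$. A necklace is a tuple $\mathbf N=\big((n_1,L_1),\dots,(n_k,L_k)\big)$ with $n_j$ positive integers and $L_j$ positive reals; $n=n_1+\dots+n_k$. It is realisable if for every $j$ with $n_j=1$ one has $2L_j<L_1+\dots+L_k$. Put $j^*=\{n_1+\dots+n_{j-1}+1,\dots,n_1+\dots+n_j\}$ and $\mathcal L_j(P)=\sum_{i\in j^*}l_i(P)$. A configuration of $\mathbf N$ is $P\in\mathrm{Poly}_n$ with $\mathcal L_j(P)=L_j$ for all $j$. It is non-singular if $\mathcal L=(\mathcal L_1,\dots,\mathcal L_k)$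 is differentiable at $P$ with surjective differential $\mathbb R^{2n}\to\mathbb R^k$. $\widetilde{\mathcal M_{sm}}(\mathbf N)$ is the set of non-singular configurations (a smooth submanifold of $\mathbb R^{2n}$), and $\mathcal M_{sm}(\mathbf N)=\widetilde{\mathcal M_{sm}}(\mathbf N)/\mathrm{Isom}_+(\mathbb R^2)$ is its quotient by the diagonal action (free and proper) of the orientation-preserving isometries of the plane, with the smooth structure for which the quotient map is a smooth submersion; it has dimension $2n-k-3$. Oriented area: $\mathcal A(P)=\frac12\sum_{i=1}^n(x_iy_{i+1}-x_{i+1}y_i)$ for $p_i=(x_i,y_i)$; it descends to a smooth function on $\mathcal M_{sm}(\mathbf N)$. The Morse index $\mu_P(\mathcal A)$ is the maximal dimension of a subspace of $T_P\mathcal M_{sm}(\mathbf N)$ on which the Hessian $\mathrm{Hess}_P\mathcal A$ is negative definite. A polygon is cyclic if its vertices lie on a circle. For a cyclic polygon with circumscribed circle of centre $o$, and oriented angles $\angle p_iop_{i+1}\in(-\pi,\pi]$: $\alpha_i(P)=|\angle p_iop_{i+1}|/2\in[0,\pi/2]$, and $\varepsilon_i(P)=1,0,-1$ according to whether $\angle p_iop_{i+1}\in(0,\pi)$, $\in\{0,\pi\}$, $\in(-\pi,0)$. A cyclic polygon with at least three different vertices is admissible if no edge $p_ip_{i+1}$ passes through the centre $o$ of its circumscribed circle; then $w_P$ denotes the winding number of the closed polygon $P$ around $o$. An admissible cyclic polygon is bifurcating if $\sum_{i=1}^n\varepsilon_i\tan\alpha_i=0$. *)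

theory Defs
  imports "HOL-Complex_Analysis.Complex_Analysis"
begin

section \<open>Cyclic indices, polygons, necklaces\<close>

text \<open>The vertices of an $n$-gon are indexed by a finite linearly ordered type with $n$ elements,
  listed in increasing order, and the Euclidean plane is the type of complex numbers
  (with coordinates \<open>Re\<close> and \<open>Im\<close>). So $Poly_n$ is the Euclidean space \<open>complex ^ 'n\<close>.
  In the same way the beads of a necklace are indexed by a type with $k$ elements.\<close>

type_synonym 'n polygon = "(complex, 'n) vec"

definition next_ix :: "'n::{finite,linorder} \<Rightarrow> 'n" where
  "next_ix i = (if i = Max UNIV then Min UNIV else Min {j. i < j})"

text \<open>Position in the increasing listing, counted from 0.\<close>

definition pos :: "'n::{finite,linorder} \<Rightarrow> nat" where
  "pos i = card {j. j < i}"

definition edge_len :: "('n::{finite,linorder}) polygon \<Rightarrow> 'n \<Rightarrow> real" where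
  "edge_len P i = dist (P $ next_ix i) (P $ i)"

type_synonym 'k necklace = "'k \<Rightarrow> nat \<times> real"

abbreviation bd_num :: "'k necklace \<Rightarrow> 'k \<Rightarrow> nat" where
  "bd_num N j \<equiv> fst (N j)"

abbreviation bd_len :: "'k necklace \<Rightarrow> 'k \<Rightarrow> real" where
  "bd_len N j \<equiv> snd (N j)"

definition is_necklace :: "('k::{finite,linorder}) necklace \<Rightarrow> bool" where
  "is_necklace N \<longleftrightarrow> (\<forall>j. bd_num N j > 0 \<and> bd_len N j > 0)"

definition realisable :: "('k::{finite,linorder}) necklace \<Rightarrow> bool" where
  "realisable N \<longleftrightarrow> (\<forall>j. bd_num N j = 1 \<longrightarrow> 2 * bd_len N j < (\<Sum>i\<in>UNIV. bd_len N i))"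

text \<open>The index set $j^*$; the bounds are shifted by one because \<^term>\<open>pos\<close> starts at 0.\<close>

definition block :: "('k::{finite,linorder}) necklace \<Rightarrow> 'k \<Rightarrow> ('n::{finite,linorder}) set" where
  "block N j = {i. (\<Sum>j'\<in>{..<j}. bd_num N j') \<le> pos i \<and> pos i < (\<Sum>j'\<in>{..j}. bd_num N j')}"

definition block_len ::
  "'k necklace \<Rightarrow> ('n::{finite,linorder}) polygon \<Rightarrow> real ^ ('k::{finite,linorder})" where
  "block_len N P = (\<chi> j. \<Sum>i\<in>block N j. edge_len P i)"

definition configuration ::
  "('k::{finite,linorder}) necklace \<Rightarrow> ('n::{finite,linorder}) polygon \<Rightarrow> bool" where
  "configuration N P \<longleftrightarrow> (\<forall>j. block_len N P $ j = bd_len N j)"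

definition nonsingular ::
  "('k::{finite,linorder}) necklace \<Rightarrow> ('n::{finite,linorder}) polygon \<Rightarrow> bool" where
  "nonsingular N P \<longleftrightarrow>
     block_len N differentiable (at P) \<and> surj (frechet_derivative (block_len N) (at P))"

definition Msm_tilde ::
  "('k::{finite,linorder}) necklace \<Rightarrow> (('n::{finite,linorder}) polygon) set" where
  "Msm_tilde N = {P. configuration N P \<and> nonsingular N P}"

text \<open>Orbit under the orientation-preserving isometries $z \mapsto az + b$, $|a| = 1$, of the plane.
  The points of $M_{sm}(N)$ are the orbits of the elements of \<open>Msm_tilde N\<close>.\<close>

definition isom_orbit :: "('n::{finite,linorder}) polygon \<Rightarrow> ('n polygon) set" where
  "isom_orbit P = {(\<chi> i. a * P $ i + b) | a b. norm a = 1}"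

definition Msm ::
  "('k::{finite,linorder}) necklace \<Rightarrow> (('n::{finite,linorder}) polygon) set set" where
  "Msm N = isom_orbit ` Msm_tilde N"

definition area :: "('n::{finite,linorder}) polygon \<Rightarrow> real" where
  "area P = 1/2 * (\<Sum>i\<in>UNIV. Re (P $ i) * Im (P $ next_ix i) - Re (P $ next_ix i) * Im (P $ i))"

text \<open>The function on \<^const>\<open>Msm\<close> to which \<^const>\<open>area\<close>, being constant on orbits, descends.\<close>

definition orbit_area :: "(('n::{finite,linorder}) polygon) set \<Rightarrow> real" where
  "orbit_area C = the_elem (area ` C)"


section \<open>Calculus on the quotient manifold\<close>

text \<open>$C^k$ on an open set.\<close>

primrec Ck_on :: "nat \<Rightarrow> ('a::real_normed_vector \<Rightarrow> 'b::real_normed_vector) \<Rightarrow> 'a set \<Rightarrow> bool" where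
  "Ck_on 0 f S = continuous_on S f"
| "Ck_on (Suc k) f S =
     ((\<forall>x\<in>S. f differentiable (at x)) \<and> (\<forall>v. Ck_on k (\<lambda>x. frechet_derivative f (at x) v) S))"

definition smooth_map_on :: "'a set \<Rightarrow> ('a::real_normed_vector \<Rightarrow> 'b::real_normed_vector) \<Rightarrow> bool" where
  "smooth_map_on S f \<longleftrightarrow> (\<forall>k. Ck_on k f S)"

text \<open>Smooth map from a neighbourhood of 0 into a subset \<open>M\<close> (in practice a submanifold) of a
  Euclidean space, sending 0 to \<open>P\<close>.\<close>

definition smooth_germ ::
  "'b set \<Rightarrow> 'b \<Rightarrow> ('a::real_normed_vector \<Rightarrow> 'b::real_normed_vector) \<Rightarrow> bool" where
  "smooth_germ M P g \<longleftrightarrow>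
     g 0 = P \<and> (\<exists>U. open U \<and> 0 \<in> U \<and> smooth_map_on U g \<and> g ` U \<subseteq> M)"

definition tangent_space :: "'b set \<Rightarrow> 'b \<Rightarrow> ('b::real_normed_vector) set" where
  "tangent_space M P =
     {v. \<exists>g::real \<Rightarrow> 'b. smooth_germ M P g \<and> (g has_vector_derivative v) (at 0)}"

text \<open>Since the projection from \<^term>\<open>Msm_tilde N\<close> to \<^term>\<open>Msm N\<close> is a smooth submersion, the smooth
  germs into \<^term>\<open>Msm N\<close> are exactly the maps \<open>isom_orbit \<circ> g\<close> with \<open>g\<close> a smooth germ into
  \<^term>\<open>Msm_tilde N\<close>. The kernel of its differential at \<open>P\<close> is the tangent space \<open>vertical P\<close>
  of the orbit, so the tangent space of \<^term>\<open>Msm N\<close> at the class of \<open>P\<close> is the quotient of the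
  tangent space of \<^term>\<open>Msm_tilde N\<close> at \<open>P\<close> by \<open>vertical P\<close>; its vectors are cosets, and its
  zero vector is \<open>vertical P\<close> itself.\<close>

definition vertical :: "('n::{finite,linorder}) polygon \<Rightarrow> ('n polygon) set" where
  "vertical P = tangent_space (isom_orbit P) P"

definition Msm_tangent ::
  "('k::{finite,linorder}) necklace \<Rightarrow> ('n::{finite,linorder}) polygon \<Rightarrow> ('n polygon) set set" where
  "Msm_tangent N P = {(\<lambda>w. v + w) ` vertical P | v. v \<in> tangent_space (Msm_tilde N) P}"

definition critical_point ::
  "('k::{finite,linorder}) necklace \<Rightarrow> ('n::{finite,linorder}) polygon \<Rightarrow> bool" where
  "critical_point N P \<longleftrightarrow>
     (\<forall>g::real \<Rightarrow> 'n polygon. smooth_germ (Msm_tilde N) P g \<longrightarrow>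
        ((\<lambda>t. orbit_area (isom_orbit (g t))) has_real_derivative 0) (at 0))"

text \<open>Hessian of the area at a critical point, as a bilinear form on \<^const>\<open>Msm_tangent\<close>: its value at
  \<open>X\<close>, \<open>Y\<close> is the mixed second derivative of the area along any smooth two-parameter family through
  the class of \<open>P\<close> whose partial velocities at 0 are \<open>X\<close> and \<open>Y\<close> (at a critical point it does not
  depend on the family).\<close>

definition area_Hess ::
  "('k::{finite,linorder}) necklace \<Rightarrow> ('n::{finite,linorder}) polygon \<Rightarrow>
     ('n polygon) set \<Rightarrow> ('n polygon) set \<Rightarrow> real" where
  "area_Hess N P X Y = (THE h. \<exists>(g::real \<times> real \<Rightarrow> 'n polygon) u v.
      smooth_germ (Msm_tilde N) P g \<and> u \<in> X \<and> v \<in> Y \<and>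
      ((\<lambda>s. g (s, 0)) has_vector_derivative u) (at 0) \<and>
      ((\<lambda>t. g (0, t)) has_vector_derivative v) (at 0) \<and>
      h = deriv (\<lambda>s. deriv (\<lambda>t. orbit_area (isom_orbit (g (s, t)))) 0) 0)"

definition Morse_point ::
  "('k::{finite,linorder}) necklace \<Rightarrow> ('n::{finite,linorder}) polygon \<Rightarrow> bool" where
  "Morse_point N P \<longleftrightarrow> critical_point N P \<and>
     (\<forall>X\<in>Msm_tangent N P. (\<forall>Y\<in>Msm_tangent N P. area_Hess N P X Y = 0) \<longrightarrow> X = vertical P)"

text \<open>A set \<open>S\<close> of cosets of \<open>K = vertical P\<close> is a linear subspace of the quotient space iff its
  union is a linear subspace \<open>W\<close> (which then contains \<open>K\<close>), and its dimension is \<open>dim W - dim K\<close>.\<close>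

definition Morse_index ::
  "('k::{finite,linorder}) necklace \<Rightarrow> ('n::{finite,linorder}) polygon \<Rightarrow> nat" where
  "Morse_index N P = Max {dim (\<Union>S) - dim (vertical P) | S.
      S \<subseteq> Msm_tangent N P \<and> subspace (\<Union>S) \<and>
      (\<forall>X\<in>S. X \<noteq> vertical P \<longrightarrow> area_Hess N P X X < 0)}"


section \<open>Cyclic polygons\<close>

definition cyclic_polygon :: "('n::{finite,linorder}) polygon \<Rightarrow> bool" where
  "cyclic_polygon P \<longleftrightarrow> (\<exists>c r. r > 0 \<and> (\<forall>i. dist c (P $ i) = r))"

text \<open>Uniquely determined only if there are at least three different vertices, which is part of
  admissibility below.\<close>

definition circumcentre :: "('n::{finite,linorder}) polygon \<Rightarrow> complex" where
  "circumcentre P = (THE c. \<exists>r>0. \<forall>i. dist c (P $ i) = r)"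

text \<open>The angle is in $(-\pi, \pi]$.\<close>

definition edge_angle :: "('n::{finite,linorder}) polygon \<Rightarrow> 'n \<Rightarrow> real" where
  "edge_angle P i = Arg ((P $ next_ix i - circumcentre P) / (P $ i - circumcentre P))"

definition edge_alpha :: "('n::{finite,linorder}) polygon \<Rightarrow> 'n \<Rightarrow> real" where
  "edge_alpha P i = \<bar>edge_angle P i\<bar> / 2"

definition edge_eps :: "('n::{finite,linorder}) polygon \<Rightarrow> 'n \<Rightarrow> real" where
  "edge_eps P i =
     (if edge_angle P i \<in> {0<..<pi} then 1 else if edge_angle P i \<in> {0, pi} then 0 else -1)"

definition admissible :: "('n::{finite,linorder}) polygon \<Rightarrow> bool" where
  "admissible P \<longleftrightarrow> cyclic_polygon P \<and> card (range (\<lambda>i. P $ i)) \<ge> 3 \<and>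
     (\<forall>i. circumcentre P \<notin> closed_segment (P $ i) (P $ next_ix i))"

fun polyline :: "complex list \<Rightarrow> real \<Rightarrow> complex" where
  "polyline (a # b # c # xs) = linepath a b +++ polyline (b # c # xs)"
| "polyline [a, b] = linepath a b"
| "polyline [a] = linepath a a"
| "polyline [] = linepath 0 0"

definition closed_polyline :: "('n::{finite,linorder}) polygon \<Rightarrow> real \<Rightarrow> complex" where
  "closed_polyline P =
     polyline (map (\<lambda>i. P $ i) (sorted_list_of_set UNIV) @ [P $ Min UNIV])"

text \<open>The library's winding number is complex-valued; off a closed path it is an integer.\<close>

definition winding :: "('n::{finite,linorder}) polygon \<Rightarrow> real" where
  "winding P = Re (winding_number (closed_polyline P) (circumcentre P))"

definition bifurcating :: "('n::{finite,linorder}) polygon \<Rightarrow> bool" where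
  "bifurcating P \<longleftrightarrow> admissible P \<and> (\<Sum>i\<in>UNIV. edge_eps P i * tan (edge_alpha P i)) = 0"

end

theory Submission
  imports Defs
begin

no_notation fps_nth (infixl "$" 75)

text \<open>Put the circumcentre at the origin, let \<open>p\<close>, \<open>p'\<close> be consecutive vertices and let \<open>\<tau>\<close> be
  the tangent of half the oriented angle of the edge between them. By Lagrange multipliers the
  Hessian of the area is \<open>D\<^sup>2 area - \<Sum> c D\<^sup>2 len\<close>, where \<open>c\<close> is the signed distance of an edge
  from the centre; criticality says that \<open>c\<close>, hence \<open>\<tau>\<close>, is constant on each bead. In terms of
  the radial components \<open>a\<close> of a variation of the vertices and the components \<open>t\<close> of the
  variations of the edges along themselves, the Hessian is half of the sum of \<open>\<tau> (a + a')\<^sup>2 -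
  (a' - a)\<^sup>2 / \<tau> - \<tau> t\<^sup>2 / (1 + \<tau>\<^sup>2)\<close> over all edges, up to the factor \<open>R\<close>, the square of the
  circumradius. The constraints on \<open>t\<close> are its vanishing sums over beads, and the closing
  condition is \<open>\<Sum> \<tau> (a + a') = 0\<close>, orthogonality to \<open>a = 1\<close>, a vector of square \<open>4 \<Sum> \<tau>\<close>. This
  is where bifurcation and the case distinction come from.

  For the part in \<open>a\<close>, choose a line through the centre avoiding all vertices and divide by
  the signed distance \<open>\<kappa>\<close> to it, a vector in the kernel (a translation). The form becomes
  diagonal in the differences of \<open>a / \<kappa>\<close>, with negative entries at the positive edges which do
  not cross the line and the negative edges which do. The signed number of crossings is twice
  the winding number.\<close>

section \<open>Smooth maps\<close>

text \<open>The index is counted by deleting squares one at a time. With the differences of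
  \<open>a / \<kappa>\<close> and the components \<open>t\<close> treated as free coordinates, the
  form is diagonal. The differences sum to zero, and the vector orthogonal to that hyperplane is
  isotropic, because the reciprocals of the diagonal entries telescope; this costs exactly one
  negative square and is the source of the \<open>- 1\<close> in the formula. The remaining
  constraints are orthogonality to mutually orthogonal vectors: the indicator of each bead, which
  removes a negative square when \<open>\<tau>\<close> is positive there, and the constant radial
  vector, which does so when the sum of the \<open>\<tau>\<close> is negative. If that sum vanishes,
  the constant radial vector itself satisfies the constraints and lies in the radical, without
  coming from an isometry. The Hessian is defined on cosets through arbitrary families, whose
  second-order term is unknown. Since the multipliers are constant on beads, the twice
  differentiated length constraints eliminate that term.\<close>

lemma Ck_on_cong:
  assumes "open S" "\<And>x. x \<in> S \<Longrightarrow> f x = g x"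
  shows "Ck_on k f S \<longleftrightarrow> Ck_on k g S"
  using assms(2)
proof (induction k arbitrary: f g)
  case 0
  then show ?case by (simp cong: continuous_on_cong)
next
  case (Suc k)
  have "(f has_derivative D) (at x) \<longleftrightarrow> (g has_derivative D) (at x)" if "x \<in> S" for x D
    using has_derivative_transform_within_open[OF _ assms(1) that, of f D UNIV g]
      has_derivative_transform_within_open[OF _ assms(1) that, of g D UNIV f] Suc.prems by auto
  then have "f differentiable (at x) \<longleftrightarrow> g differentiable (at x)"
    "frechet_derivative f (at x) = frechet_derivative g (at x)" if "x \<in> S" for x
    using that by (simp_all add: differentiable_def frechet_derivative_def)
  then show ?case
    using Suc.IH[of "\<lambda>x. frechet_derivative f (at x) v" "\<lambda>x. frechet_derivative g (at x) v" for v]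
    by simp
qed

lemma Ck_on_subset: "Ck_on k f S \<Longrightarrow> T \<subseteq> S \<Longrightarrow> Ck_on k f T"
  by (induction k arbitrary: f) (auto intro: continuous_on_subset)

lemma Ck_on_SucD: "Ck_on (Suc k) f S \<Longrightarrow> Ck_on k f S"
proof (induction k arbitrary: f)
  case 0
  then show ?case
    by (auto intro!: continuous_at_imp_continuous_on differentiable_imp_continuous_within)
qed auto

text \<open>\<open>Ck_on\<close> speaks of \<open>frechet_derivative\<close>, a choice term. With
  this rule an explicit formula for the derivative can be used instead, so that each closure
  property becomes an induction on a rule of calculus.\<close>

lemma Ck_on_SucI:
  assumes "open S" "\<And>x. x \<in> S \<Longrightarrow> (f has_derivative f' x) (at x)" "\<And>v. Ck_on k (\<lambda>x. f' x v) S"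
  shows "Ck_on (Suc k) f S"
proof -
  have "Ck_on k (\<lambda>x. frechet_derivative f (at x) v) S" for v
    using assms(3)[of v]
    by (subst Ck_on_cong[OF assms(1), of _ "\<lambda>x. f' x v"])
      (auto simp: frechet_derivative_at[OF assms(2), symmetric])
  then show ?thesis using assms(2) by (auto simp: differentiable_def)
qed

lemma Ck_on_const: "Ck_on k (\<lambda>x. c) S"
  by (induction k arbitrary: c) (auto simp: frechet_derivative_const)

lemma Ck_on_bounded_linear:
  assumes "bounded_linear f" shows "Ck_on k f S"
proof (cases k)
  case 0
  then show ?thesis using assms by (simp add: linear_continuous_on)
next
  case (Suc m)
  have "(f has_derivative f) (at x)" for x
    using assms by (rule bounded_linear_imp_has_derivative)
  then show ?thesis
    using frechet_derivative_at[of f f] Suc Ck_on_const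
    by (auto simp: differentiable_def)
qed

lemma Ck_on_linear_compose:
  assumes "open S" "bounded_linear h" "Ck_on k f S"
  shows "Ck_on k (\<lambda>x. h (f x)) S"
  using assms(3)
proof (induction k arbitrary: f)
  case 0
  then show ?case
    using bounded_linear.continuous_on[OF assms(2)] by simp
next
  case (Suc k)
  show ?case
  proof (rule Ck_on_SucI[OF assms(1)])
    show "((\<lambda>x. h (f x)) has_derivative (\<lambda>v. h (frechet_derivative f (at x) v))) (at x)"
      if "x \<in> S" for x
      using Suc.prems that
      by (intro bounded_linear.has_derivative[OF assms(2)]) (simp add: frechet_derivative_works)
    show "Ck_on k (\<lambda>x. h (frechet_derivative f (at x) v)) S" for v
      using Suc by simp
  qed
qed

lemma Ck_on_add:
  assumes "open S" "Ck_on k f S" "Ck_on k g S"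
  shows "Ck_on k (\<lambda>x. f x + g x) S"
  using assms(2,3)
proof (induction k arbitrary: f g)
  case 0
  then show ?case by (auto intro!: continuous_intros)
next
  case (Suc k)
  show ?case
  proof (rule Ck_on_SucI[OF assms(1)])
    show "((\<lambda>x. f x + g x) has_derivative
        (\<lambda>v. frechet_derivative f (at x) v + frechet_derivative g (at x) v)) (at x)"
      if "x \<in> S" for x
      using Suc.prems that by (intro has_derivative_add) (simp_all add: frechet_derivative_works)
  qed (use Suc in simp)
qed

text \<open>By the product rule the derivative is a sum of two terms of the same shape, with one
  argument differentiated and the other only lowered in order; hence the induction leaves both
  arguments arbitrary.\<close>

lemma Ck_on_bilinear:
  assumes "open S" "bounded_bilinear h" "Ck_on k f S" "Ck_on k g S"
  shows "Ck_on k (\<lambda>x. h (f x) (g x)) S"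
  using assms(3,4)
proof (induction k arbitrary: f g)
  case 0
  then show ?case using bounded_bilinear.continuous_on[OF assms(2)] by simp
next
  case (Suc k)
  show ?case
  proof (rule Ck_on_SucI[OF assms(1)])
    show "((\<lambda>x. h (f x) (g x)) has_derivative
        (\<lambda>v. h (f x) (frechet_derivative g (at x) v) + h (frechet_derivative f (at x) v) (g x))) (at
          x)"
      if "x \<in> S" for x
      using Suc.prems that
      by (intro bounded_bilinear.FDERIV[OF assms(2)]) (simp_all add: frechet_derivative_works)
    show "Ck_on k (\<lambda>x. h (f x) (frechet_derivative g (at x) v)
        + h (frechet_derivative f (at x) v) (g x)) S" for v
      using Suc.prems Ck_on_SucD[OF Suc.prems(1)] Ck_on_SucD[OF Suc.prems(2)]
      by (intro Ck_on_add[OF assms(1)] Suc.IH) auto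
  qed
qed

text \<open>Apart from the derivative of \<open>f\<close>, the derivative involves only the inverse
  itself, so the induction runs with \<open>f\<close> fixed.\<close>

lemma Ck_on_inverse:
  fixes f :: "'a::real_normed_vector \<Rightarrow> real"
  assumes "open S" "Ck_on k f S" "\<And>x. x \<in> S \<Longrightarrow> f x \<noteq> 0"
  shows "Ck_on k (\<lambda>x. inverse (f x)) S"
  using assms(2)
proof (induction k)
  case 0
  then show ?case using assms(3) by (auto intro!: continuous_intros)
next
  case (Suc k)
  show ?case
  proof (rule Ck_on_SucI[OF assms(1)])
    show "((\<lambda>x. inverse (f x)) has_derivative
        (\<lambda>v. - (inverse (f x) * frechet_derivative f (at x) v * inverse (f x)))) (at x)"
      if "x \<in> S" for x
      using Suc.prems that assms(3)
      by (intro Deriv.has_derivative_inverse) (simp_all add: frechet_derivative_works)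
    show "Ck_on k (\<lambda>x. - (inverse (f x) * frechet_derivative f (at x) v * inverse (f x))) S" for v
      using Suc Ck_on_SucD[OF Suc.prems]
      by (intro Ck_on_linear_compose[OF assms(1) bounded_linear_minus[OF bounded_linear_ident]]
          Ck_on_bilinear[OF assms(1) bounded_bilinear_mult]) auto
  qed
qed

lemma Ck_on_sqrt:
  assumes "open S" "Ck_on k f S" "\<And>x. x \<in> S \<Longrightarrow> f x > 0"
  shows "Ck_on k (\<lambda>x. sqrt (f x)) S"
  using assms(2)
proof (induction k)
  case 0
  then show ?case by (auto intro!: continuous_intros)
next
  case (Suc k)
  show ?case
  proof (rule Ck_on_SucI[OF assms(1)])
    show "((\<lambda>x. sqrt (f x)) has_derivative
        (\<lambda>v. (frechet_derivative f (at x) v * inverse (sqrt (f x))) / 2)) (at x)"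
      if "x \<in> S" for x
      using Suc.prems that assms(3)[OF that]
        has_derivative_real_sqrt[of f x "frechet_derivative f (at x)" UNIV]
      by (simp add: frechet_derivative_works)
    have "sqrt (f x) \<noteq> 0" if "x \<in> S" for x using assms(3)[OF that] by simp
    then show "Ck_on k (\<lambda>x. (frechet_derivative f (at x) v * inverse (sqrt (f x))) / 2) S" for v
      using Suc Ck_on_SucD[OF Suc.prems]
      by (intro Ck_on_linear_compose[OF assms(1) bounded_linear_divide]
          Ck_on_bilinear[OF assms(1) bounded_bilinear_mult] Ck_on_inverse[OF assms(1)]) auto
  qed
qed

context
  fixes S :: "'a::real_normed_vector set"
  assumes S: "open S"
begin

lemma smooth_map_on_const: "smooth_map_on S (\<lambda>x. c)"
  by (simp add: smooth_map_on_def Ck_on_const)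

lemma smooth_map_on_bounded_linear: "bounded_linear f \<Longrightarrow> smooth_map_on S f"
  by (simp add: smooth_map_on_def Ck_on_bounded_linear)

lemma smooth_map_on_linear_compose:
  "bounded_linear h \<Longrightarrow> smooth_map_on S f \<Longrightarrow> smooth_map_on S (\<lambda>x. h (f x))"
  unfolding smooth_map_on_def using Ck_on_linear_compose[OF S] by blast

lemma smooth_map_on_add:
  "smooth_map_on S f \<Longrightarrow> smooth_map_on S g \<Longrightarrow> smooth_map_on S (\<lambda>x. f x + g x)"
  unfolding smooth_map_on_def using Ck_on_add[OF S] by blast

lemma smooth_map_on_minus: "smooth_map_on S f \<Longrightarrow> smooth_map_on S (\<lambda>x. - f x)"
  by (rule smooth_map_on_linear_compose[OF bounded_linear_minus[OF bounded_linear_ident]])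

lemma smooth_map_on_diff:
  "smooth_map_on S f \<Longrightarrow> smooth_map_on S g \<Longrightarrow> smooth_map_on S (\<lambda>x. f x - g x)"
  using smooth_map_on_add[of f "\<lambda>x. - g x"] smooth_map_on_minus[of g] by simp

lemma smooth_map_on_bilinear:
  "bounded_bilinear h \<Longrightarrow> smooth_map_on S f \<Longrightarrow> smooth_map_on S g
    \<Longrightarrow> smooth_map_on S (\<lambda>x. h (f x) (g x))"
  unfolding smooth_map_on_def using Ck_on_bilinear[OF S] by blast

lemmas smooth_map_on_mult = smooth_map_on_bilinear[OF bounded_bilinear_mult]
  and smooth_map_on_scaleR = smooth_map_on_bilinear[OF bounded_bilinear_scaleR]
  and smooth_map_on_inner = smooth_map_on_bilinear[OF bounded_bilinear_inner]

lemma smooth_map_on_sum: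
  "(\<And>i. i \<in> I \<Longrightarrow> smooth_map_on S (f i)) \<Longrightarrow> smooth_map_on S (\<lambda>x. \<Sum>i\<in>I. f i x)"
proof (induction I rule: infinite_finite_induct)
  case (insert i I)
  then show ?case
    using smooth_map_on_add[of "f i" "\<lambda>x. \<Sum>i\<in>I. f i x"] by simp
qed (simp_all add: smooth_map_on_const)

lemma smooth_map_on_divide:
  fixes f g :: "'a \<Rightarrow> real"
  shows "smooth_map_on S f \<Longrightarrow> smooth_map_on S g \<Longrightarrow> (\<And>x. x \<in> S \<Longrightarrow> g x \<noteq> 0)
    \<Longrightarrow> smooth_map_on S (\<lambda>x. f x / g x)"
  unfolding divide_inverse
  by (rule smooth_map_on_mult) (auto simp only: smooth_map_on_def intro!: Ck_on_inverse[OF S])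

lemma smooth_map_on_sqrt:
  "smooth_map_on S f \<Longrightarrow> (\<And>x. x \<in> S \<Longrightarrow> f x > 0) \<Longrightarrow> smooth_map_on S (\<lambda>x. sqrt (f x))"
  unfolding smooth_map_on_def using Ck_on_sqrt[OF S] by blast

lemma smooth_map_on_norm:
  fixes f :: "'a \<Rightarrow> 'b::real_inner"
  shows "smooth_map_on S f \<Longrightarrow> (\<And>x. x \<in> S \<Longrightarrow> f x \<noteq> 0) \<Longrightarrow> smooth_map_on S (\<lambda>x. norm (f x))"
  unfolding norm_eq_sqrt_inner by (rule smooth_map_on_sqrt[OF smooth_map_on_inner]) auto

lemma smooth_map_on_vec:
  fixes f :: "'i::finite \<Rightarrow> 'a \<Rightarrow> 'b::euclidean_space"
  assumes "\<And>i. smooth_map_on S (f i)"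
  shows "smooth_map_on S (\<lambda>x. \<chi> i. f i x)"
proof -
  have "linear (axis i :: 'b \<Rightarrow> ('b, 'i) vec)" for i :: 'i
    by (rule linearI) (auto simp: axis_def vec_eq_iff)
  then have "bounded_linear (axis i :: 'b \<Rightarrow> ('b, 'i) vec)" for i :: 'i
    by (rule linear_conv_bounded_linear[THEN iffD1])
  then have "smooth_map_on S (\<lambda>x. \<Sum>i\<in>UNIV. axis i (f i x))"
    by (intro smooth_map_on_sum smooth_map_on_linear_compose[OF _ assms])
  also have "(\<lambda>x. \<Sum>i\<in>UNIV. axis i (f i x)) = (\<lambda>x. \<chi> i. f i x)"
    by (auto simp: vec_eq_iff axis_def fun_eq_iff if_distrib cong: if_cong)
  finally show ?thesis .
qed

lemma smooth_map_on_imp_continuous_on: "smooth_map_on S f \<Longrightarrow> continuous_on S f"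
  unfolding smooth_map_on_def by (metis Ck_on.simps(1))

lemma smooth_map_on_derivative:
  assumes "smooth_map_on S f" "x \<in> S"
  shows "(f has_derivative frechet_derivative f (at x)) (at x)"
proof -
  have "Ck_on (Suc 0) f S" using assms(1) by (simp only: smooth_map_on_def)
  then show ?thesis using assms(2) by (simp add: frechet_derivative_works[symmetric])
qed

lemma smooth_map_on_frechet:
  assumes "smooth_map_on S f"
  shows "smooth_map_on S (\<lambda>x. frechet_derivative f (at x) v)"
proof -
  have "Ck_on (Suc k) f S" for k using assms by (simp only: smooth_map_on_def)
  then show ?thesis by (simp add: smooth_map_on_def)
qed

end

lemma smooth_map_on_subset: "smooth_map_on S f \<Longrightarrow> T \<subseteq> S \<Longrightarrow> smooth_map_on T f"
  unfolding smooth_map_on_def using Ck_on_subset by blast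

section \<open>Cyclic indices and blocks\<close>

lemma less_next_ix_iff:
  fixes i j :: "'n::{finite,linorder}"
  assumes "i \<noteq> Max UNIV" shows "j < next_ix i \<longleftrightarrow> j \<le> i"
proof -
  have "i < Max UNIV" using assms by (simp add: less_le)
  then have "{j. i < j} \<noteq> {}" by blast
  then have "next_ix i \<in> {j. i < j}" and "\<And>l. i < l \<Longrightarrow> next_ix i \<le> l"
    using Min_in[of "{j. i < j}"] assms by (auto simp: next_ix_def)
  then show ?thesis by (metis leD le_less_trans mem_Collect_eq not_less)
qed

lemma next_ix_Max: "next_ix (Max UNIV :: 'n::{finite,linorder}) = Min UNIV"
  by (simp add: next_ix_def)

lemma bij_next_ix: "bij (next_ix :: 'n::{finite,linorder} \<Rightarrow> 'n)"
proof -
  have "inj (next_ix :: 'n \<Rightarrow> 'n)"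
  proof (rule injI)
    fix i j :: 'n
    assume eq: "next_ix i = next_ix j"
    have no: "next_ix l \<noteq> Min UNIV" if "l \<noteq> Max UNIV" for l :: 'n
      using less_next_ix_iff[OF that, of l] by (metis Min_le UNIV_I finite leD order_refl)
    show "i = j"
    proof (cases "i = Max UNIV \<or> j = Max UNIV")
      case True
      then show ?thesis using eq no next_ix_Max by metis
    next
      case False
      then have "l \<le> i \<longleftrightarrow> l \<le> j" for l using eq less_next_ix_iff by metis
      then show ?thesis by (meson order_antisym order_refl)
    qed
  qed
  then show ?thesis by (simp add: bij_def finite_UNIV_inj_surj)
qed

lemma sum_next_ix:
  fixes f :: "'n::{finite,linorder} \<Rightarrow> 'a::comm_monoid_add"
  shows "(\<Sum>i\<in>UNIV. f (next_ix i)) = (\<Sum>i\<in>UNIV. f i)"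
  by (rule sum.reindex_bij_betw[OF bij_next_ix])

lemma sum_next_ix_diff:
  fixes f :: "'n::{finite,linorder} \<Rightarrow> 'a::ab_group_add"
  shows "(\<Sum>i\<in>UNIV. f (next_ix i) - f i) = 0"
  by (simp add: sum_subtractf sum_next_ix)

text \<open>Partial sums are a discrete primitive. At the maximal index the step wraps around to the
  empty sum, which is consistent because the total vanishes. Polygons are rebuilt from their edges
  in this way, and vertex functions from their differences.\<close>

lemma sum_lessThan_next_ix:
  fixes d :: "'n::{finite,linorder} \<Rightarrow> 'a::ab_group_add"
  assumes "(\<Sum>i\<in>UNIV. d i) = 0"
  shows "(\<Sum>j\<in>{..<next_ix i}. d j) = (\<Sum>j\<in>{..<i}. d j) + d i"
proof -
  have "{..i} = insert i {..<i}" by auto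
  then have ins: "sum d {..i} = sum d {..<i} + d i" by (simp add: add.commute)
  show ?thesis
  proof (cases "i = Max UNIV")
    case True
    have "{..<next_ix i} = {}" "{..i} = UNIV" unfolding True next_ix_Max by (auto simp: not_less)
    then show ?thesis using assms ins by simp
  next
    case False
    then have "{..<next_ix i} = {..i}" by (auto simp: less_next_ix_iff)
    then show ?thesis using ins by simp
  qed
qed

text \<open>The successor map acts transitively: the least index with a deviating value would have a
  predecessor with the same value. This serves as induction around the polygon.\<close>

lemma next_ix_invariant_const:
  fixes f :: "'n::{finite,linorder} \<Rightarrow> 'a"
  assumes "\<And>i. f (next_ix i) = f i" shows "f i = f j"
proof -
  have "f i = f (Min UNIV)" for i
  proof (rule ccontr)
    assume "f i \<noteq> f (Min UNIV)"
    then have ne: "{i. f i \<noteq> f (Min UNIV)} \<noteq> {}" by auto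
    define m where "m = Min {i. f i \<noteq> f (Min UNIV)}"
    have m: "f m \<noteq> f (Min UNIV)" and least: "\<And>l. f l \<noteq> f (Min UNIV) \<Longrightarrow> m \<le> l"
      using Min_in[OF _ ne] unfolding m_def by auto
    obtain p where p: "next_ix p = m" using bij_next_ix by (metis bij_pointE)
    then have "p \<noteq> Max UNIV" using m next_ix_Max by metis
    then have "p < m" using p less_next_ix_iff by blast
    then have "f p = f (Min UNIV)" using least leD by blast
    then show False using m p assms by metis
  qed
  then show ?thesis by metis
qed

lemma next_ix_nth_sorted:
  fixes xs :: "'n::{finite,linorder} list"
  assumes "xs = sorted_list_of_set UNIV" "k < length xs"
  shows "next_ix (xs ! k) = (if Suc k < length xs then xs ! Suc k else Min UNIV)"
proof -
  have xs: "sorted_wrt (<) xs" "set xs = UNIV"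
    using assms(1) strict_sorted_list_of_set by simp_all
  have le: "i \<le> j" if "xs ! i \<le> xs ! j" "i < length xs" "j < length xs" for i j
    using xs(1) that by (meson leD not_le sorted_wrt_nth_less)
  have le': "xs ! i \<le> xs ! j" if "i \<le> j" "j < length xs" for i j
    using xs(1) that by (metis le_neq_implies_less less_imp_le order_refl sorted_wrt_nth_less)
  have ex: "\<exists>j<length xs. x = xs ! j" for x using xs(2) by (metis UNIV_I in_set_conv_nth)
  show ?thesis
  proof (cases "Suc k < length xs")
    case True
    have "\<not> xs ! Suc k \<le> xs ! k" using le[of "Suc k" k] True by auto
    then have "xs ! k \<noteq> Max UNIV" by (metis Max_ge UNIV_I finite)
    have "x < next_ix (xs ! k) \<longleftrightarrow> x < xs ! Suc k" for x
    proof -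
      obtain j where j: "j < length xs" "x = xs ! j" using ex by blast
      have "x \<le> xs ! k \<longleftrightarrow> j \<le> k" using j le[of j k] le'[of j k] assms(2) by auto
      moreover have "x < xs ! Suc k \<longleftrightarrow> \<not> Suc k \<le> j"
        using le[of "Suc k" j] le'[of "Suc k" j] True j by (auto simp: not_le[symmetric])
      ultimately show ?thesis
        using less_next_ix_iff[OF \<open>xs ! k \<noteq> Max UNIV\<close>, of x] by (simp add: Suc_le_eq not_less)
    qed
    then have "next_ix (xs ! k) = xs ! Suc k" by (metis less_irrefl neqE)
    then show ?thesis using True by simp
  next
    case False
    have "x \<le> xs ! k" for x using ex[of x] le'[of _ k] False assms(2) by auto
    then have "xs ! k = Max UNIV" by (intro Max_eqI[symmetric]) auto
    then show ?thesis using False next_ix_Max by simp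
  qed
qed

section \<open>Positions and the partition of the indices into beads\<close>

lemma bij_betw_pos: "bij_betw pos (UNIV :: 'n::{finite,linorder} set) {..<CARD('n)}"
proof -
  have mono: "pos i < pos j" if "i < j" for i j :: 'n
    unfolding pos_def using that by (intro psubset_card_mono) auto
  have inj: "inj (pos :: 'n \<Rightarrow> nat)" by (rule injI) (metis less_irrefl mono neqE)
  have "pos i < CARD('n)" for i :: 'n
    unfolding pos_def by (intro psubset_card_mono) auto
  then have "range (pos :: 'n \<Rightarrow> nat) \<subseteq> {..<CARD('n)}" by auto
  then have "range (pos :: 'n \<Rightarrow> nat) = {..<CARD('n)}"
    by (rule card_subset_eq[rotated]) (simp_all add: card_image[OF inj])
  then show ?thesis using inj by (simp add: bij_betw_def)
qed

definition bead :: "('k::{finite,linorder}) necklace \<Rightarrow> 'n::{finite,linorder} \<Rightarrow> 'k" where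
  "bead N i = (THE j. i \<in> block N j)"

context
  fixes N :: "('k::{finite,linorder}) necklace"
  assumes total: "(\<Sum>j\<in>UNIV. bd_num N j) = CARD('n::{finite,linorder})"
begin

lemma block_unique: "\<exists>!j. (i::'n) \<in> block N j"
proof -
  let ?S = "{j. pos i < (\<Sum>j'\<in>{..j}. bd_num N j')}"
  have "pos i < CARD('n)" using bij_betw_pos[where 'n='n] by (auto simp: bij_betw_def)
  moreover have "{..Max (UNIV :: 'k set)} = UNIV" by auto
  ultimately have "Max UNIV \<in> ?S" using total by simp
  then have ne: "?S \<noteq> {}" by blast
  define j where "j = Min ?S"
  have j: "j \<in> ?S" and least: "\<And>l. l \<in> ?S \<Longrightarrow> j \<le> l"
    using Min_in[OF _ ne] unfolding j_def by auto
  have "(\<Sum>j'\<in>{..<j}. bd_num N j') \<le> pos i"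
  proof (cases "{..<j} = {}")
    case False
    \<comment> \<open>The largest index below \<open>j\<close> stands in for a predecessor; it fails
      the inequality that \<open>j\<close> is the first to satisfy.\<close>
    then have "Max {..<j} \<in> {..<j}" by (intro Max_in) auto
    moreover have "l \<le> Max {..<j}" if "l < j" for l using that by simp
    ultimately have "{..<j} = {..Max {..<j}}" by (auto intro: le_less_trans)
    moreover have "Max {..<j} \<notin> ?S" using least \<open>Max {..<j} \<in> {..<j}\<close> by fastforce
    ultimately show ?thesis by (metis mem_Collect_eq not_less)
  qed simp
  then have ex: "i \<in> block N j" using j by (simp add: block_def)
  have mono: "(\<Sum>j'\<in>{..l}. bd_num N j') \<le> (\<Sum>j'\<in>{..<l'}. bd_num N j')" if "l < l'" for l l'
    using that by (intro sum_mono2) auto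
  have "l = l'" if "i \<in> block N l" "i \<in> block N l'" for l l'
  proof (rule ccontr)
    assume "l \<noteq> l'"
    then have "l < l' \<or> l' < l" by auto
    then show False using that mono[of l l'] mono[of l' l] unfolding block_def by auto
  qed
  with ex show ?thesis by blast
qed

lemma in_block_iff: "(i::'n) \<in> block N j \<longleftrightarrow> bead N i = j"
  unfolding bead_def by (metis block_unique theI_unique)

lemma block_eq: "block N j = {i::'n. bead N i = j}"
  by (auto simp: in_block_iff)

lemma sum_blocks:
  fixes f :: "'n \<Rightarrow> 'a::comm_monoid_add"
  shows "(\<Sum>j\<in>UNIV. \<Sum>i\<in>block N j. f i) = (\<Sum>i\<in>UNIV. f i)"
  using sum.group[of UNIV UNIV "bead N" f] by (simp add: block_eq)

lemma card_block: "card (block N j :: 'n set) = bd_num N j"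
proof -
  have "{..j} = insert j {..<j}" by auto
  then have upper: "(\<Sum>j'\<in>{..j}. bd_num N j') = (\<Sum>j'\<in>{..<j}. bd_num N j') + bd_num N j" by simp
  have "(\<Sum>j'\<in>{..j}. bd_num N j') \<le> CARD('n)"
    unfolding total[symmetric] by (intro sum_mono2) auto
  then have "pos ` (block N j :: 'n set) = {(\<Sum>j'\<in>{..<j}. bd_num N j')..<(\<Sum>j'\<in>{..j}. bd_num N j')}"
    using bij_betw_pos[where 'n='n] unfolding block_def bij_betw_def
    by (auto simp: image_iff set_eq_iff) (metis lessThan_iff order_less_le_trans rangeE)
  moreover have "inj_on pos (block N j :: 'n set)"
    using bij_betw_pos[where 'n='n] by (auto simp: bij_betw_def intro: inj_on_subset)
  ultimately show ?thesis using upper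
    by (metis add_diff_cancel_left' card_atLeastLessThan card_image)
qed

end

section \<open>The negative index of a symmetric bilinear form\<close>

definition neg_def_on :: "('a::euclidean_space \<Rightarrow> 'a \<Rightarrow> real) \<Rightarrow> 'a set \<Rightarrow> bool" where
  "neg_def_on B W \<longleftrightarrow> (\<forall>x\<in>W. x \<noteq> 0 \<longrightarrow> B x x < 0)"

text \<open>A relation with attainment and bound as separate conjuncts, so that each can be
  transported on its own.\<close>

definition has_index :: "('a::euclidean_space \<Rightarrow> 'a \<Rightarrow> real) \<Rightarrow> 'a set \<Rightarrow> nat \<Rightarrow> bool" where
  "has_index B S m \<longleftrightarrow>
     (\<exists>W. subspace W \<and> W \<subseteq> S \<and> neg_def_on B W \<and> dim W = m) \<and>
     (\<forall>W. subspace W \<longrightarrow> W \<subseteq> S \<longrightarrow> neg_def_on B W \<longrightarrow> dim W \<le> m)"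

lemma has_indexE:
  assumes "has_index B S m"
  obtains W where "subspace W" "W \<subseteq> S" "neg_def_on B W" "dim W = m"
  using assms unfolding has_index_def by blast

lemma has_index_upper:
  "has_index B S m \<Longrightarrow> subspace W \<Longrightarrow> W \<subseteq> S \<Longrightarrow> neg_def_on B W \<Longrightarrow> dim W \<le> m"
  unfolding has_index_def by blast

lemma dim_linear_image_inj:
  fixes f :: "'a::euclidean_space \<Rightarrow> 'b::euclidean_space"
  assumes "linear f" "subspace W" "\<And>x. x \<in> W \<Longrightarrow> f x = 0 \<Longrightarrow> x = 0"
  shows "dim (f ` W) = dim W"
proof -
  have "inj_on f W"
  proof (rule inj_onI)
    fix x y assume "x \<in> W" "y \<in> W" "f x = f y"
    then have "f (x - y) = 0" "x - y \<in> W"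
      using assms(1,2) by (simp_all add: linear_diff subspace_diff)
    then show "x = y" using assms(3) by fastforce
  qed
  then have "inj_on f (span W)" unfolding span_eq_iff[THEN iffD2, OF assms(2)] .
  then show ?thesis by (rule dim_image_eq[OF assms(1)])
qed

lemma dim_kernel_functional:
  fixes f :: "'a::euclidean_space \<Rightarrow> real"
  assumes "linear f" "subspace W"
  shows "dim W \<le> Suc (dim {x \<in> W. f x = 0})"
proof (cases "\<exists>w\<in>W. f w \<noteq> 0")
  case True
  then obtain w where w: "w \<in> W" "f w \<noteq> 0" by blast
  let ?K = "{x \<in> W. f x = 0}"
  have "W \<subseteq> span (insert w ?K)"
  proof
    fix x assume x: "x \<in> W"
    have "x - (f x / f w) *\<^sub>R w \<in> ?K"
      using assms w x by (simp add: linear_diff linear_cmul subspace_diff subspace_scale)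
    then have "x - (f x / f w) *\<^sub>R w \<in> span ?K" by (rule span_base)
    then show "x \<in> span (insert w ?K)" unfolding span_insert by blast
  qed
  then have "dim W \<le> dim (insert w ?K)" by (metis dim_span dim_subset)
  also have "\<dots> \<le> Suc (dim ?K)" by (simp add: dim_insert)
  finally show ?thesis .
next
  case False
  then have "{x \<in> W. f x = 0} = W" by auto
  then show ?thesis by simp
qed

text \<open>The map may have a kernel. A negative definite subspace lifts along a linear right
  inverse, and it projects injectively, since a vector killed by \<open>h\<close> has square
  zero.\<close>

lemma has_index_transport:
  fixes h :: "'a::euclidean_space \<Rightarrow> 'b::euclidean_space"
  assumes "linear h" "subspace R" "h ` R = S"
    and "\<And>x. x \<in> R \<Longrightarrow> B x x = C (h x) (h x)" "C 0 0 = 0" "has_index C S m"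
  shows "has_index B R m"
  unfolding has_index_def
proof (intro conjI allI impI)
  obtain W where W: "subspace W" "W \<subseteq> S" "neg_def_on C W" "dim W = m"
    using assms(6) by (rule has_indexE)
  obtain g where g: "range g \<subseteq> R" "linear g" "\<And>v. v \<in> S \<Longrightarrow> h (g v) = v"
    using linear_exists_right_inverse_on[OF assms(1,2)] assms(3) by blast
  have "neg_def_on B (g ` W)"
    unfolding neg_def_on_def
  proof (intro ballI impI)
    fix x assume "x \<in> g ` W" "x \<noteq> 0"
    then obtain w where w: "w \<in> W" "x = g w" by blast
    then have "w \<noteq> 0" using \<open>x \<noteq> 0\<close> g(2) linear_0 by blast
    then have "C w w < 0" using W(3) w by (simp add: neg_def_on_def)
    moreover have "B x x = C w w" using assms(4)[of x] w g W(2) by (metis rangeI subsetD)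
    ultimately show "B x x < 0" by simp
  qed
  moreover have "dim (g ` W) = dim W"
    using g W by (intro dim_linear_image_inj) (metis subsetD linear_0[OF assms(1)])+
  ultimately show "\<exists>W. subspace W \<and> W \<subseteq> R \<and> neg_def_on B W \<and> dim W = m"
    using W g by (intro exI[of _ "g ` W"]) (auto intro: linear_subspace_image)
next
  fix W assume W: "subspace W" "W \<subseteq> R" "neg_def_on B W"
  have "dim (h ` W) = dim W"
  proof (rule dim_linear_image_inj[OF assms(1) W(1)])
    fix x assume "x \<in> W" "h x = 0"
    then have "B x x = 0" using assms(4,5) W by auto
    then show "x = 0" using W(3) \<open>x \<in> W\<close> by (auto simp: neg_def_on_def)
  qed
  moreover have "neg_def_on C (h ` W)"
    unfolding neg_def_on_def
  proof (intro ballI impI)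
    fix y assume "y \<in> h ` W" "y \<noteq> 0"
    then obtain x where x: "x \<in> W" "y = h x" by blast
    then have "x \<noteq> 0" using \<open>y \<noteq> 0\<close> assms(1) linear_0 by blast
    then have "B x x < 0" using W(3) x(1) by (simp add: neg_def_on_def)
    moreover have "x \<in> R" using W(2) x(1) by blast
    ultimately show "C y y < 0" using assms(4) x(2) by simp
  qed
  moreover have "h ` W \<subseteq> S" using W(2) assms(3) by auto
  ultimately show "dim W \<le> m"
    using has_index_upper[OF assms(6) linear_subspace_image[OF assms(1) W(1)]] by simp
qed

locale sym_form =
  fixes B :: "'a::euclidean_space \<Rightarrow> 'a \<Rightarrow> real"
  assumes bilin: "bilinear B" and sym: "B x y = B y x"
begin

lemma linear_left: "linear (\<lambda>x. B x y)" and linear_right: "linear (B x)"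
  using bilin by (auto simp: bilinear_def)

lemma subspace_perp: "subspace S \<Longrightarrow> subspace {x \<in> S. B x z = 0}"
  using bilin unfolding subspace_def by (auto simp: bilinear_ladd bilinear_lmul bilinear_lzero)

lemmas bil_simps = bilinear_ladd[OF bilin] bilinear_radd[OF bilin] bilinear_lmul[OF bilin]
  bilinear_rmul[OF bilin] bilinear_lsub[OF bilin] bilinear_rsub[OF bilin]
  bilinear_lzero[OF bilin] bilinear_rzero[OF bilin]

text \<open>Adding \<open>z\<close> to a negative definite subspace orthogonal to it keeps it
  negative definite, which bounds the index; cutting a maximal one by a single linear equation loses
  at most one dimension, which attains the bound.\<close>

lemma has_index_perp_neg:
  assumes "has_index B S m" "subspace S" "z \<in> S" "B z z < 0"
  shows "0 < m \<and> has_index B {x \<in> S. B x z = 0} (m - 1)"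
proof -
  let ?R = "{x \<in> S. B x z = 0}"
  have upper: "Suc (dim W) \<le> m" if W: "subspace W" "W \<subseteq> ?R" "neg_def_on B W" for W
  proof -
    have "z \<notin> span W" using W assms(4) by (auto simp: span_eq_iff[THEN iffD2])
    then have "dim (span (insert z W)) = Suc (dim W)" by (simp add: dim_insert)
    moreover have "span (insert z W) \<subseteq> S"
      using W assms(2,3) by (intro span_minimal) auto
    moreover have "neg_def_on B (span (insert z W))"
      unfolding neg_def_on_def
    proof (intro ballI impI)
      fix x assume x: "x \<in> span (insert z W)" "x \<noteq> 0"
      then obtain c where "x - c *\<^sub>R z \<in> W"
        using W(1) unfolding span_insert by (auto simp: span_eq_iff[THEN iffD2])
      then obtain w where w: "w \<in> W" "x = w + c *\<^sub>R z" by (metis diff_add_cancel)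
      have "B w z = 0" "B z w = 0" using W w sym[of z w] by auto
      then have eq: "B x x = B w w + c\<^sup>2 * B z z" unfolding w
        by (simp add: bil_simps power2_eq_square)
      have "B w w \<le> 0" "w \<noteq> 0 \<Longrightarrow> B w w < 0"
        using W(3) w unfolding neg_def_on_def by (cases "w = 0"; auto simp: bil_simps)+
      moreover have "c \<noteq> 0 \<Longrightarrow> c\<^sup>2 * B z z < 0" using assms(4) by (simp add: mult_pos_neg)
      moreover have "c \<noteq> 0 \<or> w \<noteq> 0" using x w by auto
      ultimately show "B x x < 0" unfolding eq by (cases "c = 0") auto
    qed
    ultimately show ?thesis
      using has_index_upper[OF assms(1), of "span (insert z W)"] by auto
  qed
  obtain W where W: "subspace W" "W \<subseteq> S" "neg_def_on B W" "dim W = m"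
    using assms(1) by (rule has_indexE)
  let ?W = "{x \<in> W. B x z = 0}"
  have sub: "subspace ?W" "?W \<subseteq> ?R" "neg_def_on B ?W"
    using W subspace_perp by (auto simp: neg_def_on_def)
  have "m \<le> Suc (dim ?W)" using dim_kernel_functional[OF linear_left W(1)] W(4) by simp
  then have "dim ?W = m - 1" "0 < m" using upper[OF sub] by auto
  then show ?thesis
    unfolding has_index_def using sub upper by (intro conjI exI[of _ ?W]) (auto dest: upper)
qed

text \<open>Orthogonal projection along \<open>z\<close> subtracts a non-negative amount from
  \<open>B x x\<close>, so it carries a maximal negative definite subspace injectively into the
  complement of \<open>z\<close>.\<close>

lemma has_index_perp_pos:
  assumes "has_index B S m" "subspace S" "z \<in> S" "B z z > 0"
  shows "has_index B {x \<in> S. B x z = 0} m"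
proof -
  obtain W where W: "subspace W" "W \<subseteq> S" "neg_def_on B W" "dim W = m"
    using assms(1) by (rule has_indexE)
  define p where "p x = x - (B x z / B z z) *\<^sub>R z" for x
  have "linear p"
    unfolding p_def by (rule linearI) (simp_all add: bil_simps algebra_simps add_divide_distrib)
  have perp: "B (p x) z = 0" for x using assms(4) by (simp add: p_def bil_simps)
  have p: "B (p x) (p x) \<le> B x x" for x
  proof -
    have "B (p x) (p x) = B x x - (B x z)\<^sup>2 / B z z"
      using assms(4) sym[of z x] by (simp add: p_def bil_simps field_simps power2_eq_square)
    then show ?thesis using assms(4) by simp
  qed
  have neg: "B (p x) (p x) < 0" if "x \<in> W" "x \<noteq> 0" for x
    using p[of x] W(3) that by (force simp: neg_def_on_def)
  have "dim (p ` W) = m"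
    using dim_linear_image_inj[OF \<open>linear p\<close> W(1)] neg W(4) by (force simp: bil_simps)
  moreover have "neg_def_on B (p ` W)"
    unfolding neg_def_on_def using neg \<open>linear p\<close> linear_0 by fastforce
  moreover have "p ` W \<subseteq> {x \<in> S. B x z = 0}"
    using W(2) assms(2,3) perp by (auto simp: p_def intro!: subspace_diff subspace_scale)
  ultimately show ?thesis
    using assms(1) linear_subspace_image[OF \<open>linear p\<close> W(1)] unfolding has_index_def by blast
qed

text \<open>A partner \<open>y\<close> not orthogonal to \<open>z\<close> completes it to a
  hyperbolic plane, which splits into a negative vector \<open>n\<close> and a positive vector
  \<open>q\<close>. Removing both costs one negative square; the complement of \<open>z\<close>
  differs from what remains only by the line of \<open>z\<close>, which lies in the radical
  there.\<close>

lemma has_index_perp_isotropic: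
  assumes "has_index B S m" "subspace S" "z \<in> S" "B z z = 0" "y \<in> S" "B y z \<noteq> 0"
  shows "0 < m \<and> has_index B {x \<in> S. B x z = 0} (m - 1)"
proof -
  \<comment> \<open>Solves \<open>B y y + 2 * c * B y z = - 1\<close>, where the left side is the
    square of \<open>n\<close>.\<close>
  define c where "c = - (1 + B y y) / (2 * B y z)"
  define n where "n = y + c *\<^sub>R z"
  have nS: "n \<in> S" using assms by (simp add: n_def subspace_add subspace_scale)
  have nz: "B n z = B y z" "B z n = B y z" using assms(4) sym by (simp_all add: n_def bil_simps)
  have "B n n = B y y + 2 * c * B y z"
    using assms(4) sym[of z y] by (simp add: n_def bil_simps)
  also have "\<dots> = -1" using assms(6) by (simp add: c_def field_simps)
  finally have nn: "B n n = -1" .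
  let ?S1 = "{x \<in> S. B x n = 0}"
  have i1: "0 < m" "has_index B ?S1 (m - 1)"
    using has_index_perp_neg[OF assms(1,2) nS] nn by auto
  \<comment> \<open>The projection of \<open>z\<close> to the complement of \<open>n\<close>, whose
    square is \<open>- 1\<close>.\<close>
  define q where "q = z + B y z *\<^sub>R n"
  have "q \<in> ?S1" using assms nS nn nz by (simp add: q_def bil_simps subspace_add subspace_scale)
  moreover have "B q q = (B y z)\<^sup>2"
    using assms(4) nn nz by (simp add: q_def bil_simps power2_eq_square)
  ultimately have "has_index B {x \<in> ?S1. B x q = 0} (m - 1)"
    using has_index_perp_pos[OF i1(2) subspace_perp[OF assms(2)]] assms(6) by simp
  also have "{x \<in> ?S1. B x q = 0} = {x \<in> S. B x z = 0 \<and> B x n = 0}"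
    by (auto simp: q_def bil_simps)
  finally have i2: "has_index B {x \<in> S. B x z = 0 \<and> B x n = 0} (m - 1)" .
  \<comment> \<open>Moving along \<open>z\<close> does not change the form on the complement of
    \<open>z\<close>, and it can make \<open>x\<close> orthogonal to \<open>n\<close>.\<close>
  define h where "h x = x - (B x n / B y z) *\<^sub>R z" for x
  have "linear h"
    unfolding h_def by (rule linearI) (simp_all add: bil_simps algebra_simps add_divide_distrib)
  moreover have "h ` {x \<in> S. B x z = 0} = {x \<in> S. B x z = 0 \<and> B x n = 0}"
  proof safe
    fix x assume x: "x \<in> S" "B x z = 0"
    then show "h x \<in> S" using assms by (simp add: h_def subspace_diff subspace_scale)
    show "B (h x) z = 0" "B (h x) n = 0" using x assms nz by (simp_all add: h_def bil_simps)
  next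
    fix x assume x: "x \<in> S" "B x z = 0" "B x n = 0"
    then show "x \<in> h ` {x \<in> S. B x z = 0}" by (intro image_eqI[of _ _ x]) (simp_all add: h_def)
  qed
  moreover have "B x x = B (h x) (h x)" if "x \<in> {x \<in> S. B x z = 0}" for x
    using that assms(4) sym[of z x] by (simp add: h_def bil_simps)
  ultimately have "has_index B {x \<in> S. B x z = 0} (m - 1)"
    using has_index_transport[OF _ subspace_perp[OF assms(2)] _ _ _ i2, of h z B] bil_simps(7)
      by blast
  then show ?thesis using i1 by blast
qed

text \<open>Mutual orthogonality keeps each further vector inside the complement of the earlier
  ones, so the steps for a single vector can be iterated.\<close>

lemma has_index_perp_family:
  assumes "finite J" "has_index B S m" "subspace S"
    and "\<And>j. j \<in> J \<Longrightarrow> z j \<in> S" "\<And>j. j \<in> J \<Longrightarrow> B (z j) (z j) \<noteq> 0"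
    and "\<And>i j. i \<in> J \<Longrightarrow> j \<in> J \<Longrightarrow> i \<noteq> j \<Longrightarrow> B (z i) (z j) = 0"
  shows "card {j \<in> J. B (z j) (z j) < 0} \<le> m \<and>
    has_index B {x \<in> S. \<forall>j\<in>J. B x (z j) = 0} (m - card {j \<in> J. B (z j) (z j) < 0})"
  using assms(1,4-)
proof (induction J rule: finite_induct)
  case empty
  then show ?case using assms(2) by simp
next
  case (insert k J)
  let ?S = "{x \<in> S. \<forall>j\<in>J. B x (z j) = 0}" and ?c = "card {j \<in> J. B (z j) (z j) < 0}"
  have IH: "?c \<le> m" "has_index B ?S (m - ?c)" using insert by auto
  have sub: "subspace ?S"
    using assms(3) unfolding subspace_def by (auto simp: bil_simps)
  have zk: "z k \<in> ?S" using insert.prems insert.hyps by auto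
  have eq: "{x \<in> ?S. B x (z k) = 0} = {x \<in> S. \<forall>j\<in>insert k J. B x (z j) = 0}" by auto
  show ?case
  proof (cases "B (z k) (z k) < 0")
    case True
    then have "{j \<in> insert k J. B (z j) (z j) < 0} = insert k {j \<in> J. B (z j) (z j) < 0}" by auto
    then have "card {j \<in> insert k J. B (z j) (z j) < 0} = Suc ?c" using insert.hyps by simp
    then show ?thesis using has_index_perp_neg[OF IH(2) sub zk True] IH(1) unfolding eq
      by (simp add: Suc_le_eq)
  next
    case False
    then have "{j \<in> insert k J. B (z j) (z j) < 0} = {j \<in> J. B (z j) (z j) < 0}" by auto
    moreover have "B (z k) (z k) > 0" using False insert.prems(2)[of k] by simp
    ultimately show ?thesis using has_index_perp_pos[OF IH(2) sub zk] IH(1) unfolding eq by simp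
  qed
qed

end

text \<open>For the upper bound, the projection to the coordinates with negative coefficient is
  injective on a negative definite subspace, since a vector in its kernel has non-negative
  square.\<close>

lemma has_index_diagonal:
  fixes \<gamma> :: "'i::finite \<Rightarrow> real"
  shows "has_index (\<lambda>x y. \<Sum>i\<in>UNIV. \<gamma> i * x $ i * y $ i) (UNIV :: (real ^ 'i) set) (card {i. \<gamma> i <
    0})"
    (is "has_index ?B _ _")
proof -
  define E :: "(real ^ 'i) set" where "E = (\<lambda>i. axis i 1) ` {i. \<gamma> i < 0}"
  have cE: "card E = card {i. \<gamma> i < 0}"
    unfolding E_def by (rule card_image) (auto simp: inj_on_def axis_eq_axis)
  have "E \<subseteq> Basis" unfolding E_def Basis_vec_def by auto
  then have dE: "dim (span E) = card E"
    by (simp add: dim_eq_card_independent independent_mono[OF independent_Basis])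
  have supp: "x $ i = 0" if "x \<in> span E" "\<not> \<gamma> i < 0" for x :: "real ^ 'i" and i
    using that(1)
  proof (induction rule: span_induct_alt)
    case (step c x y)
    then show ?case using that(2) by (auto simp: E_def axis_def split: if_splits)
  qed simp
  have "neg_def_on ?B (span E)"
    unfolding neg_def_on_def
  proof (intro ballI impI)
    fix x assume x: "x \<in> span E" "x \<noteq> 0"
    have le: "\<gamma> i * x $ i * x $ i \<le> 0" for i
      using supp[OF x(1), of i] by (cases "\<gamma> i < 0") (auto simp: mult_nonpos_nonneg mult.assoc)
    obtain i where i: "x $ i \<noteq> 0" using x(2) by (auto simp: vec_eq_iff)
    then have "\<gamma> i < 0" using supp[OF x(1)] by blast
    then have "\<gamma> i * x $ i * x $ i < 0"
      using i by (auto simp: mult.assoc mult_less_0_iff zero_less_mult_iff linorder_neq_iff)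
    then have "(\<Sum>i\<in>UNIV. - (\<gamma> i * x $ i * x $ i)) > 0"
      using le by (intro sum_pos2[of _ i]) auto
    then show "?B x x < 0" by (simp add: sum_negf)
  qed
  moreover have "dim W \<le> card E" if W: "subspace W" "neg_def_on ?B W" for W
  proof -
    define p :: "real ^ 'i \<Rightarrow> real ^ 'i" where "p x = (\<chi> i. if \<gamma> i < 0 then x $ i else 0)" for x
    have "linear p" by (rule linearI) (auto simp: p_def vec_eq_iff)
    have "x = 0" if "x \<in> W" "p x = 0" for x
    proof (rule ccontr)
      assume "x \<noteq> 0"
      have "0 \<le> \<gamma> i * x $ i * x $ i" for i
        using that(2) by (cases "\<gamma> i < 0") (auto simp: p_def vec_eq_iff mult.assoc split: if_splits)
      then have "0 \<le> ?B x x" by (intro sum_nonneg) auto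
      then show False using W(2) \<open>x \<in> W\<close> \<open>x \<noteq> 0\<close> by (force simp: neg_def_on_def)
    qed
    then have "dim W = dim (p ` W)" using dim_linear_image_inj[OF \<open>linear p\<close> W(1)] by simp
    also have "\<dots> \<le> dim (span E)"
    proof (intro dim_subset subsetI)
      fix y assume "y \<in> p ` W"
      then obtain x where "y = p x" by blast
      also have "p x = (\<Sum>i\<in>{i. \<gamma> i < 0}. x $ i *\<^sub>R axis i 1)"
        by (auto simp: p_def vec_eq_iff axis_def if_distrib cong: if_cong)
      also have "\<dots> \<in> span E" by (intro span_sum span_scale span_base) (auto simp: E_def)
      finally show "y \<in> span E" .
    qed
    finally show ?thesis using dE by simp
  qed
  ultimately show ?thesis
    unfolding has_index_def using dE cE by (intro conjI exI[of _ "span E"]) auto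
qed

section \<open>Edges, block lengths and winding\<close>

definition cross :: "complex \<Rightarrow> complex \<Rightarrow> real" where
  "cross a b = Re a * Im b - Re b * Im a"

lemma cross_add_left: "cross (a + b) c = cross a c + cross b c"
  and cross_add_right: "cross a (b + c) = cross a b + cross a c"
  and cross_diff_left: "cross (a - b) c = cross a c - cross b c"
  and cross_diff_right: "cross a (b - c) = cross a b - cross a c"
  and cross_scaleR_left: "cross (r *\<^sub>R a) c = r * cross a c"
  and cross_scaleR_right: "cross a (r *\<^sub>R c) = r * cross a c"
  and cross_self: "cross a a = 0"
  and cross_skew: "cross a b = - cross b a"
  by (simp_all add: cross_def algebra_simps)

lemmas cross_simps = cross_add_left cross_add_right cross_diff_left cross_diff_right
  cross_scaleR_left cross_scaleR_right cross_self

text \<open>Cramer's rule.\<close>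

lemma cross_coordinates:
  assumes "cross u v \<noteq> 0"
  shows "\<exists>\<alpha> \<beta>. \<alpha> *\<^sub>R u + \<beta> *\<^sub>R v = w"
proof (intro exI)
  have "(cross w v / cross u v) * Re u + (cross u w / cross u v) * Re v = Re w"
    "(cross w v / cross u v) * Im u + (cross u w / cross u v) * Im v = Im w"
    using assms by (simp_all add: divide_simps) (simp_all add: cross_def algebra_simps)
  then show "(cross w v / cross u v) *\<^sub>R u + (cross u w / cross u v) *\<^sub>R v = w"
    by (simp add: complex_eq_iff)
qed

definition edge :: "('n::{finite,linorder}) polygon \<Rightarrow> 'n \<Rightarrow> complex" where
  "edge P i = P $ next_ix i - P $ i"

lemma edge_len_eq: "edge_len P i = norm (edge P i)"
  by (simp add: edge_len_def edge_def dist_norm)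

lemma edge_add: "edge (u + v) i = edge u i + edge v i"
  and edge_diff: "edge (u - v) i = edge u i - edge v i"
  and edge_scaleR: "edge (r *\<^sub>R u) i = r *\<^sub>R edge u i"
  by (simp_all add: edge_def algebra_simps)

lemma bounded_linear_edge: "bounded_linear (\<lambda>P. edge P i)"
  by (rule linear_conv_bounded_linear[THEN iffD1], rule linearI) (simp_all add: edge_add
    edge_scaleR)

lemma sum_edge: "(\<Sum>i\<in>UNIV. edge P i) = 0"
  unfolding edge_def by (rule sum_next_ix_diff)

lemma exists_polygon_with_edges:
  fixes w :: "'n::{finite,linorder} \<Rightarrow> complex"
  assumes "(\<Sum>i\<in>UNIV. w i) = 0"
  shows "edge (\<chi> i. p + (\<Sum>j\<in>{..<i}. w j)) i = w i"
  unfolding edge_def using sum_lessThan_next_ix[OF assms] by simp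

lemma polygon_eq_partial_sums:
  fixes P :: "('n::{finite,linorder}) polygon"
  shows "P $ i = P $ Min UNIV + (\<Sum>j\<in>{..<i}. edge P j)"
proof -
  define f where "f i = P $ i - (\<Sum>j\<in>{..<i}. edge P j)" for i
  have "f (next_ix i) = f i" for i
    unfolding f_def sum_lessThan_next_ix[OF sum_edge] by (simp add: edge_def)
  then have "f i = f (Min UNIV)" by (rule next_ix_invariant_const)
  moreover have "{..<Min (UNIV :: 'n set)} = {}" by (auto simp: not_less)
  ultimately show ?thesis by (simp add: f_def algebra_simps)
qed

section \<open>First variation of edge lengths and block lengths\<close>

definition edge_len_deriv :: "('n::{finite,linorder}) polygon \<Rightarrow> 'n \<Rightarrow> 'n polygon \<Rightarrow> real" where
  "edge_len_deriv P i v = edge P i \<bullet> edge v i / norm (edge P i)"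

lemma edge_len_deriv_add: "edge_len_deriv P i (u + v) = edge_len_deriv P i u + edge_len_deriv P i v"
  and edge_len_deriv_scaleR: "edge_len_deriv P i (r *\<^sub>R v) = r * edge_len_deriv P i v"
  by (simp_all add: edge_len_deriv_def edge_add edge_scaleR inner_add_right add_divide_distrib)

lemma has_derivative_edge_len:
  assumes "edge P i \<noteq> 0"
  shows "((\<lambda>Q. edge_len Q i) has_derivative edge_len_deriv P i) (at P)"
proof -
  have "((\<lambda>Q. norm (edge Q i)) has_derivative (\<lambda>v. edge v i \<bullet> sgn (edge P i))) (at P)"
    by (rule has_derivative_compose[OF bounded_linear_imp_has_derivative[OF bounded_linear_edge]
        has_derivative_norm[OF assms]])
  moreover have "edge v i \<bullet> sgn (edge P i) = edge_len_deriv P i v" for v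
    by (simp add: edge_len_deriv_def sgn_div_norm inner_commute divide_inverse mult.commute)
  ultimately show ?thesis by (simp add: edge_len_eq)
qed

lemma has_derivative_block_len:
  fixes P :: "('n::{finite,linorder}) polygon" and N :: "('k::{finite,linorder}) necklace"
  assumes "\<And>i. edge P i \<noteq> 0"
  shows "(block_len N has_derivative (\<lambda>v. \<chi> j. \<Sum>i\<in>block N j. edge_len_deriv P i v)) (at P)"
proof -
  have "((\<lambda>Q. (block_len N Q :: (real, 'k) vec) \<bullet> b) has_derivative
      (\<lambda>v. (\<chi> j. \<Sum>i\<in>block N j. edge_len_deriv P i v) \<bullet> b)) (at P)" if basis: "b \<in> Basis" for b
  proof -
    obtain j where b: "b = axis j 1" using basis by (auto simp: Basis_vec_def)
    show ?thesis
      unfolding b by (simp add: inner_axis block_len_def)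
        (intro has_derivative_sum has_derivative_edge_len assms)
  qed
  then show ?thesis
    by (subst has_derivative_componentwise_within) blast
qed

text \<open>Stretching every edge along itself achieves the prescribed rates, but the polygon need
  not close. Turning two non-parallel edges closes it without any first-order change of
  length.\<close>

lemma exists_edge_len_deriv:
  fixes P :: "('n::{finite,linorder}) polygon"
  assumes "\<And>i. edge P i \<noteq> 0" "cross (edge P a) (edge P b) \<noteq> 0"
  shows "\<exists>v. \<forall>i. edge_len_deriv P i v = x i"
proof -
  define w where "w i = (x i / norm (edge P i)) *\<^sub>R edge P i" for i
  have ab: "a \<noteq> b" using assms(2) by (auto simp: cross_self)
  have "cross (\<i> * edge P a) (\<i> * edge P b) \<noteq> 0" using assms(2)
    by (simp add: cross_def mult.commute)
  from cross_coordinates[OF this, of "- (\<Sum>i\<in>UNIV. w i)"]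
  obtain \<alpha> \<beta> where ab_eq: "\<alpha> *\<^sub>R (\<i> * edge P a) + \<beta> *\<^sub>R (\<i> * edge P b) = - (\<Sum>i\<in>UNIV. w i)"
    by blast
  define y where "y i = (if i = a then \<alpha> else 0) + (if i = b then \<beta> else 0)" for i
  have "(\<Sum>i\<in>UNIV. y i *\<^sub>R (\<i> * edge P i)) = \<alpha> *\<^sub>R (\<i> * edge P a) + \<beta> *\<^sub>R (\<i> * edge P b)"
    by (simp add: y_def scaleR_left_distrib sum.distrib if_distrib[of "\<lambda>c. c *\<^sub>R _"] cong: if_cong)
  then have "(\<Sum>i\<in>UNIV. w i + y i *\<^sub>R (\<i> * edge P i)) = 0"
    using ab_eq by (simp add: sum.distrib)
  from exists_polygon_with_edges[OF this, of 0]
  obtain v where v: "edge v i = w i + y i *\<^sub>R (\<i> * edge P i)" for i by blast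
  have "edge P i \<bullet> (w i + y i *\<^sub>R (\<i> * edge P i)) / norm (edge P i) = x i" for i
  proof -
    have "edge P i \<bullet> (\<i> * edge P i) = 0" by (simp add: inner_complex_def algebra_simps)
    moreover have "edge P i \<bullet> edge P i = norm (edge P i) * norm (edge P i)"
      by (simp add: dot_square_norm power2_eq_square)
    ultimately show ?thesis using assms(1)[of i] by (simp add: w_def inner_add_right)
  qed
  then have "edge_len_deriv P i v = x i" for i by (simp add: edge_len_deriv_def v)
  then show ?thesis by blast
qed

lemma nonsingularI:
  fixes Q :: "('n::{finite,linorder}) polygon" and N :: "('k::{finite,linorder}) necklace"
  assumes "is_necklace N" "(\<Sum>j\<in>UNIV. bd_num N j) = CARD('n)"
    and "\<And>i. edge Q i \<noteq> 0" "cross (edge Q a) (edge Q b) \<noteq> 0"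
  shows "nonsingular N Q"
proof -
  have D: "frechet_derivative (block_len N) (at Q) = (\<lambda>v. \<chi> j. \<Sum>i\<in>block N j. edge_len_deriv Q i v)"
    by (rule frechet_derivative_at[OF has_derivative_block_len[OF assms(3)], symmetric])
  have "\<exists>v. (\<chi> j. \<Sum>i\<in>block N j. edge_len_deriv Q i v) = y" for y :: "(real, 'k) vec"
  proof -
    \<comment> \<open>Spread the rate wanted for a bead evenly over its edges.\<close>
    obtain v where v: "\<And>i. edge_len_deriv Q i v = y $ bead N i / real (bd_num N (bead N i))"
      using exists_edge_len_deriv[OF assms(3,4),
          of "\<lambda>i. y $ bead N i / real (bd_num N (bead N i))"] by blast
    have "(\<Sum>i\<in>block N j. edge_len_deriv Q i v) = y $ j" for j
    proof -
      have "(\<Sum>i\<in>block N j. edge_len_deriv Q i v)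
          = (\<Sum>i\<in>(block N j :: 'n set). y $ j / real (bd_num N j))"
        by (intro sum.cong) (auto simp: v in_block_iff[OF assms(2)])
      moreover have "bd_num N j > 0" using assms(1) by (simp add: is_necklace_def)
      ultimately show ?thesis using card_block[OF assms(2), of j] by simp
    qed
    then show ?thesis by (intro exI[of _ v]) (simp add: vec_eq_iff)
  qed
  then have "surj (frechet_derivative (block_len N) (at Q))" unfolding D surj_def by metis
  then show ?thesis
    unfolding nonsingular_def using has_derivative_block_len[OF assms(3)]
      by (auto simp: differentiable_def)
qed

lemma norm_second_difference: "2 * norm (e :: 'a::real_normed_vector) \<le> norm (e + w) + norm (e - w)"
proof -
  have "2 * norm e = norm ((e + w) + (e - w))" by (simp flip: scaleR_2)
  also have "\<dots> \<le> norm (e + w) + norm (e - w)" by (rule norm_triangle_ineq)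
  finally show ?thesis .
qed

text \<open>A vanishing edge contributes \<open>2 * \<bar>t\<bar> * norm w\<close> to the symmetric second difference of the
  block length, which would be \<open>o(t)\<close> for a differentiable function.\<close>

lemma nonsingular_edge_nonzero:
  fixes P :: "('n::{finite,linorder}) polygon" and N :: "('k::{finite,linorder}) necklace"
  assumes "nonsingular N P" "(\<Sum>j\<in>UNIV. bd_num N j) = CARD('n)" "CARD('n) \<ge> 2"
  shows "edge P i \<noteq> 0"
proof
  assume zero: "edge P i = 0"
  have "\<exists>l. l \<noteq> i" using assms(3) 
    by (metis One_nat_def UNIV_I UNIV_eq_I card_1_singleton_iff insertI1 insert_iff not_less_eq_eq
        numeral_2_eq_2 order_refl singletonD)
  \<comment> \<open>Were \<open>i\<close> its own successor, the predicate \<open>l = i\<close>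
    would be invariant under \<open>next_ix\<close> and hence constant.\<close>
  then have "next_ix i \<noteq> i" using next_ix_invariant_const[of "\<lambda>l. l = i"] bij_next_ix
    by (metis bij_pointE)
  define v :: "'n polygon" where "v = axis i 1"
  have ev: "edge v i = -1" using \<open>next_ix i \<noteq> i\<close> by (simp add: v_def edge_def axis_def)
  define j where "j = bead N i"
  define f where "f Q = (\<Sum>l\<in>block N j. norm (edge Q l))" for Q :: "'n polygon"
  obtain D where "(block_len N has_derivative D) (at P)"
    using assms(1) unfolding nonsingular_def differentiable_def by blast
  then have "((\<lambda>Q. block_len N Q $ j) has_derivative (\<lambda>v. D v $ j)) (at P)"
    by (rule bounded_linear.has_derivative[OF bounded_linear_vec_nth])
  then have f: "(f has_derivative (\<lambda>v. D v $ j)) (at P)"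
    by (simp add: block_len_def f_def[abs_def] edge_len_eq)
  have line: "((\<lambda>t. f (P + t *\<^sub>R u)) has_real_derivative D u $ j) (at 0)" for u
  proof -
    have "((\<lambda>t. P + t *\<^sub>R u) has_derivative (\<lambda>t. t *\<^sub>R u)) (at (0::real))"
      by (auto intro!: derivative_eq_intros)
    from has_derivative_compose[OF this, of f] f
    have "((\<lambda>t. f (P + t *\<^sub>R u)) has_derivative (\<lambda>t. D (t *\<^sub>R u) $ j)) (at 0)" by simp
    moreover have "D (t *\<^sub>R u) $ j = D u $ j * t" for t
      using linear_cmul[OF has_derivative_linear[OF f], of t u] by simp
    ultimately show ?thesis by (simp add: has_field_derivative_def)
  qed
  have neg: "D (- v) $ j = - D v $ j" by (rule linear_neg[OF has_derivative_linear[OF f]])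
  define k where "k t = f (P + t *\<^sub>R v) + f (P + t *\<^sub>R (- v)) - 2 * f P" for t
  have "(k has_real_derivative D v $ j + D (- v) $ j - 0) (at 0)"
    unfolding k_def[abs_def] by (intro DERIV_diff DERIV_add line DERIV_const)
  then have "(\<lambda>t. k t / t) \<midarrow>0\<rightarrow> 0"
    unfolding has_field_derivative_iff neg by (simp add: k_def)
  then have "eventually (\<lambda>t. dist (k t / t) 0 < 2) (at 0)"
    by (rule tendstoD) simp
  then have "eventually (\<lambda>t. dist (k t / t) 0 < 2) (at_right 0)"
    by (rule filter_leD[OF at_le, rotated]) simp
  from eventually_happens'[OF trivial_limit_at_right_real eventually_conj[OF this
    eventually_at_right_less]]
  obtain t where t: "t > 0" "\<bar>k t / t\<bar> < 2" by auto
  have "2 * t \<le> k t"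
  proof -
    have i: "i \<in> block N j" by (simp add: j_def in_block_iff[OF assms(2)])
    have "(\<Sum>l\<in>block N j. if l = i then 2 * t else 0)
        \<le> (\<Sum>l\<in>block N j. norm (edge P l + t *\<^sub>R edge v l) + norm (edge P l - t *\<^sub>R edge v l)
             - 2 * norm (edge P l))"
    proof (rule sum_mono)
      fix l
      show "(if l = i then 2 * t else 0) \<le> norm (edge P l + t *\<^sub>R edge v l)
          + norm (edge P l - t *\<^sub>R edge v l) - 2 * norm (edge P l)"
        using norm_second_difference[of "edge P l" "t *\<^sub>R edge v l"] zero ev t by auto
    qed
    also have "\<dots> = k t"
      by (simp add: k_def f_def edge_add edge_diff edge_scaleR sum.distrib sum_subtractf
          sum_distrib_left)
    finally show ?thesis using i by simp
  qed
  then have "2 \<le> k t / t" using t by (simp add: field_simps)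
  then show False using t(2) by linarith
qed

text \<open>The branch \<open>Ln ((w - z) / (a - z))\<close> is a primitive along the segment: its
  cut is the ray from \<open>z\<close> pointing away from \<open>a\<close>, and a segment starting
  at \<open>a\<close> can meet that ray only by passing through \<open>z\<close>.\<close>

lemma winding_number_linepath_Arg:
  assumes "z \<notin> closed_segment a b"
  shows "Re (winding_number (linepath a b) z) = Arg ((b - z) / (a - z)) / (2 * pi)"
proof -
  have ne: "a \<noteq> z" "b \<noteq> z" using assms by auto
  define S where "S = {w. (w - z) / (a - z) \<notin> \<real>\<^sub>\<le>\<^sub>0}"
  have sub: "closed_segment a b \<subseteq> S"
  proof
    fix w assume "w \<in> closed_segment a b"
    then obtain t where t: "0 \<le> t" "t \<le> 1" "w = a + t *\<^sub>R (b - a)"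
      by (auto simp: closed_segment_def algebra_simps)
    show "w \<in> S"
    proof (rule ccontr)
      assume "w \<notin> S"
      then obtain y where y: "(w - z) / (a - z) = of_real y" "y \<le> 0"
        by (auto simp: S_def elim!: nonpos_Reals_cases)
      then have "a - z + t *\<^sub>R (b - a) = of_real y * (a - z)"
        using ne t(3) by (simp add: divide_simps algebra_simps)
      \<comment> \<open>The segment is on the cut at parameter \<open>t\<close>; solving for
        \<open>z\<close> shows that it passes through \<open>z\<close> no later, at
        \<open>t / (1 - y)\<close>.\<close>
      then have "z = a + (t / (1 - y)) *\<^sub>R (b - a)"
        using y(2) by (simp add: scaleR_conv_of_real field_simps)
      moreover have "0 \<le> t / (1 - y)" "t / (1 - y) \<le> 1" using t y(2) by simp_all
      ultimately show False
        using assms by (auto simp: closed_segment_def algebra_simps)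
    qed
  qed
  have "((\<lambda>w. Ln ((w - z) / (a - z))) has_field_derivative 1 / (w - z)) (at w within S)"
    if "w \<in> S" for w
  proof -
    have "w \<noteq> z" using that by (auto simp: S_def)
    have "((\<lambda>w. (w - z) / (a - z)) has_field_derivative 1 / (a - z)) (at w within S)"
      using ne by (auto intro!: derivative_eq_intros)
    from DERIV_chain2[OF has_field_derivative_Ln this] that \<open>w \<noteq> z\<close> ne
    show ?thesis by (simp add: S_def)
  qed
  then have "((\<lambda>w. 1 / (w - z)) has_contour_integral
      (Ln ((pathfinish (linepath a b) - z) / (a - z)) - Ln ((pathstart (linepath a b) - z) / (a -
        z))))
      (linepath a b)"
    by (rule contour_integral_primitive) (use sub in auto)
  then have "contour_integral (linepath a b) (\<lambda>w. 1 / (w - z)) = Ln ((b - z) / (a - z))"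
    using ne by (simp add: contour_integral_unique)
  then have "winding_number (linepath a b) z = Ln ((b - z) / (a - z)) / (2 * pi * \<i>)"
    using assms by (subst winding_number_valid_path) auto
  also have "\<dots> = - \<i> * Ln ((b - z) / (a - z)) / of_real (2 * pi)" by (simp add: field_simps)
  finally have "Re (winding_number (linepath a b) z) = Im (Ln ((b - z) / (a - z))) / (2 * pi)"
    by (simp add: Re_divide_of_real)
  then show ?thesis using ne by (simp add: Arg_eq_Im_Ln)
qed

text \<open>The conjuncts about the path, its start and its image are carried along because
  \<open>winding_number_join\<close> asks for them in the induction.\<close>

lemma winding_number_polyline:
  assumes "length ys \<ge> 2" "\<And>k. Suc k < length ys \<Longrightarrow> z \<notin> closed_segment (ys ! k) (ys ! Suc k)"
  shows "path (polyline ys) \<and> pathstart (polyline ys) = hd ys \<and> z \<notin> path_image (polyline ys) \<and>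
    winding_number (polyline ys) z
      = (\<Sum>k<length ys - 1. winding_number (linepath (ys ! k) (ys ! Suc k)) z)"
  using assms
proof (induction ys rule: polyline.induct)
  case (1 a b c xs)
  have IH: "path (polyline (b # c # xs)) \<and> pathstart (polyline (b # c # xs)) = hd (b # c # xs) \<and>
    z \<notin> path_image (polyline (b # c # xs)) \<and> winding_number (polyline (b # c # xs)) z
      = (\<Sum>k<length (b # c # xs) - 1.
          winding_number (linepath ((b # c # xs) ! k) ((b # c # xs) ! Suc k)) z)"
  proof (rule "1.IH")
    show "z \<notin> closed_segment ((b # c # xs) ! k) ((b # c # xs) ! Suc k)"
      if "Suc k < length (b # c # xs)" for k
      using "1.prems"(2)[of "Suc k"] that by simp
  qed simp
  have z: "z \<notin> closed_segment a b" using "1.prems"(2)[of 0] by simp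
  have len: "length (a # b # c # xs) - 1 = Suc (length (b # c # xs) - 1)" by simp
  have "winding_number (polyline (a # b # c # xs)) z
      = winding_number (linepath a b) z + winding_number (polyline (b # c # xs)) z"
    using IH z by (simp add: winding_number_join)
  then show ?case
    using IH z unfolding len sum.lessThan_Suc_shift by (simp add: path_image_join)
qed auto

lemma winding_eq_angle_sum:
  fixes P :: "('n::{finite,linorder}) polygon"
  assumes "\<And>i. circumcentre P \<notin> closed_segment (P $ i) (P $ next_ix i)"
  shows "winding P = (\<Sum>i\<in>UNIV. edge_angle P i) / (2 * pi)"
proof -
  define xs :: "'n list" where "xs = sorted_list_of_set UNIV"
  define ys where "ys = map (($) P) xs @ [P $ Min UNIV]"
  have xs: "length xs = CARD('n)" "set xs = UNIV" "distinct xs"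
    by (simp_all add: xs_def)
  have ys: "length ys = Suc (length xs)" by (simp add: ys_def)
  have nth: "ys ! k = P $ (xs ! k)" "ys ! Suc k = P $ next_ix (xs ! k)" if "k < length xs" for k
    using that next_ix_nth_sorted[OF xs_def that] by (auto simp: ys_def nth_append)
  have cl: "closed_polyline P = polyline ys" by (simp add: closed_polyline_def ys_def xs_def)
  have "winding_number (polyline ys) (circumcentre P)
      = (\<Sum>k<length ys - 1. winding_number (linepath (ys ! k) (ys ! Suc k)) (circumcentre P))"
    using assms xs ys nth zero_less_card_finite[where 'a='n]
      by (intro winding_number_polyline[THEN conjunct2, THEN conjunct2, THEN conjunct2]) auto
  also have "\<dots> = (\<Sum>k<length xs.
      winding_number (linepath (P $ (xs ! k)) (P $ next_ix (xs ! k))) (circumcentre P))"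
    using ys nth by (intro sum.cong) auto
  also have "\<dots> = (\<Sum>i\<in>UNIV. winding_number (linepath (P $ i) (P $ next_ix i)) (circumcentre P))"
    by (rule sum.reindex_bij_betw[OF bij_betw_nth]) (use xs in auto)
  finally show ?thesis
    unfolding winding_def cl
    by (simp add: winding_number_linepath_Arg[OF assms] edge_angle_def sum_divide_distrib)
qed

section \<open>Germs of configurations\<close>

lemma inner_cross_zero:
  assumes "cross u v \<noteq> 0" "u \<bullet> w = 0" "v \<bullet> w = 0" shows "w = 0"
proof -
  obtain \<alpha> \<beta> where "\<alpha> *\<^sub>R u + \<beta> *\<^sub>R v = w" using cross_coordinates[OF assms(1)] by blast
  then have "w \<bullet> w = \<alpha> * (u \<bullet> w) + \<beta> * (v \<bullet> w)" by (metis inner_add_left inner_scaleR_left)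
  then show ?thesis using assms(2,3) by simp
qed

lemma inner_rotate: "z \<bullet> (\<i> * z) = 0" "(\<i> * z) \<bullet> (\<i> * z) = z \<bullet> z"
  and cross_rotate: "cross z (\<i> * z) = z \<bullet> z"
  by (simp_all add: inner_complex_def cross_def algebra_simps)

text \<open>Two sides of a triangle with third side \<open>Z\<close> and prescribed lengths; \<open>X\<close> and \<open>\<plusminus>sqrt D\<close> are
  the coordinates of the apex with respect to \<open>Z\<close> and \<open>\<i> * Z\<close>.\<close>

definition apex_X :: "complex \<Rightarrow> real \<Rightarrow> real \<Rightarrow> real" where
  "apex_X Z A B = (Z \<bullet> Z + A\<^sup>2 - B\<^sup>2) / (2 * (Z \<bullet> Z))"

definition apex_D :: "complex \<Rightarrow> real \<Rightarrow> real \<Rightarrow> real" where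
  "apex_D Z A B = A\<^sup>2 / (Z \<bullet> Z) - (apex_X Z A B)\<^sup>2"

definition apex :: "complex \<Rightarrow> real \<Rightarrow> real \<Rightarrow> real \<Rightarrow> complex" where
  "apex Z A B \<sigma> = apex_X Z A B *\<^sub>R Z + (\<sigma> * sqrt (apex_D Z A B)) *\<^sub>R (\<i> * Z)"

text \<open>The third claim keeps the two closing edges non-parallel along a germ, as
  \<open>nonsingularI\<close> demands.\<close>

lemma apex_properties:
  assumes "Z \<noteq> 0" "apex_D Z A B > 0" "\<sigma>\<^sup>2 = 1"
  shows "apex Z A B \<sigma> \<bullet> apex Z A B \<sigma> = A\<^sup>2"
    and "(Z - apex Z A B \<sigma>) \<bullet> (Z - apex Z A B \<sigma>) = B\<^sup>2"
    and "cross (apex Z A B \<sigma>) (Z - apex Z A B \<sigma>) \<noteq> 0"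
proof -
  define X Y where "X = apex_X Z A B" and "Y = \<sigma> * sqrt (apex_D Z A B)"
  have Y2: "Y\<^sup>2 = A\<^sup>2 / (Z \<bullet> Z) - X\<^sup>2"
    using assms by (simp add: Y_def X_def power_mult_distrib apex_D_def)
  have Z: "Z \<bullet> Z > 0" using assms(1) by simp
  have p: "apex Z A B \<sigma> = X *\<^sub>R Z + Y *\<^sub>R (\<i> * Z)" by (simp add: apex_def X_def Y_def)
  have iZ: "(\<i> * Z) \<bullet> Z = 0" using inner_rotate(1)[of Z] by (simp add: inner_commute)
  have "apex Z A B \<sigma> \<bullet> apex Z A B \<sigma> = (X\<^sup>2 + Y\<^sup>2) * (Z \<bullet> Z)"
    unfolding p by (simp add: inner_add_left inner_add_right inner_rotate iZ power2_eq_square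
      algebra_simps)
  also have "\<dots> = A\<^sup>2" using Z by (simp add: Y2)
  finally show A: "apex Z A B \<sigma> \<bullet> apex Z A B \<sigma> = A\<^sup>2" .
  have "(Z - apex Z A B \<sigma>) \<bullet> (Z - apex Z A B \<sigma>)
      = Z \<bullet> Z - 2 * (Z \<bullet> apex Z A B \<sigma>) + apex Z A B \<sigma> \<bullet> apex Z A B \<sigma>"
    by (simp add: inner_diff_left inner_diff_right inner_commute)
  also have "Z \<bullet> apex Z A B \<sigma> = X * (Z \<bullet> Z)" unfolding p by (simp add: inner_add_right inner_rotate)
  also have "Z \<bullet> Z - 2 * (X * (Z \<bullet> Z)) + apex Z A B \<sigma> \<bullet> apex Z A B \<sigma> = B\<^sup>2"
    using Z by (simp add: A X_def apex_X_def field_simps)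
  finally show "(Z - apex Z A B \<sigma>) \<bullet> (Z - apex Z A B \<sigma>) = B\<^sup>2" .
  have "Y \<noteq> 0" using assms by (auto simp: Y_def)
  moreover have "cross (apex Z A B \<sigma>) (Z - apex Z A B \<sigma>) = - Y * (Z \<bullet> Z)"
    unfolding p using cross_skew[of "\<i> * Z" Z] by (simp add: cross_simps cross_rotate)
  ultimately show "cross (apex Z A B \<sigma>) (Z - apex Z A B \<sigma>) \<noteq> 0" using Z by simp
qed

text \<open>At parameter 0 a germ has to return the given polygon. The radicand is a square by
  Lagrange's identity, and \<open>\<sigma>\<close> records on which side of the third side the apex
  lies.\<close>

lemma apex_of_sides:
  assumes "cross p q \<noteq> 0"
  defines "\<sigma> \<equiv> sgn (cross (p + q) p)"
  shows "p + q \<noteq> 0" "apex_D (p + q) (norm p) (norm q) > 0" "\<sigma>\<^sup>2 = 1"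
    "apex (p + q) (norm p) (norm q) \<sigma> = p"
proof -
  let ?Z = "p + q"
  have c: "cross ?Z p \<noteq> 0" using assms(1) cross_skew[of p q] by (simp add: cross_simps)
  then show Z0: "?Z \<noteq> 0" by (metis cross_scaleR_left mult_zero_left scaleR_zero_left)
  show "\<sigma>\<^sup>2 = 1" using c by (simp add: \<sigma>_def sgn_if)
  have Z: "?Z \<bullet> ?Z > 0" using Z0 by simp
  have X: "apex_X ?Z (norm p) (norm q) = (p \<bullet> ?Z) / (?Z \<bullet> ?Z)"
    using Z unfolding apex_X_def power2_norm_eq_inner
    by (simp add: divide_simps) (simp add: inner_add_left inner_add_right inner_commute
      algebra_simps)
  have lagrange: "(p \<bullet> p) * (?Z \<bullet> ?Z) = (p \<bullet> ?Z)\<^sup>2 + (cross ?Z p)\<^sup>2"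
    by (simp add: inner_complex_def cross_def algebra_simps power2_eq_square)
  have D: "apex_D ?Z (norm p) (norm q) = (cross ?Z p / (?Z \<bullet> ?Z))\<^sup>2"
    using Z lagrange unfolding apex_D_def X power2_norm_eq_inner
    by (simp add: field_simps power2_eq_square)
  then show "apex_D ?Z (norm p) (norm q) > 0" using c Z by simp
  have "\<sigma> * sqrt (apex_D ?Z (norm p) (norm q)) = cross ?Z p / (?Z \<bullet> ?Z)"
    unfolding D real_sqrt_abs \<sigma>_def using c Z by (simp add: abs_divide sgn_if)
  then have "(?Z \<bullet> ?Z) *\<^sub>R apex ?Z (norm p) (norm q) \<sigma> = (p \<bullet> ?Z) *\<^sub>R ?Z + cross ?Z p *\<^sub>R (\<i> * ?Z)"
    unfolding apex_def X using Z by (simp add: scaleR_add_right)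
  also have "\<dots> = (?Z \<bullet> ?Z) *\<^sub>R p"
    by (simp add: complex_eq_iff inner_complex_def cross_def algebra_simps)
  finally show "apex ?Z (norm p) (norm q) \<sigma> = p" using Z by simp
qed

text \<open>Germs are written down explicitly, so that no implicit function theorem is needed: the edge
  lengths vary affinely (which preserves the block lengths), the edge directions are normalised,
  and the polygon is closed up by solving for the directions of two non-parallel edges.\<close>

lemma exists_germ:
  fixes P :: "('n::{finite,linorder}) polygon" and N :: "('k::{finite,linorder}) necklace"
    and L :: "'a::real_normed_vector \<Rightarrow> 'n polygon"
  assumes N: "is_necklace N" and total: "(\<Sum>j\<in>UNIV. bd_num N j) = CARD('n)"
    and conf: "configuration N P" and ne: "\<And>i. edge P i \<noteq> 0"
    and ab: "cross (edge P a) (edge P b) \<noteq> 0"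
    and L: "bounded_linear L" and L0: "\<And>x j. (\<Sum>i\<in>block N j. edge_len_deriv P i (L x)) = 0"
  shows "\<exists>g. smooth_germ (Msm_tilde N) P g \<and> (g has_derivative L) (at 0)"
proof -
  define w where "w i x = edge (L x) i" for i x
  define len where "len i x = norm (edge P i) + edge_len_deriv P i (L x)" for i x
  \<comment> \<open>The scalar factor has value 1 and derivative 0 at 0, so normalising the length
    does not disturb the velocity \<open>w i\<close>.\<close>
  define dir where "dir i x = (len i x / norm (edge P i + w i x)) *\<^sub>R (edge P i + w i x)" for i x
  \<comment> \<open>The vector that the edges \<open>a\<close> and \<open>b\<close> together must
    cover to close the polygon.\<close>
  define Z where "Z x = - (\<Sum>i\<in>UNIV - {a, b}. dir i x)" for x
  define \<sigma> where "\<sigma> = sgn (cross (edge P a + edge P b) (edge P a))"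
  define Ea where "Ea x = apex (Z x) (len a x) (len b x) \<sigma>" for x
  define E where "E i x = (if i = a then Ea x else if i = b then Z x - Ea x else dir i x)" for i x
  define g where "g x = (\<chi> i. (P $ Min UNIV + L x $ Min UNIV) + (\<Sum>j\<in>{..<i}. E j x))" for x
  \<comment> \<open>Nested domains on which the divisors and lengths, the third side
    \<open>Z\<close> and the radicand in turn stay away from 0.\<close>
  define U1 where "U1 = (\<Inter>i. {x. edge P i + w i x \<noteq> 0} \<inter> {x. 0 < len i x})"
  define U2 where "U2 = Z -` (- {0}) \<inter> U1"
  define U where "U = (\<lambda>x. apex_D (Z x) (len a x) (len b x)) -` {0<..} \<inter> U2"
  have a_b: "a \<noteq> b" using ab by (auto simp: cross_self)
  have w: "bounded_linear (w i)" for i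
    unfolding w_def[abs_def] by (rule bounded_linear_compose[OF bounded_linear_edge L])
  have dl: "bounded_linear (edge_len_deriv P i)" for i
    by (rule linear_conv_bounded_linear[THEN iffD1], rule linearI)
      (simp_all add: edge_len_deriv_add edge_len_deriv_scaleR)
  have dl: "bounded_linear (\<lambda>x. edge_len_deriv P i (L x))" for i
    by (rule bounded_linear_compose[OF dl L])
  have smooth_len: "smooth_map_on S (len i)" if "open S" for S i
    unfolding len_def[abs_def]
    by (intro smooth_map_on_add[OF that] smooth_map_on_const smooth_map_on_bounded_linear dl that)
  have smooth_ew: "smooth_map_on S (\<lambda>x. edge P i + w i x)" if "open S" for S i
    by (intro smooth_map_on_add[OF that] smooth_map_on_const smooth_map_on_bounded_linear w that)
  have "open ({x. edge P i + w i x \<noteq> 0} \<inter> {x. 0 < len i x})" for i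
    using smooth_map_on_imp_continuous_on[OF open_UNIV smooth_len[OF open_UNIV]]
      smooth_map_on_imp_continuous_on[OF open_UNIV smooth_ew[OF open_UNIV]]
    by (intro open_Int open_Collect_neq open_Collect_less continuous_on_const) auto
  then have U1: "open U1" unfolding U1_def by (intro open_INT) auto
  have smooth_dir: "smooth_map_on U1 (dir i)" for i
    unfolding dir_def[abs_def]
    by (intro smooth_map_on_scaleR[OF U1] smooth_map_on_divide[OF U1] smooth_map_on_norm[OF U1]
        smooth_len smooth_ew U1) (auto simp: U1_def)
  have smooth_Z1: "smooth_map_on U1 Z"
    unfolding Z_def[abs_def] by (intro smooth_map_on_minus[OF U1] smooth_map_on_sum[OF U1]
      smooth_dir)
  have U2: "open U2"
    unfolding U2_def using smooth_map_on_imp_continuous_on[OF U1 smooth_Z1]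
    by (simp add: continuous_on_open_vimage[OF U1] open_Compl)
  have Z0: "Z x \<bullet> Z x \<noteq> 0" if "x \<in> U2" for x using that by (simp add: U2_def)
  have smooth_Z: "smooth_map_on S Z" if "S \<subseteq> U2" for S
    using smooth_map_on_subset[OF smooth_Z1, of S] that by (auto simp: U2_def)
  have smooth_X: "smooth_map_on S (\<lambda>x. apex_X (Z x) (len a x) (len b x))" if "open S" "S \<subseteq> U2" for S
    unfolding apex_X_def power2_eq_square
    by (intro smooth_map_on_divide smooth_map_on_add smooth_map_on_diff smooth_map_on_mult
        smooth_map_on_inner smooth_map_on_const smooth_Z smooth_len that) (use Z0 that in auto)
  have smooth_D: "smooth_map_on S (\<lambda>x. apex_D (Z x) (len a x) (len b x))"
    if "open S" "S \<subseteq> U2" for S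
    unfolding apex_D_def power2_eq_square
    by (intro smooth_map_on_divide smooth_map_on_diff smooth_map_on_mult
        smooth_map_on_inner smooth_Z smooth_len smooth_X that) (use Z0 that in auto)
  have U: "open U"
    unfolding U_def using smooth_map_on_imp_continuous_on[OF U2 smooth_D[OF U2 order_refl]]
    by (simp add: continuous_on_open_vimage[OF U2])
  have UU: "U \<subseteq> U2" "U \<subseteq> U1" by (auto simp: U_def U2_def)
  have smooth_Ea: "smooth_map_on U Ea"
    unfolding Ea_def[abs_def] apex_def
    by (intro smooth_map_on_add[OF U] smooth_map_on_scaleR[OF U] smooth_map_on_mult[OF U]
        smooth_map_on_sqrt[OF U] smooth_X smooth_Z smooth_D smooth_map_on_const U UU)
      (auto simp: U_def)
  have smooth_E: "smooth_map_on U (E i)" for i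
    unfolding E_def[abs_def]
    using smooth_Ea smooth_map_on_diff[OF U smooth_Z[OF UU(1)] smooth_Ea]
      smooth_map_on_subset[OF smooth_dir UU(2)]
    by (cases "i = a"; cases "i = b"; simp)
  have smooth_g: "smooth_map_on U g"
    unfolding g_def[abs_def]
    by (intro smooth_map_on_vec smooth_map_on_add smooth_map_on_sum smooth_map_on_const smooth_E U
        smooth_map_on_bounded_linear bounded_linear_compose[OF bounded_linear_vec_nth L])
  have split: "(\<Sum>i\<in>UNIV. f i) = f a + f b + (\<Sum>i\<in>UNIV - {a, b}. f i)" for f :: "'n \<Rightarrow> complex"
    using a_b sum.subset_diff[of "{a, b}" UNIV f] by (simp add: add.commute)
  have "(\<Sum>i\<in>UNIV. E i x) = 0" for x
  proof -
    have "(\<Sum>i\<in>UNIV - {a, b}. E i x) = - Z x"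
      unfolding Z_def minus_minus by (intro sum.cong) (auto simp: E_def)
    moreover have "E a x + E b x = Z x" using a_b by (simp add: E_def)
    ultimately show ?thesis unfolding split[of "\<lambda>i. E i x"] by simp
  qed
  then have edge_g: "edge (g x) i = E i x" for x i
    unfolding g_def by (rule exists_polygon_with_edges)
  have norm_E: "norm (E i x) = len i x" if "x \<in> U" for i x
  proof -
    have x: "Z x \<noteq> 0" "apex_D (Z x) (len a x) (len b x) > 0" "\<And>i. len i x > 0"
        "\<And>i. edge P i + w i x \<noteq> 0"
      using that by (auto simp: U_def U2_def U1_def)
    have "\<sigma>\<^sup>2 = 1" unfolding \<sigma>_def by (rule apex_of_sides(3)[OF ab])
    from apex_properties(1,2)[OF x(1,2) this]
    have "(norm (Ea x))\<^sup>2 = (len a x)\<^sup>2" "(norm (Z x - Ea x))\<^sup>2 = (len b x)\<^sup>2"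
      by (simp_all add: Ea_def power2_norm_eq_inner)
    then have "norm (Ea x) = len a x" "norm (Z x - Ea x) = len b x"
      using power2_eq_imp_eq norm_ge_zero less_imp_le[OF x(3)] by blast+
    moreover have "norm (dir i x) = len i x" using x(3)[of i] x(4)[of i] by (simp add: dir_def)
    ultimately show ?thesis by (auto simp: E_def)
  qed
  have sub: "g ` U \<subseteq> Msm_tilde N"
  proof
    fix Q assume "Q \<in> g ` U"
    then obtain x where x: "x \<in> U" "Q = g x" by blast
    have "0 < len i x" for i using x(1) UU by (auto simp: U1_def)
    then have ne_Q: "edge Q i \<noteq> 0" for i
      using norm_E[OF x(1), of i] by (metis edge_g norm_zero order_less_irrefl x(2))
    have "cross (edge Q a) (edge Q b) \<noteq> 0"
      using apex_properties(3)[of "Z x" "len a x" "len b x" \<sigma>] x(1) a_b apex_of_sides(3)[OF ab]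
      unfolding x(2) edge_g by (auto simp: E_def Ea_def U_def U2_def \<sigma>_def)
    then have "nonsingular N Q" by (rule nonsingularI[OF N total ne_Q])
    moreover have "configuration N Q"
    proof -
      have "(\<Sum>i\<in>block N j. edge_len Q i) = bd_len N j" for j
      proof -
        have "(\<Sum>i\<in>block N j. edge_len Q i)
            = (\<Sum>i\<in>block N j. edge_len P i) + (\<Sum>i\<in>block N j. edge_len_deriv P i (L x))"
          by (simp add: edge_len_eq x(2) edge_g norm_E[OF x(1)] len_def sum.distrib)
        then show ?thesis using L0 conf by (simp add: configuration_def block_len_def)
      qed
      then show ?thesis by (simp add: configuration_def block_len_def)
    qed
    ultimately show "Q \<in> Msm_tilde N" by (simp add: Msm_tilde_def)
  qed
  have L_0: "L 0 = 0" by (rule linear_0[OF bounded_linear.linear[OF L]])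
  have at0: "w i 0 = 0" "len i 0 = norm (edge P i)" "dir i 0 = edge P i" for i
    using ne[of i] L_0 by (simp_all add: w_def len_def dir_def edge_def edge_len_deriv_def)
  have Z_0: "Z 0 = edge P a + edge P b"
    using split[of "edge P"] sum_edge[of P] by (simp add: Z_def at0 neg_eq_iff_add_eq_0 add.commute)
  have Ea_0: "Ea 0 = edge P a"
    unfolding Ea_def Z_0 at0 \<sigma>_def by (rule apex_of_sides(4)[OF ab])
  then have E_0: "E i 0 = edge P i" for i by (simp add: E_def at0 Z_0)
  have g_0: "g 0 = P"
    unfolding g_def E_0 L_0 by (simp add: vec_eq_iff polygon_eq_partial_sums[symmetric])
  have zero_U: "0 \<in> U"
    using apex_of_sides(1,2)[OF ab] ne by (auto simp: U_def U2_def U1_def at0 Z_0)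
  have len': "(len i has_derivative (\<lambda>x. edge_len_deriv P i (L x))) (at 0)" for i
    unfolding len_def[abs_def]
    using has_derivative_add[OF has_derivative_const bounded_linear_imp_has_derivative[OF dl]]
      by simp
  have w': "(w i has_derivative w i) (at 0)" for i by (rule bounded_linear_imp_has_derivative[OF w])
  have dir': "(dir i has_derivative w i) (at 0)" for i
  proof -
    have ew: "((\<lambda>x. edge P i + w i x) has_derivative w i) (at 0)"
      using has_derivative_add[OF has_derivative_const w', of "edge P i"] by simp
    have "((\<lambda>x. norm (edge P i + w i x)) has_derivative (\<lambda>x. w i x \<bullet> sgn (edge P i + w i 0))) (at
      0)"
      by (rule has_derivative_compose[OF ew has_derivative_norm]) (simp add: at0 ne)
    moreover have "w i x \<bullet> sgn (edge P i + w i 0) = edge_len_deriv P i (L x)" for x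
      unfolding at0(1) by (simp add: edge_len_deriv_def w_def sgn_div_norm inner_commute
        divide_inverse mult.commute)
    ultimately have norm': "((\<lambda>x. norm (edge P i + w i x)) has_derivative (\<lambda>x. edge_len_deriv P i (L
      x))) (at 0)"
      by simp
    have "((\<lambda>x. len i x / norm (edge P i + w i x)) has_derivative (\<lambda>x. 0)) (at 0)"
      using has_derivative_divide'[OF len' norm', of i] ne[of i] by (simp add: at0 mult.commute)
    from has_derivative_scaleR[OF this ew] show ?thesis
      using ne[of i] by (simp add: dir_def[abs_def] at0)
  qed
  have "- (\<Sum>i\<in>UNIV - {a, b}. w i x) = w a x + w b x" for x
  proof (rule minus_unique)
    show "(\<Sum>i\<in>UNIV - {a, b}. w i x) + (w a x + w b x) = 0"
      using split[of "\<lambda>i. w i x"] sum_edge[of "L x"] by (simp add: w_def add.commute)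
  qed
  moreover have "(Z has_derivative (\<lambda>x. - (\<Sum>i\<in>UNIV - {a, b}. w i x))) (at 0)"
    unfolding Z_def[abs_def] by (intro has_derivative_minus has_derivative_sum dir')
  ultimately have Z': "(Z has_derivative (\<lambda>x. w a x + w b x)) (at 0)" by (simp only:)
  define D where "D = frechet_derivative Ea (at 0)"
  have Ea': "(Ea has_derivative D) (at 0)"
    unfolding D_def by (rule smooth_map_on_derivative[OF U smooth_Ea zero_U])
  \<comment> \<open>The derivative of \<open>Ea\<close> is not computed from the square root.
    Differentiating the known squared length of \<open>E i\<close> gives the component of its
    derivative along \<open>edge P i\<close>; the conditions for \<open>a\<close> and
    \<open>b\<close> together determine it.\<close>
  have norm_deriv: "edge P i \<bullet> F x = edge P i \<bullet> w i x" if F: "(E i has_derivative F) (at 0)" for i F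
    x
  proof -
    have "((\<lambda>x. E i x \<bullet> E i x) has_derivative (\<lambda>x. E i 0 \<bullet> F x + F x \<bullet> E i 0)) (at 0)"
      by (rule has_derivative_inner[OF F F])
    moreover have "((\<lambda>x. len i x * len i x) has_derivative
        (\<lambda>x. len i 0 * edge_len_deriv P i (L x) + edge_len_deriv P i (L x) * len i 0)) (at 0)"
      by (rule has_derivative_mult[OF len' len'])
    then have "((\<lambda>x. E i x \<bullet> E i x) has_derivative
        (\<lambda>x. len i 0 * edge_len_deriv P i (L x) + edge_len_deriv P i (L x) * len i 0)) (at 0)"
      by (rule has_derivative_transform_within_open[OF _ U zero_U])
        (simp add: norm_E[symmetric] dot_square_norm power2_eq_square)
    ultimately have "(\<lambda>x. E i 0 \<bullet> F x + F x \<bullet> E i 0)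
        = (\<lambda>x. len i 0 * edge_len_deriv P i (L x) + edge_len_deriv P i (L x) * len i 0)"
      by (rule has_derivative_unique)
    then show ?thesis
      using ne[of i] unfolding E_0 at0 edge_len_deriv_def w_def
      by (auto simp: fun_eq_iff inner_commute dest!: spec[of _ x])
  qed
  have "D x = w a x" for x
  proof -
    have "edge P a \<bullet> D x = edge P a \<bullet> w a x" using norm_deriv[of a D x] Ea'
      by (simp add: E_def[abs_def])
    moreover have "((\<lambda>x. Z x - Ea x) has_derivative (\<lambda>x. w a x + w b x - D x)) (at 0)"
      by (rule has_derivative_diff[OF Z' Ea'])
    then have "edge P b \<bullet> (w a x + w b x - D x) = edge P b \<bullet> w b x"
      using norm_deriv[of b "\<lambda>x. w a x + w b x - D x" x] a_b by (simp add: E_def[abs_def])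
    ultimately have "D x - w a x = 0"
      by (intro inner_cross_zero[OF ab]) (simp_all add: inner_diff_right inner_add_right)
    then show ?thesis by simp
  qed
  then have "D = w a" by (rule ext)
  then have Ea': "(Ea has_derivative w a) (at 0)" using Ea' by simp
  have E': "(E i has_derivative w i) (at 0)" for i
  proof -
    have "((\<lambda>x. Z x - Ea x) has_derivative (\<lambda>x. w a x + w b x - w a x)) (at 0)"
      by (rule has_derivative_diff[OF Z' Ea'])
    then show ?thesis using Ea' dir'[of i]
      by (cases "i = a"; cases "i = b") (simp_all add: E_def[abs_def])
  qed
  have comp: "((\<lambda>x. g x $ i) has_derivative (\<lambda>x. L x $ i)) (at 0)" for i
  proof -
    have "((\<lambda>x. (P $ Min UNIV + L x $ Min UNIV) + (\<Sum>j\<in>{..<i}. E j x)) has_derivative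
        (\<lambda>x. (0 + L x $ Min UNIV) + (\<Sum>j\<in>{..<i}. w j x))) (at 0)"
      by (intro has_derivative_add has_derivative_sum has_derivative_const E'
          bounded_linear_imp_has_derivative bounded_linear_compose[OF bounded_linear_vec_nth L])
    then show ?thesis
      using polygon_eq_partial_sums[of "L x" i for x] by (simp add: g_def w_def)
  qed
  have "(g has_derivative L) (at 0)"
  proof (subst has_derivative_componentwise_within, intro ballI)
    fix b :: "'n polygon" assume "b \<in> Basis"
    then obtain i c where b: "b = axis i c" by (auto simp: Basis_vec_def)
    show "((\<lambda>x. g x \<bullet> b) has_derivative (\<lambda>x. L x \<bullet> b)) (at 0)"
      unfolding b inner_axis by (rule has_derivative_inner_left[OF comp])
  qed
  then show ?thesis
    unfolding smooth_germ_def using smooth_g U zero_U sub g_0 by blast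
qed

section \<open>The Hessian of the area\<close>

lemma has_vector_derivative_compose_derivative:
  assumes "(\<gamma> has_vector_derivative v) (at t)" "(f has_derivative f') (at (\<gamma> t))"
  shows "((\<lambda>s. f (\<gamma> s)) has_vector_derivative f' v) (at t)"
  using has_derivative_compose[OF assms(1)[unfolded has_vector_derivative_def] assms(2)]
    linear_cmul[OF has_derivative_linear[OF assms(2)]]
  by (simp add: has_vector_derivative_def)

lemma derivative_zero_of_constant:
  assumes "(\<gamma> has_vector_derivative v) (at t)" "(f has_derivative f') (at (\<gamma> t))"
    and "open S" "t \<in> S" "\<And>s. s \<in> S \<Longrightarrow> f (\<gamma> s) = c"
  shows "f' v = 0"
proof -
  have "((\<lambda>s. c) has_vector_derivative f' v) (at t)"
    using has_vector_derivative_transform_within_open[OF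
        has_vector_derivative_compose_derivative[OF assms(1,2)] assms(3,4)] assms(5) by simp
  then show ?thesis
    using vector_derivative_unique_at[OF has_vector_derivative_const] by metis
qed

lemma smooth_germE:
  assumes "smooth_germ M P g"
  obtains U where "open U" "0 \<in> U" "smooth_map_on U g" "\<And>x. x \<in> U \<Longrightarrow> g x \<in> M" "g 0 = P"
  using assms unfolding smooth_germ_def by blast

text \<open>The second derivative of the quadratic form \<open>area\<close>. Since
  \<open>area_bil P P\<close> is twice the area, \<open>area_bil P\<close> is also the first
  derivative at \<open>P\<close>.\<close>

definition area_bil :: "('n::{finite,linorder}) polygon \<Rightarrow> 'n polygon \<Rightarrow> real" where
  "area_bil u v = 1/2 * (\<Sum>i\<in>UNIV. cross (u $ i) (v $ next_ix i) + cross (v $ i) (u $ next_ix i))"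

lemma area_bil_sym: "area_bil u v = area_bil v u"
  by (simp add: area_bil_def add.commute)

lemma area_bil_self: "area_bil P P = 2 * area P"
proof -
  have "area P = 1/2 * (\<Sum>i\<in>UNIV. cross (P $ i) (P $ next_ix i))"
    by (simp add: area_def cross_def)
  then show ?thesis by (simp add: area_bil_def flip: sum_distrib_left)
qed

lemma bounded_bilinear_area_bil: "bounded_bilinear area_bil"
proof (rule bilinear_conv_bounded_bilinear[THEN iffD1])
  have "linear (area_bil u)" for u :: "'a polygon"
  proof (rule linearI)
    show "area_bil u (x + y) = area_bil u x + area_bil u y" for x y
      by (simp add: area_bil_def cross_simps sum.distrib distrib_left)
    show "area_bil u (r *\<^sub>R x) = r *\<^sub>R area_bil u x" for r x
      by (simp add: area_bil_def cross_simps flip: distrib_left sum_distrib_left)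
  qed
  moreover from this have "linear (\<lambda>u. area_bil u v)" for v :: "'a polygon"
    by (simp add: area_bil_sym[of _ v])
  ultimately show "bilinear (area_bil :: 'a polygon \<Rightarrow> _)" by (simp add: bilinear_def)
qed

lemma has_derivative_area: "(area has_derivative area_bil P) (at P)"
proof -
  have "((\<lambda>Q. area_bil Q Q) has_derivative (\<lambda>v. area_bil P v + area_bil v P)) (at P)"
    by (rule bounded_bilinear.FDERIV[OF bounded_bilinear_area_bil has_derivative_ident
      has_derivative_ident])
  from has_derivative_scaleR_right[OF this, of "1/2"] show ?thesis
    by (simp add: area_bil_self area_bil_sym[of _ P])
qed

text \<open>The terms produced by the translation cancel around the polygon.\<close>

lemma area_isometry:
  fixes P :: "('n::{finite,linorder}) polygon"
  assumes "norm a = 1" shows "area (\<chi> i. a * P $ i + b) = area P"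
proof -
  have "(Re a)\<^sup>2 + (Im a)\<^sup>2 = 1" using assms by (simp add: cmod_def)
  then have rot: "cross (a * p) (a * q) = cross p q" for p q
  proof -
    have "cross (a * p) (a * q) = ((Re a)\<^sup>2 + (Im a)\<^sup>2) * cross p q"
      by (simp add: cross_def power2_eq_square algebra_simps)
    then show ?thesis using \<open>(Re a)\<^sup>2 + (Im a)\<^sup>2 = 1\<close> by simp
  qed
  have "cross (a * p + b) (a * q + b) = cross p q + (cross b (a * q) - cross b (a * p))" for p q
    using cross_skew[of "a * p" b] by (simp add: cross_simps rot)
  then have "(\<Sum>i\<in>UNIV. cross (a * P $ i + b) (a * P $ next_ix i + b))
      = (\<Sum>i\<in>UNIV. cross (P $ i) (P $ next_ix i))"
    using sum_next_ix_diff[of "\<lambda>i. cross b (a * P $ i)"] by (simp add: sum.distrib)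
  then show ?thesis by (simp add: area_def cross_def)
qed

lemma orbit_area_isom_orbit: "orbit_area (isom_orbit P) = area P"
proof -
  have "P \<in> isom_orbit P"
    unfolding isom_orbit_def by (intro CollectI exI[of _ 1] exI[of _ 0]) (simp add: vec_eq_iff)
  then have "area ` isom_orbit P = {area P}"
    using area_isometry by (fastforce simp: isom_orbit_def)
  then show ?thesis by (simp add: orbit_area_def)
qed

section \<open>Infinitesimal isometries as the vertical directions\<close>

definition isom_field :: "('n::{finite,linorder}) polygon \<Rightarrow> real \<Rightarrow> complex \<Rightarrow> 'n polygon" where
  "isom_field P \<omega> b = (\<chi> i. of_real \<omega> * \<i> * P $ i + b)"

text \<open>One non-zero edge determines the rotation factor as a linear function of the polygon, so
  along a smooth curve in the orbit this factor is differentiable and of modulus 1, and its velocity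
  at 0 is imaginary. Conversely each field is the velocity of an explicit curve.\<close>

lemma vertical_eq:
  fixes P :: "('n::{finite,linorder}) polygon"
  assumes "edge P l \<noteq> 0"
  shows "vertical P = {isom_field P \<omega> b | \<omega> b. True}"
proof (intro set_eqI iffI)
  fix v assume "v \<in> vertical P"
  then obtain g where g: "smooth_germ (isom_orbit P) P g" "(g has_vector_derivative v) (at 0)"
    unfolding vertical_def tangent_space_def by blast
  obtain U where U: "open U" "0 \<in> U" "\<And>t. t \<in> U \<Longrightarrow> g t \<in> isom_orbit P" "g 0 = P"
    by (rule smooth_germE[OF g(1)]) blast
  define A where "A t = edge (g t) l / edge P l" for t :: real
  have A: "norm (A t) = 1" "g t $ i - g t $ l = A t * (P $ i - P $ l)" if t: "t \<in> U" for t i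
  proof -
    obtain a b where ab: "norm a = 1" "g t = (\<chi> i. a * P $ i + b)"
      using U(3)[OF t] by (auto simp: isom_orbit_def)
    have "edge (g t) l = a * edge P l" by (simp add: ab(2) edge_def algebra_simps)
    then have "A t = a" using assms by (simp add: A_def)
    then show "norm (A t) = 1" "g t $ i - g t $ l = A t * (P $ i - P $ l)"
      using ab by (simp_all add: algebra_simps)
  qed
  define \<alpha> where "\<alpha> = edge v l / edge P l"
  have "bounded_linear (\<lambda>Q. edge Q l / edge P l)"
    by (rule bounded_linear_compose[OF bounded_linear_divide bounded_linear_edge])
  then have lin: "((\<lambda>Q. edge Q l / edge P l) has_derivative (\<lambda>Q. edge Q l / edge P l)) (at (g 0))"
    by (rule bounded_linear_imp_has_derivative)
  have "((\<lambda>Q. (edge Q l / edge P l) \<bullet> (edge Q l / edge P l)) has_derivative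
      (\<lambda>v. (edge (g 0) l / edge P l) \<bullet> (edge v l / edge P l)
         + (edge v l / edge P l) \<bullet> (edge (g 0) l / edge P l))) (at (g 0))"
    by (rule has_derivative_inner[OF lin lin])
  from derivative_zero_of_constant[OF g(2) this U(1,2), of 1]
  have "1 \<bullet> \<alpha> = 0"
    using A(1) assms by (simp add: A_def \<alpha>_def dot_square_norm U(4) inner_commute)
  then have \<alpha>: "\<alpha> = of_real (Im \<alpha>) * \<i>" by (simp add: complex_eq_iff)
  have diff: "v $ i - v $ l = \<alpha> * (P $ i - P $ l)" for i
  proof -
    have "bounded_linear (\<lambda>Q :: 'n polygon. (Q $ i - Q $ l) - edge Q l / edge P l * (P $ i - P $
      l))"
      by (intro bounded_linear_sub bounded_linear_vec_nth
          bounded_linear_compose[OF bounded_linear_mult_left bounded_linear_compose[OF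
            bounded_linear_divide bounded_linear_edge]])
    then have "((\<lambda>Q. (Q $ i - Q $ l) - edge Q l / edge P l * (P $ i - P $ l)) has_derivative
        (\<lambda>Q. (Q $ i - Q $ l) - edge Q l / edge P l * (P $ i - P $ l))) (at (g 0))"
      by (rule bounded_linear_imp_has_derivative)
    from derivative_zero_of_constant[OF g(2) this U(1,2), of 0]
    show ?thesis using A(2) by (simp add: A_def \<alpha>_def)
  qed
  have "v $ i = isom_field P (Im \<alpha>) (v $ l - \<alpha> * P $ l) $ i" for i
    unfolding isom_field_def \<alpha>[symmetric] vec_lambda_beta using diff[of i]
      by (simp add: algebra_simps)
  then have "v = isom_field P (Im \<alpha>) (v $ l - \<alpha> * P $ l)" by (rule vec_eq_iff[THEN iffD2, OF allI])
  then show "v \<in> {isom_field P \<omega> b | \<omega> b. True}" by blast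
next
  fix v assume "v \<in> {isom_field P \<omega> b | \<omega> b. True}"
  then obtain \<omega> b where v: "v = isom_field P \<omega> b" by blast
  \<comment> \<open>Normalising a straight line in the complex plane replaces the exponential, so
    that smoothness follows from the closure rules above.\<close>
  define q where "q t = 1 + t *\<^sub>R (of_real \<omega> * \<i>)" for t :: real
  define A where "A t = (1 / norm (q t)) *\<^sub>R q t" for t
  define g where "g t = (\<chi> i. A t * P $ i + t *\<^sub>R b)" for t
  have Re_q: "Re (q t) = 1" for t by (simp add: q_def)
  then have q_ne: "q t \<noteq> 0" for t by (metis zero_complex.sel(1) zero_neq_one)
  have smooth_q: "smooth_map_on UNIV q"
    unfolding q_def[abs_def]
    by (intro smooth_map_on_add[OF open_UNIV] smooth_map_on_const[OF open_UNIV]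
        smooth_map_on_bounded_linear[OF open_UNIV] bounded_linear_scaleR_left)
  have smooth_A: "smooth_map_on UNIV A"
    unfolding A_def[abs_def]
    by (intro smooth_map_on_scaleR[OF open_UNIV] smooth_map_on_divide[OF open_UNIV]
        smooth_map_on_norm[OF open_UNIV] smooth_map_on_const[OF open_UNIV] smooth_q) (auto simp:
          q_ne)
  have "smooth_map_on UNIV g"
    unfolding g_def[abs_def]
    by (intro smooth_map_on_vec[OF open_UNIV] smooth_map_on_add[OF open_UNIV]
        smooth_map_on_mult[OF open_UNIV] smooth_map_on_const[OF open_UNIV] smooth_A
        smooth_map_on_bounded_linear[OF open_UNIV] bounded_linear_scaleR_left)
  moreover have "g t \<in> isom_orbit P" for t
    using q_ne[of t] unfolding isom_orbit_def g_def A_def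
    by (intro CollectI exI[of _ "(1 / norm (q t)) *\<^sub>R q t"] exI[of _ "t *\<^sub>R b"]) simp
  moreover have "g 0 = P" by (simp add: g_def A_def q_def vec_eq_iff)
  ultimately have germ: "smooth_germ (isom_orbit P) P g"
    unfolding smooth_germ_def by (intro conjI exI[of _ UNIV]) auto
  have q': "(q has_derivative (\<lambda>t. t *\<^sub>R (of_real \<omega> * \<i>))) (at 0)"
    unfolding q_def[abs_def]
    using has_derivative_add[OF has_derivative_const
        bounded_linear_imp_has_derivative[OF bounded_linear_scaleR_left]] by simp
  have q0: "q 0 = 1" by (simp add: q_def)
  have "((\<lambda>t. norm (q t)) has_derivative (\<lambda>t. (t *\<^sub>R (of_real \<omega> * \<i>)) \<bullet> sgn (q 0))) (at 0)"
    by (rule has_derivative_compose[OF q' has_derivative_norm]) (simp add: q0)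
  then have norm': "((\<lambda>t. norm (q t)) has_derivative (\<lambda>t. 0)) (at 0)"
    by (simp add: q0 inner_complex_def)
  have "((\<lambda>t. 1 / norm (q t)) has_derivative (\<lambda>t. 0)) (at 0)"
    using has_derivative_divide'[OF has_derivative_const norm', of 1] q_ne[of 0] by simp
  from has_derivative_scaleR[OF this q']
  have A': "(A has_derivative (\<lambda>t. t *\<^sub>R (of_real \<omega> * \<i>))) (at 0)"
    by (simp add: A_def[abs_def] q0)
  have comp: "((\<lambda>t. g t $ i) has_derivative (\<lambda>t. (t *\<^sub>R v) $ i)) (at 0)" for i
  proof -
    have "((\<lambda>t. A t * P $ i + t *\<^sub>R b) has_derivative
        (\<lambda>t. (t *\<^sub>R (of_real \<omega> * \<i>)) * P $ i + t *\<^sub>R b)) (at 0)"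
      by (intro has_derivative_add has_derivative_mult_left[OF A']
          bounded_linear_imp_has_derivative bounded_linear_scaleR_left)
    then show ?thesis by (simp add: g_def v isom_field_def scaleR_add_right)
  qed
  have "(g has_derivative (\<lambda>t. t *\<^sub>R v)) (at 0)"
  proof (subst has_derivative_componentwise_within, intro ballI)
    fix b :: "'n polygon" assume "b \<in> Basis"
    then obtain i c where b: "b = axis i c" by (auto simp: Basis_vec_def)
    show "((\<lambda>x. g x \<bullet> b) has_derivative (\<lambda>x. (x *\<^sub>R v) \<bullet> b)) (at 0)"
      unfolding b inner_axis by (rule has_derivative_inner_left[OF comp])
  qed
  then show "v \<in> vertical P"
    unfolding vertical_def tangent_space_def has_vector_derivative_def using germ by blast
qed

text \<open>The quotient is the second derivative of the norm of edge \<open>i\<close>: only the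
  parts of the variations normal to the edge enter.\<close>

definition hess_form ::
  "('n::{finite,linorder}) polygon \<Rightarrow> ('n \<Rightarrow> real) \<Rightarrow> 'n polygon \<Rightarrow> 'n polygon \<Rightarrow> real" where
  "hess_form P c u v = area_bil u v - (\<Sum>i\<in>UNIV. c i *
     (cross (edge P i) (edge u i) * cross (edge P i) (edge v i) / norm (edge P i) ^ 3))"

lemma sym_form_hess_form: "sym_form (hess_form P c)"
proof
  show sym: "hess_form P c x y = hess_form P c y x" for x y
    by (simp add: hess_form_def area_bil_sym[of x] mult.commute mult.left_commute)
  interpret area: bounded_bilinear area_bil by (rule bounded_bilinear_area_bil)
  have "linear (hess_form P c u)" for u
  proof (rule linearI)
    show "hess_form P c u (x + y) = hess_form P c u x + hess_form P c u y" for x y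
      by (simp add: hess_form_def area.add_right edge_add cross_simps add_divide_distrib
          distrib_left sum.distrib)
    show "hess_form P c u (r *\<^sub>R x) = r *\<^sub>R hess_form P c u x" for r x
      by (simp add: hess_form_def area.scaleR_right edge_scaleR cross_simps sum_distrib_left
          right_diff_distrib mult_ac)
  qed
  moreover from this have "linear (\<lambda>u. hess_form P c u v)" for v by (simp add: sym[of _ v])
  ultimately show "bilinear (hess_form P c)" by (simp add: bilinear_def)
qed

text \<open>\<open>a\<close> and \<open>b\<close> are the two edges with which germs are closed
  up.\<close>

locale necklace_point =
  fixes N :: "('k::{finite,linorder}) necklace" and P :: "('n::{finite,linorder}) polygon"
    and a b :: 'n
  assumes neck: "is_necklace N" and total: "(\<Sum>j\<in>UNIV. bd_num N j) = CARD('n)"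
    and P: "P \<in> Msm_tilde N" and card2: "CARD('n) \<ge> 2"
    and ab: "cross (edge P a) (edge P b) \<noteq> 0"
begin

lemma edge_nonzero: "Q \<in> Msm_tilde N \<Longrightarrow> edge Q i \<noteq> 0" for Q :: "'n polygon"
  using nonsingular_edge_nonzero[OF _ total card2] by (simp add: Msm_tilde_def)

definition T :: "'n polygon set" where
  "T = {v. \<forall>j. (\<Sum>i\<in>block N j. edge_len_deriv P i v) = 0}"

lemma subspace_T: "subspace T"
  unfolding subspace_def T_def
  by (simp add: edge_len_deriv_add edge_len_deriv_scaleR sum.distrib sum_distrib_left[symmetric])
    (simp add: edge_len_deriv_def edge_def)

lemma germ_along:
  assumes "bounded_linear L" "\<And>x. L x \<in> T"
  obtains g where "smooth_germ (Msm_tilde N) P g" "(g has_derivative L) (at 0)"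
  using exists_germ[OF neck total _ edge_nonzero[OF P] ab assms(1)] assms(2) P
  by (auto simp: T_def Msm_tilde_def)

lemma curve_in_Msm_tilde:
  fixes \<gamma> :: "real \<Rightarrow> 'n polygon"
  assumes "(\<gamma> has_vector_derivative v) (at t)" "open S" "t \<in> S" "\<And>s. s \<in> S \<Longrightarrow> \<gamma> s \<in> Msm_tilde N"
  shows "(\<Sum>i\<in>block N j. edge_len_deriv (\<gamma> t) i v) = 0"
proof (rule derivative_zero_of_constant[OF assms(1) _ assms(2,3)])
  show "((\<lambda>Q. \<Sum>i\<in>block N j. edge_len Q i) has_derivative
      (\<lambda>v. \<Sum>i\<in>block N j. edge_len_deriv (\<gamma> t) i v)) (at (\<gamma> t))"
    by (intro has_derivative_sum has_derivative_edge_len edge_nonzero assms(4)[OF assms(3)])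
  show "(\<Sum>i\<in>block N j. edge_len (\<gamma> s) i) = bd_len N j" if "s \<in> S" for s
    using assms(4)[OF that] by (simp add: Msm_tilde_def configuration_def block_len_def)
qed

lemma tangent_space_eq: "tangent_space (Msm_tilde N) P = T"
proof (intro set_eqI iffI)
  fix v assume "v \<in> tangent_space (Msm_tilde N) P"
  then obtain g where g: "smooth_germ (Msm_tilde N) P g" "(g has_vector_derivative v) (at 0)"
    unfolding tangent_space_def by blast
  obtain U where U: "open U" "0 \<in> U" "\<And>t. t \<in> U \<Longrightarrow> g t \<in> Msm_tilde N" "g 0 = P"
    by (rule smooth_germE[OF g(1)]) blast
  show "v \<in> T" using curve_in_Msm_tilde[OF g(2) U(1-3)] U(4) by (simp add: T_def)
next
  fix v assume v: "v \<in> T"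
  obtain g where "smooth_germ (Msm_tilde N) P g" "(g has_derivative (\<lambda>t::real. t *\<^sub>R v)) (at 0)"
    by (rule germ_along[OF bounded_linear_scaleR_left]) (use v subspace_T subspace_scale in blast)
  then show "v \<in> tangent_space (Msm_tilde N) P"
    unfolding tangent_space_def has_vector_derivative_def by blast
qed

lemma critical_area_bil:
  assumes "critical_point N P" "v \<in> T" shows "area_bil P v = 0"
proof -
  obtain g where g: "smooth_germ (Msm_tilde N) P g" "(g has_vector_derivative v) (at 0)"
    using assms(2) unfolding tangent_space_eq[symmetric] tangent_space_def by blast
  have "g 0 = P" using g(1) by (simp add: smooth_germ_def)
  then have "((\<lambda>t. area (g t)) has_vector_derivative area_bil P v) (at 0)"
    using has_vector_derivative_compose_derivative[OF g(2) has_derivative_area] by simp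
  moreover have "((\<lambda>t. area (g t)) has_real_derivative 0) (at 0)"
    using assms(1) g(1) by (simp add: critical_point_def orbit_area_isom_orbit)
  ultimately show ?thesis
    by (metis has_real_derivative_iff_has_vector_derivative vector_derivative_unique_at)
qed

text \<open>The mixed second derivative \<open>\<xi>\<close> of the family enters only through
  \<open>area_bil P \<xi>\<close>. The multipliers turn this into a sum of
  \<open>c i * edge_len_deriv P i \<xi>\<close>, and since they are constant on beads,
  differentiating the bead constraints twice expresses that sum by \<open>u\<close> and
  \<open>v\<close>.\<close>

lemma second_derivative_area:
  fixes g :: "real \<times> real \<Rightarrow> 'n polygon"
  assumes c: "\<And>w. area_bil P w = (\<Sum>i\<in>UNIV. c i * edge_len_deriv P i w)" "\<And>i. c i = \<mu> (bead N i)"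
    and g: "smooth_germ (Msm_tilde N) P g"
    and u: "((\<lambda>s. g (s, 0)) has_vector_derivative u) (at 0)"
    and v: "((\<lambda>t. g (0, t)) has_vector_derivative v) (at 0)"
  shows "deriv (\<lambda>s. deriv (\<lambda>t. orbit_area (isom_orbit (g (s, t)))) 0) 0 = hess_form P c u v"
proof -
  obtain U where U: "open U" "0 \<in> U" "smooth_map_on U g" "\<And>x. x \<in> U \<Longrightarrow> g x \<in> Msm_tilde N" "g 0 = P"
    by (rule smooth_germE[OF g]) blast
  define G where "G x = frechet_derivative g (at x)" for x
  have G: "(g has_derivative G x) (at x)" if "x \<in> U" for x
    unfolding G_def using smooth_map_on_derivative[OF U(1,3) that] .
  define \<eta> where "\<eta> s = G (s, 0) (0, 1)" for s :: real
  define V where "V = (\<lambda>s::real. (s, 0::real)) -` U"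
  have V: "open V" "0 \<in> V"
    using U(1,2) unfolding V_def by (auto intro!: open_vimage continuous_intros simp: zero_prod_def)
  have fst_curve: "((\<lambda>s. (s, 0)) has_vector_derivative (1, 0)) (at (s::real))" for s
    unfolding has_vector_derivative_def by (auto intro!: derivative_eq_intros)
  have snd_curve: "((\<lambda>t. (s, t)) has_vector_derivative (0, 1)) (at (t::real))" for s t :: real
    unfolding has_vector_derivative_def
    by (auto intro!: derivative_eq_intros)
  have curve: "((\<lambda>t. g (s, t)) has_vector_derivative \<eta> s) (at 0)" if "s \<in> V" for s
    unfolding \<eta>_def
    by (rule has_vector_derivative_compose_derivative[OF snd_curve G]) (use that in \<open>simp add:
      V_def\<close>)
  have "\<eta> 0 = v" using vector_derivative_unique_at[OF curve[OF V(2)] v] .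
  obtain \<xi> where \<xi>: "(\<eta> has_vector_derivative \<xi>) (at 0)"
  proof -
    have "smooth_map_on U (\<lambda>x. G x (0, 1))"
      unfolding G_def by (rule smooth_map_on_frechet[OF U(1,3)])
    from smooth_map_on_derivative[OF U(1) this U(2)]
    have "\<exists>D. ((\<lambda>x. G x (0, 1)) has_derivative D) (at (0, 0))" by (auto simp: zero_prod_def)
    then show ?thesis
      using has_vector_derivative_compose_derivative[OF fst_curve, of "\<lambda>x. G x (0, 1)" _ 0] that
      unfolding \<eta>_def[abs_def] by blast
  qed
  have g0: "g (0, 0) = P" using U(5) by (simp add: zero_prod_def)
  interpret area: bounded_bilinear area_bil by (rule bounded_bilinear_area_bil)
  have inner: "deriv (\<lambda>t. orbit_area (isom_orbit (g (s, t)))) 0 = area_bil (g (s, 0)) (\<eta> s)"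
    if "s \<in> V" for s
    unfolding orbit_area_isom_orbit
    by (rule DERIV_imp_deriv)
      (use has_vector_derivative_compose_derivative[OF curve[OF that] has_derivative_area]
        in \<open>simp add: has_real_derivative_iff_has_vector_derivative\<close>)
  have "((\<lambda>s. area_bil (g (s, 0)) (\<eta> s)) has_vector_derivative area_bil P \<xi> + area_bil u v) (at 0)"
    using area.has_vector_derivative[OF u \<xi>] \<open>\<eta> 0 = v\<close> g0 by simp
  then have "((\<lambda>s. deriv (\<lambda>t. orbit_area (isom_orbit (g (s, t)))) 0)
      has_vector_derivative area_bil P \<xi> + area_bil u v) (at 0)"
    by (rule has_vector_derivative_transform_within_open[OF _ V]) (simp add: inner)
  then have outer: "deriv (\<lambda>s. deriv (\<lambda>t. orbit_area (isom_orbit (g (s, t)))) 0) 0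
      = area_bil P \<xi> + area_bil u v"
    by (intro DERIV_imp_deriv) (simp add: has_real_derivative_iff_has_vector_derivative)
  define C where "C i = cross (edge P i) (edge u i) * cross (edge P i) (edge v i) / norm (edge P i)
    ^ 3" for i
  have len2: "((\<lambda>s. edge_len_deriv (g (s, 0)) i (\<eta> s)) has_real_derivative
      edge_len_deriv P i \<xi> + C i) (at 0)" for i
  proof -
    have e: "edge P i \<noteq> 0" by (rule edge_nonzero[OF P])
    have e_u: "((\<lambda>s. edge (g (s, 0)) i) has_vector_derivative edge u i) (at 0)"
      and e_\<xi>: "((\<lambda>s. edge (\<eta> s) i) has_vector_derivative edge \<xi> i) (at 0)"
      using bounded_linear.has_vector_derivative[OF bounded_linear_edge] u \<xi> by blast+
    have num: "((\<lambda>s. edge (g (s, 0)) i \<bullet> edge (\<eta> s) i) has_real_derivative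
        edge P i \<bullet> edge \<xi> i + edge u i \<bullet> edge v i) (at 0)"
      using bounded_bilinear.has_vector_derivative[OF bounded_bilinear_inner e_u e_\<xi>]
      by (simp add: has_real_derivative_iff_has_vector_derivative g0 \<open>\<eta> 0 = v\<close>)
    have den: "((\<lambda>s. norm (edge (g (s, 0)) i)) has_real_derivative edge_len_deriv P i u) (at 0)"
      using has_vector_derivative_compose_derivative[OF u, of "\<lambda>Q. edge_len Q i"]
        has_derivative_edge_len[OF e]
      by (simp add: has_real_derivative_iff_has_vector_derivative g0 edge_len_eq)
    \<comment> \<open>Lagrange's identity leaves exactly the normal components that occur in
      \<open>hess_form\<close>.\<close>
    have lagrange: "(edge u i \<bullet> edge v i) * (norm (edge P i))\<^sup>2
        = (edge P i \<bullet> edge v i) * (edge P i \<bullet> edge u i)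
          + cross (edge P i) (edge u i) * cross (edge P i) (edge v i)"
      unfolding power2_norm_eq_inner
      by (simp add: inner_complex_def cross_def algebra_simps)
    have "((edge P i \<bullet> edge \<xi> i + edge u i \<bullet> edge v i) * norm (edge P i)
        - (edge P i \<bullet> edge v i) * edge_len_deriv P i u) / (norm (edge P i) * norm (edge P i))
        = edge_len_deriv P i \<xi> + C i"
      using e lagrange unfolding edge_len_deriv_def C_def
      by (simp add: field_simps power2_eq_square power3_eq_cube)
    then show ?thesis
      using DERIV_divide[OF num den] e g0 \<open>\<eta> 0 = v\<close> unfolding edge_len_deriv_def by simp
  qed
  have "(\<Sum>i\<in>block N j. edge_len_deriv P i \<xi> + C i) = 0" for j
  proof -
    have zero: "(\<Sum>i\<in>block N j. edge_len_deriv (g (s, 0)) i (\<eta> s)) = 0" if "s \<in> V" for s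
    proof (rule curve_in_Msm_tilde[OF curve[OF that]])
      show "open ((\<lambda>t. (s, t)) -` U)"
        using U(1) by (auto intro!: open_vimage continuous_intros)
    qed (use that U(4) in \<open>auto simp: V_def\<close>)
    have "((\<lambda>s. \<Sum>i\<in>block N j. edge_len_deriv (g (s, 0)) i (\<eta> s)) has_real_derivative
        (\<Sum>i\<in>block N j. edge_len_deriv P i \<xi> + C i)) (at 0)"
      by (intro DERIV_sum len2)
    then have "((\<lambda>s. 0) has_real_derivative (\<Sum>i\<in>block N j. edge_len_deriv P i \<xi> + C i)) (at 0)"
      by (rule has_field_derivative_transform_within_open[OF _ V]) (simp add: zero)
    then show ?thesis by (rule DERIV_unique[OF _ DERIV_const])
  qed
  then have "(\<Sum>i\<in>block N j. c i * (edge_len_deriv P i \<xi> + C i)) = 0" for j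
  proof -
    have "(\<Sum>i\<in>block N j. c i * (edge_len_deriv P i \<xi> + C i))
        = \<mu> j * (\<Sum>i\<in>block N j. edge_len_deriv P i \<xi> + C i)"
      unfolding sum_distrib_left by (intro sum.cong) (auto simp: c(2) in_block_iff[OF total])
    then show ?thesis using \<open>\<And>j. (\<Sum>i\<in>block N j. edge_len_deriv P i \<xi> + C i) = 0\<close> by simp
  qed
  then have "(\<Sum>i\<in>UNIV. c i * (edge_len_deriv P i \<xi> + C i)) = 0"
    by (simp flip: sum_blocks[OF total])
  then have "area_bil P \<xi> = - (\<Sum>i\<in>UNIV. c i * C i)"
    by (simp add: c(1) algebra_simps sum.distrib)
  then show ?thesis unfolding outer hess_form_def C_def by simp
qed

end

section \<open>Descent to the quotient by the isometries\<close>

locale critical_necklace_point = necklace_point +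
  fixes c :: "'b \<Rightarrow> real" and \<mu> :: "'a \<Rightarrow> real"
  assumes area_c: "\<And>w. area_bil P w = (\<Sum>i\<in>UNIV. c i * edge_len_deriv P i w)"
    and c_block: "\<And>i. c i = \<mu> (bead N i)"
    and critical: "critical_point N P"
    and hess_vertical: "\<And>x v. x \<in> vertical P \<Longrightarrow> hess_form P c x v = 0"
begin

sublocale H: sym_form "hess_form P c"
  by (rule sym_form_hess_form)

abbreviation "V \<equiv> vertical P"
abbreviation coset :: "'b polygon \<Rightarrow> 'b polygon set" where "coset u \<equiv> (\<lambda>w. u + w) ` V"

lemma V_eq: "V = {isom_field P \<omega> b | \<omega> b. True}"
  by (rule vertical_eq[OF edge_nonzero[OF P]])

lemma subspace_V: "subspace V"
proof -
  have "isom_field P 0 0 = 0"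
    and "isom_field P \<omega> b + isom_field P \<omega>' b' = isom_field P (\<omega> + \<omega>') (b + b')"
    and "r *\<^sub>R isom_field P \<omega> b = isom_field P (r * \<omega>) (r *\<^sub>R b)" for \<omega> b \<omega>' b' r
    by (simp_all add: isom_field_def vec_eq_iff complex_eq_iff algebra_simps)
  then show ?thesis unfolding subspace_def V_eq by (fastforce intro: sym)
qed

lemma V_subset_T: "V \<subseteq> T"
proof
  fix v assume "v \<in> V"
  then obtain \<omega> b where v: "v = isom_field P \<omega> b" unfolding V_eq by blast
  have "edge v i = \<omega> *\<^sub>R (\<i> * edge P i)" for i
    by (simp add: v isom_field_def edge_def scaleR_conv_of_real algebra_simps)
  then have "edge_len_deriv P i v = 0" for i by (simp add: edge_len_deriv_def inner_rotate)
  then show "v \<in> T" by (simp add: T_def)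
qed

lemma hess_vertical_right: "x \<in> V \<Longrightarrow> hess_form P c v x = 0"
  using hess_vertical H.sym by metis

lemma coset_eq_iff: "coset u = coset v \<longleftrightarrow> u - v \<in> V"
proof
  assume "coset u = coset v"
  moreover have "u + 0 \<in> coset u" using subspace_V subspace_0 by blast
  ultimately obtain w where "u = v + w" "w \<in> V" by auto
  then show "u - v \<in> V" by simp
next
  assume uv: "u - v \<in> V"
  have sub: "coset x \<subseteq> coset y" if "x - y \<in> V" for x y
  proof
    fix p assume "p \<in> coset x"
    then obtain w where "w \<in> V" "p = x + w" by blast
    then have "(x - y) + w \<in> V" "p = y + ((x - y) + w)"
      using subspace_add[OF subspace_V that] by simp_all
    then show "p \<in> coset y" by blast
  qed
  have "v - u \<in> V" using subspace_neg[OF subspace_V uv] by simp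
  then show "coset u = coset v" using sub uv by blast
qed

lemma coset_eq_V_iff: "coset u = V \<longleftrightarrow> u \<in> V"
  using coset_eq_iff[of u 0] by (simp only: add_0 image_ident diff_0_right)

lemma Msm_tangent_eq: "Msm_tangent N P = coset ` T"
  unfolding Msm_tangent_def tangent_space_eq by auto

text \<open>A germ with velocity \<open>s *\<^sub>R u + t *\<^sub>R v\<close> provides a value for
  the definite description; other representatives of the cosets differ by vertical vectors, which
  lie in the radical.\<close>

lemma area_Hess_eq:
  assumes u: "u \<in> T" and v: "v \<in> T"
  shows "area_Hess N P (coset u) (coset v) = hess_form P c u v"
  unfolding area_Hess_def
proof (rule the_equality)
  let ?L = "\<lambda>x :: real \<times> real. fst x *\<^sub>R u + snd x *\<^sub>R v"
  have "bounded_linear ?L"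
    by (intro bounded_linear_add bounded_linear_compose[OF bounded_linear_scaleR_left]
        bounded_linear_fst bounded_linear_snd)
  moreover have "?L x \<in> T" for x using u v subspace_T by (simp add: subspace_add subspace_scale)
  ultimately obtain g where g: "smooth_germ (Msm_tilde N) P g" "(g has_derivative ?L) (at 0)"
    by (rule germ_along)
  have 1: "((\<lambda>s. (s, 0)) has_vector_derivative (1, 0)) (at (0::real))"
    and 2: "((\<lambda>t. (0, t)) has_vector_derivative (0, 1)) (at (0::real))"
    unfolding has_vector_derivative_def by (auto intro!: derivative_eq_intros)
  have gu: "((\<lambda>s. g (s, 0)) has_vector_derivative u) (at 0)"
    using has_vector_derivative_compose_derivative[OF 1, of g ?L] g(2) by (simp add: zero_prod_def)
  have gv: "((\<lambda>t. g (0, t)) has_vector_derivative v) (at 0)"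
    using has_vector_derivative_compose_derivative[OF 2, of g ?L] g(2) by (simp add: zero_prod_def)
  have "u + 0 \<in> coset u" "v + 0 \<in> coset v" using subspace_V subspace_0 by blast+
  then have mem: "u \<in> coset u" "v \<in> coset v" by simp_all
  show "\<exists>(g :: real \<times> real \<Rightarrow> 'b polygon) u' v'. smooth_germ (Msm_tilde N) P g \<and>
      u' \<in> coset u \<and> v' \<in> coset v \<and>
      ((\<lambda>s. g (s, 0)) has_vector_derivative u') (at 0) \<and>
      ((\<lambda>t. g (0, t)) has_vector_derivative v') (at 0) \<and>
      hess_form P c u v = deriv (\<lambda>s. deriv (\<lambda>t. orbit_area (isom_orbit (g (s, t)))) 0) 0"
    using second_derivative_area[OF area_c c_block g(1) gu gv] g(1) gu gv mem by metis
next
  fix h assume "\<exists>(g :: real \<times> real \<Rightarrow> 'b polygon) u' v'. smooth_germ (Msm_tilde N) P g \<and>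
      u' \<in> coset u \<and> v' \<in> coset v \<and>
      ((\<lambda>s. g (s, 0)) has_vector_derivative u') (at 0) \<and>
      ((\<lambda>t. g (0, t)) has_vector_derivative v') (at 0) \<and>
      h = deriv (\<lambda>s. deriv (\<lambda>t. orbit_area (isom_orbit (g (s, t)))) 0) 0"
  then obtain u' v' where "u' \<in> coset u" "v' \<in> coset v" and h: "h = hess_form P c u' v'"
    using second_derivative_area[OF area_c c_block] by metis
  then obtain x y where "x \<in> V" "y \<in> V" "u' = u + x" "v' = v + y" by blast
  then show "h = hess_form P c u v"
    using h by (simp add: H.bil_simps hess_vertical hess_vertical_right)
qed

lemma Morse_point_iff:
  "Morse_point N P \<longleftrightarrow> (\<forall>u\<in>T. (\<forall>v\<in>T. hess_form P c u v = 0) \<longrightarrow> u \<in> V)"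
  unfolding Morse_point_def Msm_tangent_eq ball_simps
  using critical by (simp add: area_Hess_eq coset_eq_V_iff)

text \<open>Subspaces of the quotient correspond to subspaces of \<open>T\<close> containing
  \<open>V\<close>. Inside a negative definite one, the orthogonal complement of \<open>V\<close>
  has the dimension of the quotient. Conversely a negative definite \<open>W\<close> meets the
  radical \<open>V\<close> only in 0, so no dimension is lost in passing to its cosets.\<close>

lemma Morse_index_eq:
  assumes "has_index (hess_form P c) T m" shows "Morse_index N P = m"
  unfolding Morse_index_def
proof (rule Max_eqI)
  let ?R = "{dim (\<Union>S) - dim V | S. S \<subseteq> Msm_tangent N P \<and> subspace (\<Union>S) \<and>
      (\<forall>X\<in>S. X \<noteq> V \<longrightarrow> area_Hess N P X X < 0)}"
  show le: "y \<le> m" if y: "y \<in> ?R" for y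
  proof -
    obtain S where S: "y = dim (\<Union>S) - dim V" "S \<subseteq> coset ` T" "subspace (\<Union>S)"
        "\<forall>X\<in>S. X \<noteq> V \<longrightarrow> area_Hess N P X X < 0"
      using y unfolding Msm_tangent_eq by (elim CollectE exE conjE) (rule that)
    have coset_S: "coset x \<in> S \<and> x \<in> T" if x: "x \<in> \<Union>S" for x
    proof -
      obtain u where u: "u \<in> T" "coset u \<in> S" "x \<in> coset u" using x S(2) by blast
      then obtain w where w: "w \<in> V" "x = u + w" by blast
      then have "coset x = coset u" by (simp only: coset_eq_iff add_diff_cancel_left')
      then show ?thesis using u w V_subset_T subspace_T subspace_add by (metis subsetD)
    qed
    have "V \<subseteq> \<Union>S" using coset_S[OF subspace_0[OF S(3)]] by auto
    define W where "W = {y \<in> \<Union>S. \<forall>x\<in>V. orthogonal x y}"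
    have dim: "dim W + dim V = dim (\<Union>S)"
      unfolding W_def by (rule dim_subspace_orthogonal_to_vectors[OF subspace_V S(3) \<open>V \<subseteq> \<Union>S\<close>])
    have "W = \<Union>S \<inter> {y. \<forall>x\<in>V. orthogonal x y}" by (auto simp: W_def)
    then have "subspace W"
      using subspace_Int[of "{\<Union>S, {y. \<forall>x\<in>V. orthogonal x y}}"] S(3)
        subspace_orthogonal_to_vectors[of V] by (metis subspace_inter)
    moreover have "W \<subseteq> T" using coset_S by (auto simp: W_def)
    moreover have "neg_def_on (hess_form P c) W"
      unfolding neg_def_on_def
    proof (intro ballI impI)
      fix x assume x: "x \<in> W" "x \<noteq> 0"
      then have "x \<notin> V" by (auto simp: W_def orthogonal_def)
      then have "coset x \<noteq> V" using coset_eq_V_iff by blast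
      moreover have "coset x \<in> S" "x \<in> T" using coset_S x(1) by (auto simp: W_def)
      ultimately show "hess_form P c x x < 0" using S(4) area_Hess_eq by metis
    qed
    ultimately have "dim W \<le> m" by (rule has_index_upper[OF assms])
    then show ?thesis using dim S(1) by simp
  qed
  show "finite ?R" by (rule finite_subset[of _ "{..m}"]) (use le in auto)
  obtain W where W: "subspace W" "W \<subseteq> T" "neg_def_on (hess_form P c) W" "dim W = m"
    using assms by (rule has_indexE)
  have "\<Union>(coset ` W) = {x + y | x y. x \<in> W \<and> y \<in> V}" by auto
  moreover have "W \<inter> V = {0}"
    using W(1,3) subspace_V hess_vertical subspace_0 by (fastforce simp: neg_def_on_def)
  ultimately have "subspace (\<Union>(coset ` W))" "dim (\<Union>(coset ` W)) = m + dim V"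
    using subspace_sums[OF W(1) subspace_V] dim_sums_Int[OF W(1) subspace_V] W(4) by simp_all
  moreover have "area_Hess N P (coset x) (coset x) < 0" if "x \<in> W" "coset x \<noteq> V" for x
  proof -
    have "x \<noteq> 0" using that(2) coset_eq_V_iff subspace_0[OF subspace_V] by blast
    then show ?thesis using W(2,3) that(1) by (auto simp: area_Hess_eq neg_def_on_def)
  qed
  ultimately show "m \<in> ?R"
    using W(2) unfolding Msm_tangent_eq by (intro CollectI exI[of _ "coset ` W"]) auto
qed

end

section \<open>The diagonalised form\<close>

lemma cis_eq_1_imp_0:
  assumes "cis y = 1" "\<bar>y\<bar> < 2 * pi" shows "y = 0"
proof -
  obtain n :: int where n: "y = 2 * pi * n"
    using assms(1) by (auto simp: cis_conv_exp exp_eq_1)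
  then have "\<bar>real_of_int n\<bar> < 1" using assms(2) by (simp add: abs_mult)
  then show ?thesis using n by simp
qed

lemma cis_eq_minus_1_imp_pi:
  assumes "cis y = -1" "- pi < y" "y < 3 * pi" shows "y = pi"
  using cis_eq_1_imp_0[of "y - pi"] assms by (simp add: cis_divide[symmetric])

text \<open>\<open>\<kappa>\<close> and \<open>\<sigma>\<close> are coordinates of the vertices in a
  rotated frame at the centre. With \<open>z = \<kappa> + \<i> * \<sigma>\<close> and
  \<open>z'\<close> for the next vertex, the turning equations are the real and imaginary parts of
  \<open>z' * (1 - \<i> * \<tau>) = z * (1 + \<i> * \<tau>)\<close>, so no angles occur.\<close>

locale cyclic_form =
  fixes \<tau> \<kappa> \<sigma> :: "'n::{finite,linorder} \<Rightarrow> real" and R :: real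
  assumes \<tau>: "\<And>i. \<tau> i \<noteq> 0" and \<kappa>: "\<And>i. \<kappa> i \<noteq> 0" and radius: "\<And>i. (\<kappa> i)\<^sup>2 + (\<sigma> i)\<^sup>2 = R"
    and turn_Re: "\<And>i. \<kappa> (next_ix i) + \<tau> i * \<sigma> (next_ix i) = \<kappa> i - \<tau> i * \<sigma> i"
    and turn_Im: "\<And>i. \<sigma> (next_ix i) - \<tau> i * \<kappa> (next_ix i) = \<sigma> i + \<tau> i * \<kappa> i"
begin

lemma next_\<kappa>: "\<kappa> (next_ix i) * (1 + (\<tau> i)\<^sup>2) = \<kappa> i * (1 - (\<tau> i)\<^sup>2) - 2 * \<tau> i * \<sigma> i"
  and next_\<sigma>: "\<sigma> (next_ix i) * (1 + (\<tau> i)\<^sup>2) = \<sigma> i * (1 - (\<tau> i)\<^sup>2) + 2 * \<tau> i * \<kappa> i"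
  and prev_\<kappa>: "\<kappa> i * (1 + (\<tau> i)\<^sup>2) = \<kappa> (next_ix i) * (1 - (\<tau> i)\<^sup>2) + 2 * \<tau> i * \<sigma> (next_ix i)"
  using turn_Re[of i] turn_Im[of i] by algebra+

lemma R_pos: "R > 0"
  using radius[of undefined] \<kappa>[of undefined] by (metis sum_power2_gt_zero_iff)

text \<open>Twice \<open>\<kappa> i * \<kappa> (next_ix i)\<close> divided by the sine of the edge
  angle, written with the half-angle tangent.\<close>

definition wt :: "'n \<Rightarrow> real" where
  "wt i = \<kappa> i * \<kappa> (next_ix i) * (1 + (\<tau> i)\<^sup>2) / \<tau> i"

lemma one_plus_\<tau>2: "1 + (\<tau> i)\<^sup>2 > 0"
  by (rule add_pos_nonneg) auto

lemma wt_nonzero: "wt i \<noteq> 0"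
  using \<tau>[of i] \<kappa>[of i] \<kappa>[of "next_ix i"] one_plus_\<tau>2[of i] by (simp add: wt_def)

text \<open>The cross product of consecutive vertices is \<open>R\<close> times the sine of the edge
  angle; divided by both values of \<open>\<kappa>\<close> it becomes a difference of slopes. So the
  reciprocal weights telescope.\<close>

lemma inverse_wt: "1 / wt i = (\<sigma> (next_ix i) / \<kappa> (next_ix i) - \<sigma> i / \<kappa> i) / (2 * R)"
proof -
  have "(\<sigma> (next_ix i) * \<kappa> i - \<sigma> i * \<kappa> (next_ix i)) * (1 + (\<tau> i)\<^sup>2) = 2 * \<tau> i * R"
    using next_\<kappa>[of i] next_\<sigma>[of i] radius[of i] by algebra
  then show ?thesis
    using \<tau>[of i] \<kappa>[of i] \<kappa>[of "next_ix i"] one_plus_\<tau>2[of i] R_pos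
    by (simp add: wt_def divide_simps)
qed

lemma sum_inverse_wt: "(\<Sum>i\<in>UNIV. 1 / wt i) = 0"
  using sum_next_ix_diff[of "\<lambda>i. \<sigma> i / \<kappa> i"]
  unfolding inverse_wt sum_divide_distrib[symmetric] by simp

definition Q :: "(real, 'n) vec \<Rightarrow> (real, 'n) vec \<Rightarrow> real" where
  "Q a b = (\<Sum>i\<in>UNIV. \<tau> i * (a $ i + a $ next_ix i) * (b $ i + b $ next_ix i)
     - (a $ next_ix i - a $ i) * (b $ next_ix i - b $ i) / \<tau> i)"

text \<open>The vector \<open>\<kappa>\<close> lies in the kernel of \<^term>\<open>Q\<close>; dividing by it turns \<^term>\<open>Q\<close> into a
  diagonal form in the differences of the quotients.\<close>

lemma Q_differences:
  "Q a b = - (\<Sum>i\<in>UNIV. wt i * (a $ next_ix i / \<kappa> (next_ix i) - a $ i / \<kappa> i)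
      * (b $ next_ix i / \<kappa> (next_ix i) - b $ i / \<kappa> i))"
proof -
  \<comment> \<open>The diagonal terms left over after collecting the differences are a cyclic
    difference of this function and vanish in the sum.\<close>
  define h where "h i = 2 * \<sigma> i / \<kappa> i * a $ i * b $ i" for i
  have edge: "\<tau> i * (a $ i + a $ next_ix i) * (b $ i + b $ next_ix i)
      - (a $ next_ix i - a $ i) * (b $ next_ix i - b $ i) / \<tau> i
      = - (wt i * (a $ next_ix i / \<kappa> (next_ix i) - a $ i / \<kappa> i)
      * (b $ next_ix i / \<kappa> (next_ix i) - b $ i / \<kappa> i)) + (h (next_ix i) - h i)" for i
  proof -
    define f f' g g' where fg: "f = a $ i / \<kappa> i" "f' = a $ next_ix i / \<kappa> (next_ix i)"
      "g = b $ i / \<kappa> i" "g' = b $ next_ix i / \<kappa> (next_ix i)"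
    have a: "a $ i = \<kappa> i * f" "a $ next_ix i = \<kappa> (next_ix i) * f'"
      "b $ i = \<kappa> i * g" "b $ next_ix i = \<kappa> (next_ix i) * g'"
      using \<kappa>[of i] \<kappa>[of "next_ix i"] by (simp_all add: fg)
    have h: "h (next_ix i) - h i = 2 * \<sigma> (next_ix i) * \<kappa> (next_ix i) * f' * g' - 2 * \<sigma> i * \<kappa> i * f *
      g"
      unfolding h_def a using \<kappa>[of i] \<kappa>[of "next_ix i"] by simp
    have wt: "wt i * \<tau> i = \<kappa> i * \<kappa> (next_ix i) * (1 + (\<tau> i)\<^sup>2)" using \<tau>[of i] by (simp add: wt_def)
    have "(\<tau> i * (\<kappa> i * f + \<kappa> (next_ix i) * f') * (\<kappa> i * g + \<kappa> (next_ix i) * g')) * \<tau> i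
        - (\<kappa> (next_ix i) * f' - \<kappa> i * f) * (\<kappa> (next_ix i) * g' - \<kappa> i * g)
        = - (wt i * \<tau> i) * (f' - f) * (g' - g)
          + \<tau> i * (2 * \<sigma> (next_ix i) * \<kappa> (next_ix i) * f' * g' - 2 * \<sigma> i * \<kappa> i * f * g)"
      unfolding wt using next_\<kappa>[of i] prev_\<kappa>[of i] by algebra
    then show ?thesis
      unfolding h fg[symmetric] unfolding a using \<tau>[of i] by (simp add: field_simps)
  qed
  then show ?thesis
    unfolding Q_def edge by (simp only: sum.distrib sum_negf sum_next_ix_diff add_0_right)
qed

text \<open>Testing with one vertex at a time shows that \<open>wt i * d i\<close> is the same for
  all edges. So \<open>d\<close> is a multiple of the reciprocal weights, hence of the differences
  of \<open>\<sigma> / \<kappa>\<close>, and one summation gives \<open>a\<close>.\<close>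

lemma Q_kernel:
  assumes "\<And>b. Q a b = 0"
  shows "\<exists>p q. \<forall>i. a $ i = p * \<kappa> i + q * \<sigma> i"
proof -
  define d where "d i = a $ next_ix i / \<kappa> (next_ix i) - a $ i / \<kappa> i" for i
  have "wt (next_ix i) * d (next_ix i) = wt i * d i" for i
  proof -
    \<comment> \<open>The quotient by \<open>\<kappa>\<close> is the indicator of one vertex: it
      jumps up on one edge and down on the next.\<close>
    define b :: "(real, 'n) vec" where "b = (\<chi> l. if l = next_ix i then \<kappa> l else 0)"
    have inj: "next_ix l = next_ix i \<longleftrightarrow> l = i" for l
      using bij_next_ix by (metis bij_def inj_def)
    have b: "b $ next_ix l / \<kappa> (next_ix l) - b $ l / \<kappa> l
        = (if l = i then 1 else 0) - (if l = next_ix i then 1 else 0)" for l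
      by (simp add: b_def inj \<kappa>)
    have "0 = (\<Sum>l\<in>UNIV. wt l * d l * ((if l = i then 1 else 0) - (if l = next_ix i then 1 else 0)))"
      using assms[of b] unfolding Q_differences b d_def by simp
    also have "\<dots> = wt i * d i - wt (next_ix i) * d (next_ix i)"
      by (simp add: right_diff_distrib sum_subtractf if_distrib[of "\<lambda>x. _ * x"] cong: if_cong)
    finally show ?thesis by simp
  qed
  then have const: "wt i * d i = wt j * d j" for i j
    by (rule next_ix_invariant_const[where f = "\<lambda>i. wt i * d i"])
  define k where "k = wt undefined * d undefined"
  have "d i = k * (1 / wt i)" for i
    using const[of i undefined] wt_nonzero[of i] by (simp add: k_def field_simps)
  then have "d i = k / (2 * R) * (\<sigma> (next_ix i) / \<kappa> (next_ix i)) - k / (2 * R) * (\<sigma> i / \<kappa> i)" for i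
    unfolding inverse_wt by (simp add: algebra_simps diff_divide_distrib)
  then have "a $ next_ix i / \<kappa> (next_ix i) - k / (2 * R) * (\<sigma> (next_ix i) / \<kappa> (next_ix i))
      = a $ i / \<kappa> i - k / (2 * R) * (\<sigma> i / \<kappa> i)" for i
    by (simp add: d_def algebra_simps)
  then have eq: "a $ i / \<kappa> i - k / (2 * R) * (\<sigma> i / \<kappa> i)
      = a $ j / \<kappa> j - k / (2 * R) * (\<sigma> j / \<kappa> j)" for i j
    by (rule next_ix_invariant_const[where f = "\<lambda>i. a $ i / \<kappa> i - k / (2 * R) * (\<sigma> i / \<kappa> i)"])
  define p where "p = a $ undefined / \<kappa> undefined - k / (2 * R) * (\<sigma> undefined / \<kappa> undefined)"
  have "a $ i = p * \<kappa> i + k / (2 * R) * \<sigma> i" for i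
    using eq[of i undefined] \<kappa>[of i] unfolding p_def[symmetric] by (simp add: field_simps)
  then show ?thesis by blast
qed

text \<open>The edge from \<open>i\<close> turns by \<open>2 * arctan (\<tau> i)\<close>; after subtracting the change of the direction
  of the line through the centre and the vertex, measured in \<open>(-\<pi>/2, \<pi>/2)\<close> from the
  normal of the line \<open>\<kappa> = 0\<close>, only the crossings of that line remain.\<close>

lemma turning_edge:
  "2 * arctan (\<tau> i) - (arctan (\<sigma> (next_ix i) / \<kappa> (next_ix i)) - arctan (\<sigma> i / \<kappa> i))
    = (if \<kappa> i * \<kappa> (next_ix i) > 0 then 0 else pi * sgn (\<tau> i))"
proof -
  define \<theta> where "\<theta> l = arctan (\<sigma> l / \<kappa> l)" for l
  define y where "y = 2 * arctan (\<tau> i) - (\<theta> (next_ix i) - \<theta> i)"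
  have \<theta>: "\<bar>\<theta> l\<bar> < pi / 2" for l
    using arctan_bounded[of "\<sigma> l / \<kappa> l"] by (auto simp: \<theta>_def abs_less_iff)
  \<comment> \<open>\<open>\<theta>\<close> only sees the line through the centre and the vertex;
    the sign of \<open>\<kappa>\<close> tells which of its two rays is meant.\<close>
  have polar: "Complex (\<kappa> l) (\<sigma> l) = of_real (sgn (\<kappa> l) * sqrt R) * cis (\<theta> l)" for l
  proof -
    have "1 + (\<sigma> l / \<kappa> l)\<^sup>2 = R / (\<kappa> l)\<^sup>2"
      using radius[of l] \<kappa>[of l] by (simp add: field_simps)
    then have "sqrt (1 + (\<sigma> l / \<kappa> l)\<^sup>2) = sqrt R / \<bar>\<kappa> l\<bar>" by (simp add: real_sqrt_divide)
    then have "cos (\<theta> l) = \<bar>\<kappa> l\<bar> / sqrt R" "sin (\<theta> l) = \<sigma> l / \<kappa> l * (\<bar>\<kappa> l\<bar> / sqrt R)"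
      unfolding \<theta>_def by (simp_all add: cos_arctan sin_arctan)
    then show ?thesis
      using \<kappa>[of l] R_pos by (auto simp: complex_eq_iff sgn_if abs_if)
  qed
  have half: "Complex 1 (\<tau> i) = of_real (sqrt (1 + (\<tau> i)\<^sup>2)) * cis (arctan (\<tau> i))"
    "Complex 1 (- \<tau> i) = of_real (sqrt (1 + (\<tau> i)\<^sup>2)) * cis (- arctan (\<tau> i))"
    using one_plus_\<tau>2[of i] by (simp_all add: complex_eq_iff cos_arctan sin_arctan)
  have "Complex (\<kappa> (next_ix i)) (\<sigma> (next_ix i)) * Complex 1 (- \<tau> i)
      = Complex (\<kappa> i) (\<sigma> i) * Complex 1 (\<tau> i)"
    using turn_Re[of i] turn_Im[of i] by (simp add: complex_eq_iff algebra_simps)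
  then have "of_real (sqrt R * sqrt (1 + (\<tau> i)\<^sup>2)) * (of_real (sgn (\<kappa> (next_ix i))) * (cis (\<theta>
    (next_ix i)) * cis (- arctan (\<tau> i))))
      = of_real (sqrt R * sqrt (1 + (\<tau> i)\<^sup>2)) * (of_real (sgn (\<kappa> i)) * (cis (\<theta> i) * cis (arctan (\<tau>
        i))))"
    unfolding polar half by (simp add: mult_ac)
  moreover have "complex_of_real (sqrt R * sqrt (1 + (\<tau> i)\<^sup>2)) \<noteq> 0"
    using R_pos one_plus_\<tau>2[of i] by (simp add: less_imp_neq[symmetric])
  ultimately have eq: "of_real (sgn (\<kappa> (next_ix i))) * cis (\<theta> (next_ix i) - arctan (\<tau> i))
      = of_real (sgn (\<kappa> i)) * cis (\<theta> i + arctan (\<tau> i))"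
    by (simp add: cis_mult)
  have sgn1: "sgn (\<kappa> i) * sgn (\<kappa> i) = 1" using \<kappa>[of i] by (simp add: sgn_if)
  have "cis y = cis (\<theta> i + arctan (\<tau> i)) * cis (- (\<theta> (next_ix i) - arctan (\<tau> i)))"
    by (simp add: cis_mult y_def algebra_simps)
  also have "\<dots> = of_real (sgn (\<kappa> i) * sgn (\<kappa> i)) * cis (\<theta> i + arctan (\<tau> i)) * cis (- (\<theta> (next_ix i)
    - arctan (\<tau> i)))"
    unfolding sgn1 by simp
  also have "\<dots> = of_real (sgn (\<kappa> i)) * (of_real (sgn (\<kappa> i)) * cis (\<theta> i + arctan (\<tau> i))) * cis (- (\<theta>
    (next_ix i) - arctan (\<tau> i)))"
    by (simp only: of_real_mult mult.assoc)
  also have "\<dots> = of_real (sgn (\<kappa> i) * sgn (\<kappa> (next_ix i)))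
      * (cis (\<theta> (next_ix i) - arctan (\<tau> i)) * cis (- (\<theta> (next_ix i) - arctan (\<tau> i))))"
    unfolding eq[symmetric] by simp
  also have "\<dots> = of_real (sgn (\<kappa> i * \<kappa> (next_ix i)))"
    unfolding cis_mult by (simp add: sgn_mult)
  finally have cis_y: "cis y = of_real (sgn (\<kappa> i * \<kappa> (next_ix i)))" .
  \<comment> \<open>By \<open>cis_y\<close>, \<open>y\<close> is an even multiple of
    \<open>pi\<close> without a crossing and an odd one with a crossing; the bounds on the
    arctangents single out the multiple.\<close>
  have at: "- pi / 2 < arctan (\<tau> i)" "arctan (\<tau> i) < pi / 2"
    using arctan_bounded[of "\<tau> i"] by auto
  have \<theta>': "\<bar>\<theta> (next_ix i) - \<theta> i\<bar> < pi" using \<theta>[of i] \<theta>[of "next_ix i"] by linarith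
  have "\<kappa> i * \<kappa> (next_ix i) \<noteq> 0" using \<kappa> by simp
  then consider "\<kappa> i * \<kappa> (next_ix i) > 0" | "\<kappa> i * \<kappa> (next_ix i) < 0" "\<tau> i > 0"
    | "\<kappa> i * \<kappa> (next_ix i) < 0" "\<tau> i < 0"
    using \<tau>[of i] by linarith
  then have "y = (if \<kappa> i * \<kappa> (next_ix i) > 0 then 0 else pi * sgn (\<tau> i))"
  proof cases
    case 1
    have "\<bar>y\<bar> < 2 * pi" using at \<theta>' unfolding y_def by linarith
    then have "y = 0" using cis_y 1 by (intro cis_eq_1_imp_0) simp_all
    then show ?thesis using 1 by simp
  next
    case 2
    then have "arctan (\<tau> i) > 0" by simp
    then have "- pi < y" "y < 3 * pi" using at \<theta>' unfolding y_def by linarith+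
    then have "y = pi" using 2 cis_y by (intro cis_eq_minus_1_imp_pi) simp_all
    then show ?thesis using 2 by simp
  next
    case 3
    then have "arctan (\<tau> i) < 0" by simp
    then have "- pi < - y" "- y < 3 * pi" using at \<theta>' unfolding y_def by linarith+
    moreover have "cis (- y) = -1" using 3 cis_y by (simp add: cis_cnj[symmetric])
    ultimately have "- y = pi" by (intro cis_eq_minus_1_imp_pi)
    then show ?thesis using 3 by simp
  qed
  then show ?thesis by (simp add: y_def \<theta>_def)
qed

text \<open>Around the polygon the changes of line direction cancel. What is left on an edge is
  \<open>pi\<close> times the difference of the indicators of \<open>\<tau> i > 0\<close> and
  \<open>wt i > 0\<close>: these agree unless the edge crosses the line, which flips the
  second.\<close>

lemma card_wt_pos:
  "real (card {i. wt i > 0}) = real (card {i. \<tau> i > 0}) - (\<Sum>i\<in>UNIV. 2 * arctan (\<tau> i)) / pi"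
proof -
  have "(\<Sum>i\<in>UNIV. 2 * arctan (\<tau> i))
      = (\<Sum>i\<in>UNIV. 2 * arctan (\<tau> i) - (arctan (\<sigma> (next_ix i) / \<kappa> (next_ix i)) - arctan (\<sigma> i / \<kappa> i)))"
    using sum_next_ix_diff[of "\<lambda>i. arctan (\<sigma> i / \<kappa> i)"] by (simp add: sum_subtractf)
  also have "\<dots> = (\<Sum>i\<in>UNIV. pi * ((if \<tau> i > 0 then 1 else 0) - (if wt i > 0 then 1 else 0)))"
  proof (rule sum.cong)
    fix i
    have "wt i > 0 \<longleftrightarrow> (\<kappa> i * \<kappa> (next_ix i) > 0 \<longleftrightarrow> \<tau> i > 0)"
      unfolding wt_def using one_plus_\<tau>2[of i] \<tau>[of i] \<kappa>[of i] \<kappa>[of "next_ix i"]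
      by (auto simp: zero_less_divide_iff zero_less_mult_iff mult_less_0_iff linorder_neq_iff)
    then show "2 * arctan (\<tau> i) - (arctan (\<sigma> (next_ix i) / \<kappa> (next_ix i)) - arctan (\<sigma> i / \<kappa> i))
        = pi * ((if \<tau> i > 0 then 1 else 0) - (if wt i > 0 then 1 else 0))"
      unfolding turning_edge using \<tau>[of i] by (auto simp: sgn_if)
  qed simp
  also have "\<dots> = pi * (real (card {i. \<tau> i > 0}) - real (card {i. wt i > 0}))"
    by (simp add: sum_distrib_left[symmetric] sum_subtractf sum.If_cases)
  finally show ?thesis by simp
qed

text \<open>The Hessian up to the factor \<open>R / 2\<close>, in radial components and components
  along the edges, on pairs not yet subject to any constraint.\<close>

definition D :: "(real, 'n) vec \<times> (real, 'n) vec \<Rightarrow> (real, 'n) vec \<times> (real, 'n) vec \<Rightarrow> real" where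
  "D x y = Q (fst x) (fst y) - (\<Sum>i\<in>UNIV. \<tau> i / (1 + (\<tau> i)\<^sup>2) * snd x $ i * snd y $ i)"

sublocale D: sym_form D
proof
  show sym: "D x y = D y x" for x y
    by (simp add: D_def Q_def mult_ac)
  have "linear (D x)" for x
  proof (rule linearI)
    show "D x (y + z) = D x y + D x z" for y z
      by (simp add: D_def Q_differences sum.distrib[symmetric] sum_negf[symmetric]
        sum_subtractf[symmetric]
          add_divide_distrib algebra_simps)
    show "D x (r *\<^sub>R y) = r *\<^sub>R D x y" for r y
      by (simp add: D_def Q_differences sum_distrib_left right_diff_distrib algebra_simps)
  qed
  moreover from this have "linear (\<lambda>x. D x y)" for y by (simp add: sym[of _ y])
  ultimately show "bilinear D" by (simp add: bilinear_def)
qed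

text \<open>The differences of the radial quotients range over the vectors of sum zero, a hyperplane
  orthogonal to an isotropic vector, so exactly one negative square of the diagonal form is
  lost.\<close>

lemma has_index_D: "card {i. wt i > 0} + card {i. \<tau> i > 0} > 0 \<and>
    has_index D UNIV (card {i. wt i > 0} + card {i. \<tau> i > 0} - 1)"
proof -
  define \<gamma> where "\<gamma> k = (case k of Inl i \<Rightarrow> - wt i | Inr i \<Rightarrow> - (\<tau> i / (1 + (\<tau> i)\<^sup>2)))" for k :: "'n +
    'n"
  define B where "B x y = (\<Sum>k\<in>UNIV. \<gamma> k * x $ k * y $ k)" for x y :: "(real, 'n + 'n) vec"
  have sumPlus: "(\<Sum>k\<in>UNIV. f k) = (\<Sum>i\<in>UNIV. f (Inl i)) + (\<Sum>i\<in>UNIV. f (Inr i))"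
    for f :: "'n + 'n \<Rightarrow> real"
    unfolding UNIV_Plus_UNIV[symmetric] by (subst sum.Plus) auto
  interpret B: sym_form B
  proof
    show sym: "B x y = B y x" for x y by (simp add: B_def mult_ac)
    have "linear (B x)" for x
      by (rule linearI) (simp_all add: B_def sum.distrib sum_distrib_left algebra_simps)
    moreover from this have "linear (\<lambda>x. B x y)" for y by (simp add: sym[of _ y])
    ultimately show "bilinear B" by (simp add: bilinear_def)
  qed
  have "{k. \<gamma> k < 0} = Inl ` {i. wt i > 0} \<union> Inr ` {i. \<tau> i > 0}"
  proof -
    have "\<tau> i / (1 + (\<tau> i)\<^sup>2) > 0 \<longleftrightarrow> \<tau> i > 0" for i
      using one_plus_\<tau>2[of i] by (simp add: zero_less_divide_iff)
    then have "\<gamma> k < 0 \<longleftrightarrow> k \<in> Inl ` {i. wt i > 0} \<union> Inr ` {i. \<tau> i > 0}" for k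
      by (cases k) (auto simp: \<gamma>_def)
    then show ?thesis by blast
  qed
  moreover have "card (Inl ` {i. wt i > 0} \<union> Inr ` {i. \<tau> i > 0} :: ('n + 'n) set)
      = card {i. wt i > 0} + card {i. \<tau> i > 0}"
    by (subst card_Un_disjoint) (auto simp: card_image)
  ultimately have "has_index B UNIV (card {i. wt i > 0} + card {i. \<tau> i > 0})"
    using has_index_diagonal[of \<gamma>] unfolding B_def[abs_def] by simp
  \<comment> \<open>Dividing by the diagonal entries makes \<open>B x z\<close> the sum of the first
    half of the coordinates; \<open>z\<close> is isotropic by \<open>sum_inverse_wt\<close>.\<close>
  moreover define z :: "(real, 'n + 'n) vec" where
    "z = (\<chi> k. case k of Inl i \<Rightarrow> - (1 / wt i) | Inr i \<Rightarrow> 0)"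
  have Bz: "B x z = (\<Sum>i\<in>UNIV. x $ Inl i)" for x
    using wt_nonzero by (simp add: B_def sumPlus z_def \<gamma>_def)
  have "B z z = 0" unfolding Bz using sum_inverse_wt by (simp add: z_def sum_negf)
  moreover have "B (axis (Inl undefined) 1) z \<noteq> 0"
    unfolding Bz by (simp add: axis_def)
  ultimately have pos: "card {i. wt i > 0} + card {i. \<tau> i > 0} > 0"
    and idx: "has_index B {x. B x z = 0} (card {i. wt i > 0} + card {i. \<tau> i > 0} - 1)"
    using B.has_index_perp_isotropic[of UNIV _ z "axis (Inl undefined) 1"] by auto
  define h :: "(real, 'n) vec \<times> (real, 'n) vec \<Rightarrow> (real, 'n + 'n) vec" where
    "h x = (\<chi> k. case k of Inl i \<Rightarrow> fst x $ next_ix i / \<kappa> (next_ix i) - fst x $ i / \<kappa> i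
                 | Inr i \<Rightarrow> snd x $ i)" for x
  have "linear h"
    by (rule linearI) (auto simp: h_def vec_eq_iff add_divide_distrib right_diff_distrib split:
      sum.splits)
  moreover have "range h = {x. B x z = 0}"
  proof safe
    show "B (h x) z = 0" for x
      unfolding Bz using sum_next_ix_diff[of "\<lambda>i. fst x $ i / \<kappa> i"] by (simp add: h_def)
  next
    fix y assume "B y z = 0"
    then have "(\<Sum>i\<in>UNIV. y $ Inl i) = 0" by (simp add: Bz)
    note f = sum_lessThan_next_ix[OF this]
    have "h (\<chi> i. \<kappa> i * (\<Sum>j\<in>{..<i}. y $ Inl j), \<chi> i. y $ Inr i) = y"
      using \<kappa> f by (auto simp: h_def vec_eq_iff split: sum.splits)
    then show "y \<in> range h" by (rule range_eqI[OF sym])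
  qed
  moreover have "D x x = B (h x) (h x)" for x
    by (simp add: D_def Q_differences B_def sumPlus \<gamma>_def h_def sum_negf)
  ultimately have "has_index D UNIV (card {i. wt i > 0} + card {i. \<tau> i > 0} - 1)"
    using has_index_transport[OF _ subspace_UNIV _ _ _ idx, of h D] B.bil_simps(7) by simp
  then show ?thesis using pos by simp
qed

lemma D_ones: "D x (1, 0) = 2 * (\<Sum>i\<in>UNIV. \<tau> i * (fst x $ i + fst x $ next_ix i))"
  by (simp add: D_def Q_def sum_distrib_left mult_ac)

text \<open>The first equation lets the tangential components close up around the polygon; the
  others keep the bead lengths stationary.\<close>

definition constraint_space :: "('n \<Rightarrow> 'k) \<Rightarrow> ((real, 'n) vec \<times> (real, 'n) vec) set" where
  "constraint_space bd = {x. (\<Sum>i\<in>UNIV. \<tau> i * (fst x $ i + fst x $ next_ix i)) = 0 \<and>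
     (\<forall>j. (\<Sum>i | bd i = j. snd x $ i) = 0)}"

text \<open>Each constraint is orthogonality to some \<open>z k\<close>: the constant radial vector
  for \<open>None\<close>, the indicator of a bead for \<open>Some j\<close>, where constancy of
  \<open>\<tau>\<close> on the bead turns the condition into a plain sum. Disjointness of the beads
  makes these vectors orthogonal, and beads with positive \<open>\<theta>\<close> give negative
  squares.\<close>

lemma has_index_constraint_space:
  fixes bd :: "'n \<Rightarrow> 'k::finite"
  assumes surj: "surj bd" and \<theta>: "\<And>i. \<tau> i = \<theta> (bd i)" and sum: "(\<Sum>i\<in>UNIV. \<tau> i) \<noteq> 0"
  shows "\<exists>m. has_index D (constraint_space bd) m \<and>
    real m = real (card {i. wt i > 0}) + real (card {i. \<tau> i > 0}) - 1
      - real (card {j. \<theta> j > 0}) - (if (\<Sum>i\<in>UNIV. \<tau> i) > 0 then 0 else 1)"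
proof -
  define z :: "'k option \<Rightarrow> (real, 'n) vec \<times> (real, 'n) vec" where
    "z k = (case k of None \<Rightarrow> (1, 0) | Some j \<Rightarrow> (0, \<chi> i. if bd i = j then 1 else 0))" for k
  define s where "s j = - (\<theta> j / (1 + (\<theta> j)\<^sup>2))" for j
  have one: "1 + (\<theta> j)\<^sup>2 > 0" for j by (rule add_pos_nonneg) auto
  have D_Some: "D x (z (Some j)) = s j * (\<Sum>i | bd i = j. snd x $ i)" for x j
  proof -
    have "D x (z (Some j)) = - (\<Sum>i\<in>UNIV. if bd i = j then \<tau> i / (1 + (\<tau> i)\<^sup>2) * snd x $ i else 0)"
      by (simp add: D_def z_def Q_def if_distrib cong: if_cong)
    also have "\<dots> = - (\<Sum>i | bd i = j. \<tau> i / (1 + (\<tau> i)\<^sup>2) * snd x $ i)"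
      by (simp add: sum.If_cases)
    also have "\<dots> = s j * (\<Sum>i | bd i = j. snd x $ i)"
      unfolding s_def sum_distrib_left sum_negf[symmetric] by (intro sum.cong) (auto simp: \<theta>)
    finally show ?thesis .
  qed
  have D_None: "D x (z None) = 2 * (\<Sum>i\<in>UNIV. \<tau> i * (fst x $ i + fst x $ next_ix i))" for x
    by (simp add: z_def D_ones)
  have \<theta>0: "\<theta> j \<noteq> 0" for j using surj \<tau> \<theta> by (metis surj_def)
  have s0: "s j \<noteq> 0" for j using \<theta>0[of j] one[of j] by (simp add: s_def)
  define n where "n j = real (card {i. bd i = j})" for j
  have n: "n j > 0" for j
    using surj unfolding n_def by (auto simp: card_gt_0_iff surj_def) metis
  have DNone: "D (z None) (z None) = 4 * (\<Sum>i\<in>UNIV. \<tau> i)"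
    unfolding D_None by (simp add: z_def sum_distrib_left[symmetric] sum_distrib_right[symmetric])
  have DSome: "D (z (Some j)) (z (Some j)) = s j * n j" for j
    unfolding D_Some by (simp add: z_def n_def)
  have perp: "D (z k) (z k') = 0" if "k \<noteq> k'" for k k'
  proof (cases k')
    case (Some j)
    then show ?thesis
      using that unfolding Some D_Some by (cases k) (auto simp: z_def intro!: sum.neutral)
  next
    case N: None
    then show ?thesis using that unfolding N D_None by (cases k) (auto simp: z_def)
  qed
  have neg: "card {k \<in> UNIV. D (z k) (z k) < 0}
      = card {j. \<theta> j > 0} + (if (\<Sum>i\<in>UNIV. \<tau> i) > 0 then 0 else 1)"
  proof -
    have "s j * n j < 0 \<longleftrightarrow> \<theta> j > 0" for j
      using n[of j] one[of j]
        by (auto simp: s_def mult_less_0_iff zero_less_divide_iff zero_less_mult_iff)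
    then have "D (z k) (z k) < 0 \<longleftrightarrow>
        k \<in> Some ` {j. \<theta> j > 0} \<union> (if (\<Sum>i\<in>UNIV. \<tau> i) > 0 then {} else {None})" for k
      using sum by (cases k) (auto simp: DSome DNone)
    then have "{k \<in> UNIV. D (z k) (z k) < 0}
        = Some ` {j. \<theta> j > 0} \<union> (if (\<Sum>i\<in>UNIV. \<tau> i) > 0 then {} else {None})"
      by blast
    then show ?thesis by (simp add: card_image card_insert_if)
  qed
  have "D (z k) (z k) \<noteq> 0" for k
    using DNone DSome sum s0 n by (cases k) (auto simp: less_imp_neq[symmetric])
  then have "card {k \<in> UNIV. D (z k) (z k) < 0} \<le> card {i. wt i > 0} + card {i. \<tau> i > 0} - 1 \<and>
    has_index D {x \<in> UNIV. \<forall>k\<in>UNIV. D x (z k) = 0}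
      (card {i. wt i > 0} + card {i. \<tau> i > 0} - 1 - card {k \<in> UNIV. D (z k) (z k) < 0})"
    using has_index_D by (intro D.has_index_perp_family) (auto simp: perp)
  moreover have "{x \<in> UNIV. \<forall>k\<in>UNIV. D x (z k) = 0} = constraint_space bd"
    using s0 by (auto simp: constraint_space_def D_None D_Some split_option_all)
  ultimately show ?thesis
    unfolding neg using has_index_D by (intro exI conjI, force) auto
qed

end

section \<open>Admissible polygons\<close>

lemma cross_mult: "cross (m * x) (m * y) = (norm m)\<^sup>2 * cross x y"
  and inner_mult: "(m * x) \<bullet> (m * y) = (norm m)\<^sup>2 * (x \<bullet> y)"
  unfolding cmod_power2 by (simp_all add: cross_def inner_complex_def power2_eq_square
    algebra_simps)

lemma inner_cross_decomposition:
  "(\<nu> \<bullet> \<nu>) *\<^sub>R q = (\<nu> \<bullet> q) *\<^sub>R \<nu> + cross \<nu> q *\<^sub>R (\<i> * \<nu>)"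
  "(\<nu> \<bullet> \<nu>) * (q \<bullet> q) = (\<nu> \<bullet> q)\<^sup>2 + (cross \<nu> q)\<^sup>2"
  by (simp_all add: complex_eq_iff inner_complex_def cross_def power2_eq_square algebra_simps)

locale admissible_polygon =
  fixes P :: "('n::{finite,linorder}) polygon"
  assumes admissible: "admissible P" and edge_ne: "\<And>i. edge P i \<noteq> 0"
begin

text \<open>A line meets a circle in at most two points, while admissibility provides three
  vertices. An arbitrary circle through the vertices is used, since uniqueness of the circumcentre
  is deduced from this lemma.\<close>

lemma not_collinear:
  assumes "\<nu> \<noteq> 0" shows "\<exists>i. \<nu> \<bullet> P $ i \<noteq> k"
proof (rule ccontr)
  assume "\<not> ?thesis"
  then have line: "\<nu> \<bullet> P $ i = k" for i by blast
  obtain o' r where r: "\<And>i. dist o' (P $ i) = r"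
    using admissible unfolding admissible_def cyclic_polygon_def by blast
  \<comment> \<open>By Pythagoras the coordinate along the line is determined up to sign, with
    square \<open>K\<close>; \<open>f\<close> rebuilds the point from it.\<close>
  define K where "K = (\<nu> \<bullet> \<nu>) * r\<^sup>2 - (k - \<nu> \<bullet> o')\<^sup>2"
  define f where "f s = o' + (1 / (\<nu> \<bullet> \<nu>)) *\<^sub>R ((k - \<nu> \<bullet> o') *\<^sub>R \<nu> + s *\<^sub>R (\<i> * \<nu>))" for s :: real
  have "P $ i \<in> f ` {sqrt K, - sqrt K}" for i
  proof -
    define q where "q = P $ i - o'"
    have inner: "\<nu> \<bullet> q = k - \<nu> \<bullet> o'" by (simp add: q_def inner_diff_right line)
    have "q \<bullet> q = r\<^sup>2" using r[of i]
      by (simp add: q_def dist_norm norm_minus_commute dot_square_norm)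
    then have "(cross \<nu> q)\<^sup>2 = K"
      using inner_cross_decomposition(2)[of \<nu> q] by (simp add: K_def inner)
    then have "cross \<nu> q \<in> {sqrt K, - sqrt K}" by (auto simp: abs_if split: if_splits)
    moreover have "f (cross \<nu> q) = P $ i"
      unfolding f_def inner[symmetric] inner_cross_decomposition(1)[symmetric]
      using assms by (simp add: q_def)
    ultimately show ?thesis by (metis image_eqI)
  qed
  then have "range (\<lambda>i. P $ i) \<subseteq> f ` {sqrt K, - sqrt K}" by blast
  then have "card (range (\<lambda>i. P $ i)) \<le> card (f ` {sqrt K, - sqrt K})" by (intro card_mono) auto
  also have "\<dots> \<le> card {sqrt K, - sqrt K}" by (rule card_image_le) simp
  also have "\<dots> \<le> 2" by (simp add: card_insert_if)
  finally show False using admissible by (simp add: admissible_def)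
qed

definition ctr :: complex where "ctr = circumcentre P"
definition z :: "'n \<Rightarrow> complex" where "z i = P $ i - ctr"
definition R :: real where "R = z undefined \<bullet> z undefined"

text \<open>Subtracting the equations of two circles gives the equation of a line through all
  vertices.\<close>

lemma circumcentre_unique:
  assumes "\<forall>i. dist x (P $ i) = r" "\<forall>i. dist y (P $ i) = s" shows "x = y"
proof (rule ccontr)
  assume "x \<noteq> y"
  have "(P $ i - x) \<bullet> (P $ i - x) = r\<^sup>2" "(P $ i - y) \<bullet> (P $ i - y) = s\<^sup>2" for i
    using assms by (auto simp: dist_norm norm_minus_commute dot_square_norm)
  then have expanded: "P $ i \<bullet> P $ i + x \<bullet> x - 2 * (x \<bullet> P $ i) = r\<^sup>2"
    "P $ i \<bullet> P $ i + y \<bullet> y - 2 * (y \<bullet> P $ i) = s\<^sup>2" for i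
    by (simp_all add: inner_diff_left inner_diff_right inner_commute)
  have "(y - x) \<bullet> P $ i = (r\<^sup>2 - s\<^sup>2 - x \<bullet> x + y \<bullet> y) / 2" for i
    using expanded[of i] by (simp add: inner_diff_left field_simps)
  moreover have "y - x \<noteq> 0" using \<open>x \<noteq> y\<close> by simp
  ultimately show False using not_collinear by blast
qed

lemma on_circle: "\<exists>r>0. \<forall>i. dist ctr (P $ i) = r"
proof -
  obtain x r where x: "r > 0" "\<forall>i. dist x (P $ i) = r"
    using admissible unfolding admissible_def cyclic_polygon_def by blast
  show ?thesis
    unfolding ctr_def circumcentre_def
  proof (rule theI[of _ x])
    show "\<exists>r>0. \<forall>i. dist x (P $ i) = r" using x by blast
  next
    fix y assume "\<exists>r>0. \<forall>i. dist y (P $ i) = r"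
    then obtain s where "\<forall>i. dist y (P $ i) = s" by blast
    then show "y = x" using x(2) by (rule circumcentre_unique)
  qed
qed

lemma z_inner: "z i \<bullet> z i = R" and R_pos: "R > 0"
proof -
  obtain r where r: "r > 0" "\<And>i. dist ctr (P $ i) = r" using on_circle by blast
  have "z i \<bullet> z i = r\<^sup>2" for i
    using r(2)[of i] by (simp add: z_def dist_norm norm_minus_commute dot_square_norm)
  then show "z i \<bullet> z i = R" "R > 0" using r(1) by (simp_all add: R_def)
qed

lemma z_nonzero: "z i \<noteq> 0"
  using z_inner[of i] R_pos by auto

lemma edge_z: "edge P i = z (next_ix i) - z i"
  by (simp add: edge_def z_def)

section \<open>Half-angle tangents and edge midpoints\<close>

definition \<tau> :: "'n \<Rightarrow> real" where "\<tau> i = tan (edge_angle P i / 2)"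
definition mid :: "'n \<Rightarrow> complex" where "mid i = (z i + z (next_ix i)) / 2"

lemma z_next: "z (next_ix i) = cis (edge_angle P i) * z i"
proof -
  have "norm (z l) = sqrt R" for l by (simp add: norm_eq_sqrt_inner z_inner)
  then have "norm (z (next_ix i) / z i) = 1" using R_pos by (simp add: norm_divide)
  then have "cis (Arg (z (next_ix i) / z i)) = z (next_ix i) / z i"
    using z_nonzero by (subst cis_Arg) (simp_all add: sgn_div_norm)
  then show ?thesis
    using z_nonzero[of i] by (simp add: edge_angle_def z_def ctr_def)
qed

text \<open>The angle \<open>pi\<close> would make the centre the midpoint of the edge, which
  admissibility excludes; the angle 0 would make the edge vanish.\<close>

lemma edge_angle_bounds:
  "- pi < edge_angle P i" "edge_angle P i < pi" "edge_angle P i \<noteq> 0"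
proof -
  show "- pi < edge_angle P i" unfolding edge_angle_def by (rule mpi_less_Arg)
  have "edge_angle P i \<le> pi" unfolding edge_angle_def by (rule Arg_le_pi)
  moreover have "edge_angle P i \<noteq> pi"
  proof
    assume "edge_angle P i = pi"
    then have "P $ next_ix i - ctr = - (P $ i - ctr)" using z_next[of i] by (simp add: z_def)
    then have "ctr = midpoint (P $ i) (P $ next_ix i)"
      by (simp add: midpoint_def scaleR_conv_of_real field_simps)
    then have "ctr \<in> closed_segment (P $ i) (P $ next_ix i)" by simp
    then show False using admissible by (auto simp: admissible_def ctr_def)
  qed
  ultimately show "edge_angle P i < pi" by simp
  show "edge_angle P i \<noteq> 0" using z_next[of i] edge_ne[of i] by (auto simp: edge_z)
qed

lemma cos_half_pos: "cos (edge_angle P i / 2) > 0"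
  using edge_angle_bounds[of i] by (intro cos_gt_zero_pi) auto

lemma edge_angle_arctan: "edge_angle P i = 2 * arctan (\<tau> i)"
  using edge_angle_bounds[of i] by (simp add: \<tau>_def arctan_tan)

lemma \<tau>_nonzero: "\<tau> i \<noteq> 0"
  using edge_angle_bounds(3)[of i] edge_angle_arctan[of i] by auto

text \<open>The half-angle form of a rotation: \<open>cis\<close> of the edge angle is
  \<open>(1 + \<i> * \<tau> i) / (1 - \<i> * \<tau> i)\<close>.\<close>

lemma z_turn: "z (next_ix i) * (1 - \<i> * \<tau> i) = z i * (1 + \<i> * \<tau> i)"
proof -
  define h where "h = edge_angle P i / 2"
  have half: "of_real (cos h) * (1 - \<i> * \<tau> i) = cis (- h)" "of_real (cos h) * (1 + \<i> * \<tau> i) = cis h"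
    using cos_half_pos[of i] by (simp_all add: \<tau>_def h_def complex_eq_iff tan_def)
  have "of_real (cos h) * (z (next_ix i) * (1 - \<i> * \<tau> i)) = z i * (cis (edge_angle P i) * cis (-
    h))"
    unfolding half(1)[symmetric] z_next by (simp only: mult_ac)
  also have "cis (edge_angle P i) * cis (- h) = cis h" by (simp add: cis_mult h_def)
  also have "z i * cis h = of_real (cos h) * (z i * (1 + \<i> * \<tau> i))"
    unfolding half(2)[symmetric] by (simp only: mult_ac)
  finally have "of_real (cos h) * (z (next_ix i) * (1 - \<i> * \<tau> i)) = of_real (cos h) * (z i * (1 + \<i>
    * \<tau> i))" .
  then show ?thesis using cos_half_pos[of i] by (simp add: h_def)
qed

text \<open>The midpoint serves as a frame for its edge: both ends and the edge itself are multiples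
  of \<open>mid i\<close> by factors depending only on \<open>\<tau> i\<close>, which makes the
  later identities polynomial in \<open>\<tau> i\<close>.\<close>

lemma z_mid: "z i = (1 - \<i> * \<tau> i) * mid i"
  and z_next_mid: "z (next_ix i) = (1 + \<i> * \<tau> i) * mid i"
proof -
  have "(1 - \<i> * \<tau> i) * mid i = (z i * (1 - \<i> * \<tau> i) + z (next_ix i) * (1 - \<i> * \<tau> i)) / 2"
    by (simp add: mid_def algebra_simps)
  then show "z i = (1 - \<i> * \<tau> i) * mid i" unfolding z_turn by (simp add: algebra_simps)
  have "(1 + \<i> * \<tau> i) * mid i = (z i * (1 + \<i> * \<tau> i) + z (next_ix i) * (1 + \<i> * \<tau> i)) / 2"
    by (simp add: mid_def algebra_simps)
  then show "z (next_ix i) = (1 + \<i> * \<tau> i) * mid i"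
    unfolding z_turn[symmetric] by (simp add: algebra_simps)
qed

lemma edge_mid: "edge P i = mid i * (2 * \<i> * \<tau> i)"
  unfolding edge_z z_next_mid z_mid[of i] by (simp add: algebra_simps)

lemma norm_mid: "(norm (mid i))\<^sup>2 * (1 + (\<tau> i)\<^sup>2) = R"
proof -
  have "R = (norm (mid i))\<^sup>2 * ((1 - \<i> * \<tau> i) \<bullet> (1 - \<i> * \<tau> i))"
    unfolding inner_mult[symmetric] using z_inner[of i] z_mid[of i] by (simp add: mult.commute)
  then show ?thesis by (simp add: inner_complex_def power2_eq_square)
qed

lemma mid_nonzero: "mid i \<noteq> 0"
  using norm_mid[of i] R_pos by auto

definition c :: "'n \<Rightarrow> real" where "c i = sgn (\<tau> i) * norm (mid i)"

text \<open>The circumradius is common to all edges, so \<open>norm_mid\<close> ties the distance of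
  an edge from the centre to \<open>\<bar>\<tau> i\<bar>\<close>; the signs agree by
  definition.\<close>

lemma c_eq_iff: "c i = c j \<longleftrightarrow> \<tau> i = \<tau> j"
proof
  assume eq: "c i = c j"
  have pos: "norm (mid l) > 0" for l using mid_nonzero by simp
  have abs: "\<bar>c l\<bar> = norm (mid l)" and sgn: "sgn (c l) = sgn (\<tau> l)" for l
    using \<tau>_nonzero[of l] pos[of l] by (simp_all add: c_def abs_mult sgn_mult abs_sgn_eq)
  have "norm (mid i) = norm (mid j)" "sgn (\<tau> i) = sgn (\<tau> j)" using abs sgn eq by metis+
  then have "(norm (mid j))\<^sup>2 * (1 + (\<tau> i)\<^sup>2) = (norm (mid j))\<^sup>2 * (1 + (\<tau> j)\<^sup>2)"
    using norm_mid[of i] norm_mid[of j] by simp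
  then have "(\<tau> i)\<^sup>2 = (\<tau> j)\<^sup>2" using pos[of j] by simp
  then show "\<tau> i = \<tau> j"
    using \<open>sgn (\<tau> i) = sgn (\<tau> j)\<close> \<tau>_nonzero[of j]
    by (auto simp: power2_eq_iff sgn_if split: if_splits)
next
  assume eq: "\<tau> i = \<tau> j"
  then have "(norm (mid i))\<^sup>2 * (1 + (\<tau> j)\<^sup>2) = (norm (mid j))\<^sup>2 * (1 + (\<tau> j)\<^sup>2)"
    using norm_mid[of i] norm_mid[of j] by simp
  moreover have "1 + (\<tau> j)\<^sup>2 \<noteq> 0" by (metis add_pos_nonneg less_irrefl zero_le_power2 zero_less_one)
  ultimately have "norm (mid i) = norm (mid j)" by simp
  then show "c i = c j" using eq by (simp add: c_def)
qed

lemma edge_eps_eq: "edge_eps P i = sgn (\<tau> i)"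
  and edge_eps_tan: "edge_eps P i * tan (edge_alpha P i) = \<tau> i"
proof -
  show 1: "edge_eps P i = sgn (\<tau> i)"
    using edge_angle_bounds[of i] \<tau>_nonzero[of i] edge_angle_arctan[of i]
    by (auto simp: edge_eps_def sgn_if)
  have "tan (\<bar>edge_angle P i\<bar> / 2) = \<bar>\<tau> i\<bar>"
  proof (cases "\<tau> i > 0")
    case True
    then show ?thesis by (simp add: edge_angle_arctan tan_arctan)
  next
    case False
    then have "\<bar>edge_angle P i\<bar> / 2 = arctan (- \<tau> i)"
      using \<tau>_nonzero[of i] by (simp add: edge_angle_arctan arctan_minus)
    then show ?thesis using False by (simp only: tan_arctan)
  qed
  then show "edge_eps P i * tan (edge_alpha P i) = \<tau> i"
    by (simp add: 1 edge_alpha_def sgn_mult_abs)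
qed

lemma bifurcating_iff: "bifurcating P \<longleftrightarrow> (\<Sum>i\<in>UNIV. \<tau> i) = 0"
  using admissible by (simp add: bifurcating_def edge_eps_tan)

lemma winding_\<tau>: "2 * winding P = (\<Sum>i\<in>UNIV. 2 * arctan (\<tau> i)) / pi"
proof -
  have "winding P = (\<Sum>i\<in>UNIV. edge_angle P i) / (2 * pi)"
    using admissible by (intro winding_eq_angle_sum) (auto simp: admissible_def)
  then show ?thesis by (simp add: edge_angle_arctan)
qed

text \<open>Otherwise all vertices lie on a line parallel to one edge.\<close>

lemma exists_nonparallel_edges: "\<exists>a b. cross (edge P a) (edge P b) \<noteq> 0"
proof (rule ccontr)
  assume "\<not> ?thesis"
  then have par: "cross (edge P a) (edge P b) = 0" for a b by blast
  define \<nu> where "\<nu> = \<i> * edge P undefined"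
  have "\<nu> \<bullet> P $ next_ix i = \<nu> \<bullet> P $ i" for i
  proof -
    have "\<nu> \<bullet> edge P i = cross (edge P undefined) (edge P i)"
      by (simp add: \<nu>_def cross_def inner_complex_def)
    then have "\<nu> \<bullet> edge P i = 0" by (simp only: par)
    then show ?thesis by (simp add: edge_def inner_diff_right)
  qed
  then have "\<nu> \<bullet> P $ i = \<nu> \<bullet> P $ undefined" for i
    by (rule next_ix_invariant_const[where f = "\<lambda>i. \<nu> \<bullet> P $ i"])
  moreover have "\<nu> \<noteq> 0" using edge_ne by (simp add: \<nu>_def)
  ultimately show False using not_collinear[of \<nu>] by blast
qed

text \<open>Each vertex rules out at most one slope.\<close>

lemma exists_generic_direction: "\<exists>\<nu>. norm \<nu> = 1 \<and> (\<forall>i. \<nu> \<bullet> z i \<noteq> 0)"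
proof -
  have "finite (\<Union>i. {t. Complex 1 t \<bullet> z i = 0})"
  proof (rule finite_UN_I)
    fix i
    have "{t. Complex 1 t \<bullet> z i = 0} \<subseteq> {- Re (z i) / Im (z i)}"
    proof
      fix t assume "t \<in> {t. Complex 1 t \<bullet> z i = 0}"
      then have t: "Re (z i) + t * Im (z i) = 0" by (simp add: inner_complex_def)
      then have "Im (z i) \<noteq> 0" using z_nonzero[of i] by (auto simp: complex_eq_iff)
      then show "t \<in> {- Re (z i) / Im (z i)}" using t by (simp add: field_simps)
    qed
    then show "finite {t. Complex 1 t \<bullet> z i = 0}" by (rule finite_subset) simp
  qed simp
  from ex_new_if_finite[OF infinite_UNIV_char_0 this]
  obtain t where "t \<notin> (\<Union>i. {t. Complex 1 t \<bullet> z i = 0})" ..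
  then have t: "Complex 1 t \<bullet> z i \<noteq> 0" for i by simp
  have "Complex 1 t \<noteq> 0" by (simp add: complex_eq_iff)
  then show ?thesis
    using t by (intro exI[of _ "(1 / norm (Complex 1 t)) *\<^sub>R Complex 1 t"]) simp
qed

text \<open>Since \<open>mid i\<close> is normal to edge \<open>i\<close>, the cross product with it
  measures the variation along the edge: \<open>c i * edge_len_deriv P i w\<close> is
  \<open>cross (mid i) (edge w i)\<close>. This is the contribution to the area up to the difference
  of \<open>k\<close>, which cancels around the polygon. So the \<open>c i\<close> are the
  multipliers.\<close>

lemma area_bil_edge_len: "area_bil P w = (\<Sum>i\<in>UNIV. c i * edge_len_deriv P i w)"
proof -
  define k where "k i = (cross ctr (w $ i) - cross (z i) (w $ i)) / 2" for i
  have "(cross (P $ i) (w $ next_ix i) + cross (w $ i) (P $ next_ix i)) / 2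
      = c i * edge_len_deriv P i w + (k (next_ix i) - k i)" for i
  proof -
    have "edge P i \<bullet> edge w i = 2 * \<tau> i * cross (mid i) (edge w i)"
      by (simp add: edge_mid inner_complex_def cross_def algebra_simps)
    moreover have "norm (edge P i) = 2 * \<bar>\<tau> i\<bar> * norm (mid i)" by (simp add: edge_mid norm_mult)
    ultimately have "c i * edge_len_deriv P i w = cross (mid i) (edge w i)"
      using \<tau>_nonzero[of i] mid_nonzero[of i]
      by (simp add: edge_len_deriv_def c_def sgn_if)
    moreover have "P $ i = ctr + z i" "P $ next_ix i = ctr + z (next_ix i)" by (simp_all add: z_def)
    ultimately show ?thesis
      by (simp add: k_def mid_def edge_def cross_def field_simps)
  qed
  then have "(\<Sum>i\<in>UNIV. (cross (P $ i) (w $ next_ix i) + cross (w $ i) (P $ next_ix i)) / 2)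
      = (\<Sum>i\<in>UNIV. c i * edge_len_deriv P i w)"
    by (simp only: sum.distrib sum_next_ix_diff add_0_right)
  then show ?thesis by (simp add: area_bil_def sum_divide_distrib)
qed

text \<open>Radial and tangential components of a variation of the polygon, and the components of the
  variation of an edge normal and parallel to that edge (all in units of \<open>z\<close> and \<open>mid\<close>).\<close>

definition rad :: "'n polygon \<Rightarrow> 'n \<Rightarrow> real" where "rad v i = Re (v $ i / z i)"
definition rot :: "'n polygon \<Rightarrow> 'n \<Rightarrow> real" where "rot v i = Im (v $ i / z i)"
definition par :: "'n polygon \<Rightarrow> 'n \<Rightarrow> real" where
  "par v i = \<tau> i * (rad v i + rad v (next_ix i)) + (rot v (next_ix i) - rot v i)"
definition nor :: "'n polygon \<Rightarrow> 'n \<Rightarrow> real" where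
  "nor v i = (rad v (next_ix i) - rad v i) - \<tau> i * (rot v i + rot v (next_ix i))"

lemma vertex_eq: "v $ i = Complex (rad v i) (rot v i) * z i"
  using z_nonzero[of i] by (simp add: rad_def rot_def)

lemma vertex_mid: "v $ i = mid i * (Complex (rad v i) (rot v i) * (1 - \<i> * \<tau> i))"
  and next_vertex_mid:
    "v $ next_ix i = mid i * (Complex (rad v (next_ix i)) (rot v (next_ix i)) * (1 + \<i> * \<tau> i))"
  using vertex_eq[of v i] vertex_eq[of v "next_ix i"] z_mid[of i] z_next_mid[of i]
  by (simp_all add: mult_ac)

lemma edge_eq: "edge v i = mid i * Complex (nor v i) (par v i)"
proof -
  have "edge v i = mid i * (Complex (rad v (next_ix i)) (rot v (next_ix i)) * (1 + \<i> * \<tau> i)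
      - Complex (rad v i) (rot v i) * (1 - \<i> * \<tau> i))"
    unfolding edge_def vertex_mid[of v i] next_vertex_mid[of v i] by (simp add: algebra_simps)
  also have "Complex (rad v (next_ix i)) (rot v (next_ix i)) * (1 + \<i> * \<tau> i)
      - Complex (rad v i) (rot v i) * (1 - \<i> * \<tau> i) = Complex (nor v i) (par v i)"
    by (simp add: complex_eq_iff nor_def par_def algebra_simps)
  finally show ?thesis .
qed

lemma edge_len_deriv_par: "edge_len_deriv P i v = c i * par v i"
proof -
  have "edge P i \<bullet> edge v i = (norm (mid i))\<^sup>2 * (2 * \<tau> i * par v i)"
    unfolding edge_mid edge_eq[of v] inner_mult by (simp add: inner_complex_def)
  moreover have "norm (edge P i) = 2 * \<bar>\<tau> i\<bar> * norm (mid i)" by (simp add: edge_mid norm_mult)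
  ultimately show ?thesis
    using \<tau>_nonzero[of i] mid_nonzero[of i]
    by (simp add: edge_len_deriv_def c_def sgn_if power2_eq_square)
qed

definition hess_red :: "'n polygon \<Rightarrow> 'n polygon \<Rightarrow> 'n \<Rightarrow> real" where
  "hess_red u v i = \<tau> i * (rad u i + rad u (next_ix i)) * (rad v i + rad v (next_ix i))
     - (rad u (next_ix i) - rad u i) * (rad v (next_ix i) - rad v i) / \<tau> i
     - \<tau> i / (1 + (\<tau> i)\<^sup>2) * par u i * par v i"

text \<open>Expressed through \<open>mid i\<close>, each edge contributes a polynomial in
  \<open>\<tau> i\<close>, its inverse and the components of the variations. The products of
  \<open>rad\<close> and \<open>rot\<close> at single vertices form the cyclic difference of
  \<open>k\<close> and drop out of the sum.\<close>

lemma hess_form_red: "hess_form P c u v = R / 2 * (\<Sum>i\<in>UNIV. hess_red u v i)"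
proof -
  define k where "k i = R / 2 * (rad u i * rot v i + rad v i * rot u i)" for i
  have "(cross (u $ i) (v $ next_ix i) + cross (v $ i) (u $ next_ix i)) / 2
      - c i * (cross (edge P i) (edge u i) * cross (edge P i) (edge v i) / norm (edge P i) ^ 3)
      = R / 2 * hess_red u v i + (k (next_ix i) - k i)" for i
  proof -
    \<comment> \<open>Names for the reciprocals leave only ring identities for
      \<open>algebra\<close>.\<close>
    define M \<iota> where "M = (norm (mid i))\<^sup>2" and "\<iota> = 1 / \<tau> i"
    have \<iota>: "\<tau> i * \<iota> = 1" using \<tau>_nonzero[of i] by (simp add: \<iota>_def)
    have R: "R = M * (1 + (\<tau> i)\<^sup>2)" using norm_mid[of i] by (simp add: M_def)
    have ce: "cross (edge P i) (edge w i) = - (2 * M * \<tau> i * nor w i)" for w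
      unfolding edge_mid edge_eq[of w] cross_mult by (simp add: cross_def M_def)
    have ne: "norm (edge P i) = 2 * \<bar>\<tau> i\<bar> * norm (mid i)" by (simp add: edge_mid norm_mult)
    have second: "c i * (cross (edge P i) (edge u i) * cross (edge P i) (edge v i) / norm (edge P i)
      ^ 3)
        = M * \<iota> * nor u i * nor v i / 2"
      unfolding ce ne c_def M_def \<iota>_def using \<tau>_nonzero[of i] mid_nonzero[of i]
      by (simp add: sgn_if field_simps power2_eq_square power3_eq_cube)
    have first: "cross (x $ i) (y $ next_ix i) = M * (2 * \<tau> i * (rad x i * rad y (next_ix i) + rot x
      i * rot y (next_ix i))
        + (1 - (\<tau> i)\<^sup>2) * (rad x i * rot y (next_ix i) - rot x i * rad y (next_ix i)))" for x y
      unfolding vertex_mid[of x i] next_vertex_mid[of y i] cross_mult M_def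
      by (simp add: cross_def power2_eq_square algebra_simps)
    define \<rho> where "\<rho> = \<tau> i / (1 + (\<tau> i)\<^sup>2)"
    have \<rho>: "R * \<rho> = M * \<tau> i"
      unfolding R \<rho>_def using add_pos_nonneg[OF zero_less_one zero_le_power2[of "\<tau> i"]] by simp
    have "hess_red u v i = \<tau> i * (rad u i + rad u (next_ix i)) * (rad v i + rad v (next_ix i))
        - (rad u (next_ix i) - rad u i) * (rad v (next_ix i) - rad v i) * \<iota>
        - \<rho> * par u i * par v i"
      by (simp add: hess_red_def \<iota>_def \<rho>_def)
    then have red: "R * hess_red u v i = R * (\<tau> i * (rad u i + rad u (next_ix i)) * (rad v i + rad v
      (next_ix i))
        - (rad u (next_ix i) - rad u i) * (rad v (next_ix i) - rad v i) * \<iota>)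
        - M * \<tau> i * par u i * par v i"
      using \<rho> by algebra
    have k2: "2 * (k (next_ix i) - k i)
        = R * (rad u (next_ix i) * rot v (next_ix i) + rad v (next_ix i) * rot u (next_ix i))
          - R * (rad u i * rot v i + rad v i * rot u i)"
      by (simp add: k_def algebra_simps)
    have "M * (2 * \<tau> i * (rad u i * rad v (next_ix i) + rot u i * rot v (next_ix i))
        + (1 - (\<tau> i)\<^sup>2) * (rad u i * rot v (next_ix i) - rot u i * rad v (next_ix i)))
      + M * (2 * \<tau> i * (rad v i * rad u (next_ix i) + rot v i * rot u (next_ix i))
        + (1 - (\<tau> i)\<^sup>2) * (rad v i * rot u (next_ix i) - rot v i * rad u (next_ix i)))
      - M * \<iota> * nor u i * nor v i
      = R * hess_red u v i + 2 * (k (next_ix i) - k i)"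
      unfolding red k2 unfolding R nor_def par_def using \<iota> by algebra
    from arg_cong[OF this, of "\<lambda>x. x / 2"] show ?thesis
      unfolding second first by (simp only: add_divide_distrib diff_divide_distrib) simp
  qed
  then have "(\<Sum>i\<in>UNIV. (cross (u $ i) (v $ next_ix i) + cross (v $ i) (u $ next_ix i)) / 2
      - c i * (cross (edge P i) (edge u i) * cross (edge P i) (edge v i) / norm (edge P i) ^ 3))
      = (\<Sum>i\<in>UNIV. R / 2 * hess_red u v i)"
    by (simp only: sum.distrib sum_next_ix_diff add_0_right)
  then show ?thesis
    by (simp add: hess_form_def area_bil_def sum_subtractf sum_divide_distrib sum_distrib_left)
qed

text \<open>Split the field at the circumcentre: a rotation about it has no radial part and constant
  \<open>rot\<close>, hence vanishing \<open>par\<close>; a translation changes no edge, and its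
  area term telescopes.\<close>

lemma hess_form_vertical:
  assumes "u \<in> vertical P" shows "hess_form P c u v = 0"
proof -
  interpret H: sym_form "hess_form P c" by (rule sym_form_hess_form)
  obtain \<omega> b where u: "u = isom_field P \<omega> b"
    using assms vertical_eq[OF edge_ne] by blast
  define r :: "'n polygon" where "r = (\<chi> i. of_real \<omega> * \<i> * z i)"
  define t :: "'n polygon" where "t = (\<chi> i. of_real \<omega> * \<i> * ctr + b)"
  have "u = r + t" by (simp add: u isom_field_def r_def t_def z_def vec_eq_iff algebra_simps)
  moreover have "hess_form P c r v = 0"
  proof -
    have "rad r i = 0" "rot r i = \<omega>" for i using z_nonzero[of i]
      by (simp_all add: rad_def rot_def r_def)
    then show ?thesis unfolding hess_form_red by (simp add: hess_red_def par_def)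
  qed
  moreover have "hess_form P c t v = 0"
  proof -
    define d where "d = of_real \<omega> * \<i> * ctr + b"
    have "area_bil t v = 1/2 * (\<Sum>i\<in>UNIV. cross d (v $ next_ix i) - cross d (v $ i))"
      unfolding area_bil_def using cross_skew[of "v $ i" d for i] by (simp add: t_def d_def)
    also have "\<dots> = 0" by (subst sum_next_ix_diff[of "\<lambda>i. cross d (v $ i)"]) simp
    finally have "area_bil t v = 0" .
    moreover have "edge t i = 0" for i by (simp add: edge_def t_def)
    ultimately show ?thesis by (simp add: hess_form_def cross_def)
  qed
  ultimately show ?thesis by (simp add: H.bil_simps)
qed

text \<open>Together with \<open>Q_kernel\<close> this identifies the radical of the radial part
  with the translations.\<close>

lemma translation_rad:
  assumes "v = (\<chi> i. b)"
  shows "rad v i = b \<bullet> z i / R" "par v i = 0"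
proof -
  have "b / z i = b * cnj (z i) / of_real R"
    using z_inner[of i] by (simp add: complex_div_cnj[of b] dot_square_norm flip: of_real_power)
  then show "rad v i = b \<bullet> z i / R"
    by (simp add: rad_def assms Re_divide_of_real inner_complex_def)
  have "mid i * Complex (nor v i) (par v i) = 0" using edge_eq[of v i] by (simp add: edge_def assms)
  then have "Complex (nor v i) (par v i) = 0" using mid_nonzero[of i] by simp
  then show "par v i = 0" by (simp add: complex_eq_iff)
qed

end

section \<open>Critical configurations\<close>

locale critical_cyclic = admissible_polygon P + necklace_point N P a b
  for P :: "('n::{finite,linorder}) polygon" and N :: "('k::{finite,linorder}) necklace"
    and a b :: 'n +
  fixes rep :: "'k \<Rightarrow> 'n" and \<nu> :: complex
  assumes bead_rep: "\<And>j. bead N (rep j) = j" and crit: "critical_point N P"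
    and norm_\<nu>: "norm \<nu> = 1" and generic: "\<And>i. \<nu> \<bullet> z i \<noteq> 0"
begin

text \<open>Lengthening edge \<open>i\<close> at the expense of another edge of the same bead is a
  tangent direction; criticality then equates the two multipliers.\<close>

lemma \<tau>_block: "\<tau> i = \<tau> (rep (bead N i))"
proof -
  define l where "l = rep (bead N i)"
  obtain v where v: "\<And>h. edge_len_deriv P h v = (if h = i then 1 else 0) - (if h = l then 1 else 0)"
    using exists_edge_len_deriv[OF edge_ne ab,
        of "\<lambda>h. (if h = i then 1 else 0) - (if h = l then 1 else 0)"] by blast
  have "(\<Sum>h\<in>block N j. edge_len_deriv P h v) = 0" for j
    unfolding v by (simp add: sum_subtractf in_block_iff[OF total] l_def bead_rep)
  then have "v \<in> T" by (simp add: T_def)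
  then have "(\<Sum>h\<in>UNIV. c h * edge_len_deriv P h v) = 0"
    using critical_area_bil[OF crit] by (simp add: area_bil_edge_len)
  then have "c i = c l"
    unfolding v by (simp add: right_diff_distrib sum_subtractf if_distrib[of "\<lambda>x. _ * x"] cong:
      if_cong)
  then show ?thesis by (simp add: c_eq_iff l_def)
qed

lemma c_block: "c i = c (rep (bead N i))"
  using \<tau>_block c_eq_iff by blast

lemma c_nonzero: "c i \<noteq> 0"
  using \<tau>_nonzero[of i] mid_nonzero[of i] by (simp add: c_def sgn_if)

sublocale C: critical_necklace_point N P a b c "\<lambda>j. c (rep j)"
  by unfold_locales (rule area_bil_edge_len c_block crit hess_form_vertical; assumption?)+

text \<open>Coordinates in the orthonormal frame \<open>\<nu>\<close>, \<open>\<i> * \<nu>\<close>;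
  the line through the centre normal to \<open>\<nu>\<close> is the one that avoids all
  vertices.\<close>

sublocale F: cyclic_form \<tau> "\<lambda>i. \<nu> \<bullet> z i" "\<lambda>i. cross \<nu> (z i)" R
proof
  have "\<nu> \<bullet> \<nu> = 1" by (simp add: dot_square_norm norm_\<nu>)
  then show "(\<nu> \<bullet> z i)\<^sup>2 + (cross \<nu> (z i))\<^sup>2 = R" for i
    using inner_cross_decomposition(2)[of \<nu> "z i"] by (simp only: z_inner mult_1)
  have "\<nu> \<bullet> (z (next_ix i) * (1 - \<i> * \<tau> i)) = \<nu> \<bullet> (z i * (1 + \<i> * \<tau> i))" for i
    by (simp only: z_turn)
  then show "\<nu> \<bullet> z (next_ix i) + \<tau> i * cross \<nu> (z (next_ix i)) = \<nu> \<bullet> z i - \<tau> i * cross \<nu> (z i)" for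
    i
    by (simp add: inner_complex_def cross_def algebra_simps)
  have "cross \<nu> (z (next_ix i) * (1 - \<i> * \<tau> i)) = cross \<nu> (z i * (1 + \<i> * \<tau> i))" for i
    by (simp only: z_turn)
  then show "cross \<nu> (z (next_ix i)) - \<tau> i * (\<nu> \<bullet> z (next_ix i)) = cross \<nu> (z i) + \<tau> i * (\<nu> \<bullet> z i)"
    for i
    by (simp add: inner_complex_def cross_def algebra_simps)
qed (simp_all add: \<tau>_nonzero generic)

text \<open>The component \<open>rot\<close> is left out: \<open>rad\<close> and \<open>par\<close>
  determine its increments, and the remaining constant is a rotation about the centre, a vertical
  direction.\<close>

definition coords :: "'n polygon \<Rightarrow> (real, 'n) vec \<times> (real, 'n) vec" where
  "coords v = (\<chi> i. rad v i, \<chi> i. par v i)"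

lemma hess_form_coords: "hess_form P c u v = R / 2 * F.D (coords u) (coords v)"
  unfolding hess_form_red F.D_def F.Q_def coords_def hess_red_def by (simp add: sum_subtractf)

lemma linear_coords: "linear coords"
proof -
  have "(r *\<^sub>R x) / y = r *\<^sub>R (x / y)" for r and x y :: complex
    by (simp add: scaleR_conv_of_real)
  then show ?thesis
    by (intro linearI)
      (simp_all add: coords_def vec_eq_iff par_def rad_def rot_def add_divide_distrib algebra_simps)
qed

lemma surj_bead: "surj (bead N :: 'n \<Rightarrow> 'k)"
  using bead_rep by (metis surjI)

abbreviation "S \<equiv> F.constraint_space (bead N)"

lemmas S_eq = F.constraint_space_def

lemma in_T_iff: "v \<in> T \<longleftrightarrow> (\<forall>j. (\<Sum>i | bead N i = j. par v i) = 0)"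
proof -
  have "(\<Sum>i\<in>block N j. edge_len_deriv P i v) = c (rep j) * (\<Sum>i | bead N i = j. par v i)" for j
    unfolding block_eq[OF total] sum_distrib_left
  proof (rule sum.cong)
    fix i :: 'n assume "i \<in> {i. bead N i = j}"
    then have "c i = c (rep j)" using c_block[of i] by simp
    then show "edge_len_deriv P i v = c (rep j) * par v i" by (simp add: edge_len_deriv_par)
  qed simp
  then show ?thesis using c_nonzero by (simp add: T_def)
qed

text \<open>The only obstruction to recovering \<open>rot\<close> is that its increments must add up
  to zero, which on \<open>S\<close> follows from the closing equation and the bead
  equations.\<close>

lemma coords_image: "coords ` T = S"
proof (intro set_eqI iffI)
  fix x assume "x \<in> coords ` T"
  then obtain v where v: "v \<in> T" "x = coords v" by blast
  have "(\<Sum>i\<in>UNIV. par v i) = (\<Sum>j\<in>UNIV. \<Sum>i\<in>block N j. par v i)"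
    by (simp add: sum_blocks[OF total])
  also have "\<dots> = 0" using v(1) by (simp add: in_T_iff block_eq[OF total])
  finally have "(\<Sum>i\<in>UNIV. \<tau> i * (rad v i + rad v (next_ix i))) = 0"
    using sum_next_ix_diff[of "rot v"] by (simp add: par_def sum.distrib)
  then show "x \<in> S" using v by (simp add: S_eq coords_def in_T_iff)
next
  fix x assume x: "x \<in> S"
  define \<alpha> t where "\<alpha> = fst x" and "t = snd x"
  define d where "d i = t $ i - \<tau> i * (\<alpha> $ i + \<alpha> $ next_ix i)" for i
  have "(\<Sum>i\<in>UNIV. t $ i) = (\<Sum>j\<in>UNIV. \<Sum>i\<in>block N j. t $ i)"
    by (simp add: sum_blocks[OF total])
  also have "\<dots> = 0" using x by (simp add: S_eq t_def block_eq[OF total])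
  finally have "(\<Sum>i\<in>UNIV. d i) = 0" using x by (simp add: d_def sum_subtractf S_eq \<alpha>_def)
  note \<beta> = sum_lessThan_next_ix[OF this]
  define v :: "'n polygon" where "v = (\<chi> i. Complex (\<alpha> $ i) (\<Sum>l\<in>{..<i}. d l) * z i)"
  have "rad v i = \<alpha> $ i" "rot v i = (\<Sum>l\<in>{..<i}. d l)" for i
    using z_nonzero[of i] by (simp_all add: v_def rad_def rot_def)
  moreover from this have "par v i = \<tau> i * (\<alpha> $ i + \<alpha> $ next_ix i) + d i" for i
    by (simp add: par_def \<beta>)
  ultimately have "rad v i = \<alpha> $ i" and par: "par v i = t $ i" for i by (simp_all add: d_def)
  then have "coords v = x" by (simp add: coords_def prod_eq_iff vec_eq_iff \<alpha>_def t_def)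
  moreover have "v \<in> T" using x par by (simp add: in_T_iff S_eq t_def)
  ultimately show "x \<in> coords ` T" by blast
qed

lemma hess_radical_iff:
  "(\<forall>v\<in>T. hess_form P c u v = 0) \<longleftrightarrow> (\<forall>y\<in>S. F.D (coords u) y = 0)"
  using R_pos by (simp add: hess_form_coords flip: coords_image)

text \<open>With vanishing sum the constant radial vector \<open>(1, 0)\<close> satisfies the
  constraints and lies in the radical. An isometry field with all radial components equal to 1 would
  put the vertices on a line.\<close>

lemma not_Morse:
  assumes "(\<Sum>i\<in>UNIV. \<tau> i) = 0" shows "\<not> Morse_point N P"
proof
  assume Morse: "Morse_point N P"
  have "(1, 0) \<in> S" using assms by (simp add: S_eq sum_distrib_right[symmetric])
  then obtain u where u: "u \<in> T" "coords u = (1, 0)" by (metis coords_image imageE)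
  have "F.D (coords u) y = 0" if "y \<in> S" for y
    unfolding u(2) using that F.D_ones[of y] by (simp add: F.D.sym[of "(1, 0)"] S_eq)
  then have "u \<in> vertical P" using Morse u(1) unfolding C.Morse_point_iff hess_radical_iff by blast
  then obtain \<omega> b' where v: "u = isom_field P \<omega> b'" unfolding C.V_eq by blast
  define d where "d = of_real \<omega> * \<i> * ctr + b'"
  have "d \<bullet> z i = R" for i
  proof -
    have "u $ i / z i = of_real \<omega> * \<i> + d / z i"
      using z_nonzero[of i] by (simp add: v isom_field_def d_def z_def field_simps)
    then have "rad u i = d \<bullet> z i / R"
      using translation_rad(1)[of "\<chi> i. d" d i] by (simp add: rad_def)
    moreover have "rad u i = 1" using u(2) by (simp add: coords_def vec_eq_iff)
    ultimately show ?thesis using R_pos by simp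
  qed
  then have "d \<bullet> P $ i = R + d \<bullet> ctr" for i by (simp add: z_def inner_diff_right algebra_simps)
  moreover have "d \<noteq> 0" using \<open>\<And>i. d \<bullet> z i = R\<close> R_pos by auto
  ultimately show False using not_collinear by blast
qed

text \<open>A vector in the radical is reduced in three steps. Testing inside a bead makes
  \<open>par\<close> constant there, hence zero. Testing with radial vectors puts \<open>rad\<close>
  in the kernel of \<open>Q\<close>, so a translation removes it. Then only a rotation about the
  centre is left.\<close>

lemma Morse:
  assumes "(\<Sum>i\<in>UNIV. \<tau> i) \<noteq> 0" shows "Morse_point N P"
  unfolding C.Morse_point_iff hess_radical_iff
proof (intro ballI impI)
  fix u assume u: "u \<in> T" "\<forall>y\<in>S. F.D (coords u) y = 0"
  have "coords u \<in> S" using u(1) coords_image by blast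
  then have uS: "(\<Sum>i\<in>UNIV. \<tau> i * (rad u i + rad u (next_ix i))) = 0"
    "\<And>j. (\<Sum>i | bead N i = j. par u i) = 0"
    by (simp_all add: S_eq coords_def)
  have const: "par u i = par u l" if il: "bead N i = bead N l" for i l
  proof -
    define t :: "(real, 'n) vec" where "t = axis i 1 - axis l 1"
    have t: "t $ h = (if h = i then 1 else 0) - (if h = l then 1 else 0)" for h
      by (simp add: t_def axis_def)
    have "(0, t) \<in> S" using il by (simp add: S_eq t sum_subtractf)
    then have "F.D (coords u) (0, t) = 0" using u(2) by blast
    then have "\<tau> i / (1 + (\<tau> i)\<^sup>2) * par u i = \<tau> l / (1 + (\<tau> l)\<^sup>2) * par u l"
      by (simp add: F.D_def F.Q_def coords_def t right_diff_distrib sum_subtractf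
          if_distrib[of "\<lambda>x. _ * x"] cong: if_cong)
    moreover have "\<tau> i = \<tau> l" using \<tau>_block[of i] \<tau>_block[of l] il by simp
    moreover have "\<tau> l / (1 + (\<tau> l)\<^sup>2) \<noteq> 0"
      using \<tau>_nonzero[of l] F.one_plus_\<tau>2[of l] by simp
    ultimately show ?thesis by simp
  qed
  have par_u: "par u i = 0" for i
  proof -
    have "(\<Sum>l | bead N l = bead N i. par u l) = (\<Sum>l\<in>{l :: 'n. bead N l = bead N i}. par u i)"
      by (intro sum.cong) (auto intro: const)
    moreover have "card {l :: 'n. bead N l = bead N i} > 0" by (auto simp: card_gt_0_iff)
    ultimately show ?thesis using uS(2)[of "bead N i"] by auto
  qed
  define \<alpha> :: "(real, 'n) vec" where "\<alpha> = (\<chi> i. rad u i)"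
  have "F.Q \<alpha> y = 0" for y
  proof -
    \<comment> \<open>Subtracting this multiple of the constant vector makes \<open>y\<close>
      satisfy the closing equation, which is possible because the sum of the \<open>\<tau> i\<close>
      is not zero. The constant vector itself is orthogonal to \<open>coords u\<close>.\<close>
    define s where "s = (\<Sum>i\<in>UNIV. \<tau> i * (y $ i + y $ next_ix i)) / (2 * (\<Sum>i\<in>UNIV. \<tau> i))"
    define w where "w = (y - s *\<^sub>R 1, 0 :: (real, 'n) vec)"
    have "(\<Sum>i\<in>UNIV. \<tau> i * (fst w $ i + fst w $ next_ix i))
        = (\<Sum>i\<in>UNIV. \<tau> i * (y $ i + y $ next_ix i)) - 2 * s * (\<Sum>i\<in>UNIV. \<tau> i)"
      by (simp add: w_def algebra_simps sum.distrib sum_subtractf sum_distrib_left)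
    also have "\<dots> = 0" using assms by (simp add: s_def)
    finally have "w \<in> S" by (simp add: S_eq w_def)
    then have "F.D (coords u) w = 0" using u(2) by blast
    moreover have "F.D (coords u) (1, 0) = 0" using F.D_ones[of "coords u"] uS(1)
      by (simp add: coords_def)
    moreover have "(y, 0) = w + s *\<^sub>R (1, 0)" by (simp add: w_def)
    ultimately have "F.D (coords u) (y, 0) = 0"
      by (simp only: F.D.bil_simps scaleR_zero_right mult_zero_right add_0)
    then show ?thesis by (simp add: F.D_def coords_def \<alpha>_def)
  qed
  then obtain p q where pq: "\<And>i. \<alpha> $ i = p * (\<nu> \<bullet> z i) + q * cross \<nu> (z i)"
    using F.Q_kernel by blast
  \<comment> \<open>By \<open>translation_rad\<close>, the translation with radial components
    \<open>\<alpha>\<close>.\<close>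
  define d where "d = R *\<^sub>R (p *\<^sub>R \<nu> + q *\<^sub>R (\<i> * \<nu>))"
  define t :: "'n polygon" where "t = (\<chi> i. d)"
  have "(\<i> * \<nu>) \<bullet> x = cross \<nu> x" for x by (simp add: inner_complex_def cross_def)
  then have "d \<bullet> z i / R = \<alpha> $ i" for i
    using R_pos by (simp add: d_def inner_add_left pq)
  then have rad: "rad (u - t) i = 0" for i
    using translation_rad(1)[OF t_def, of i] by (simp add: rad_def \<alpha>_def diff_divide_distrib)
  have "par (u - t) i = 0" for i
    using translation_rad(2)[OF t_def, of i] par_u[of i]
      linear_diff[OF linear_coords, of u t] by (simp add: coords_def vec_eq_iff)
  then have "rot (u - t) (next_ix i) = rot (u - t) i" for i using rad by (simp add: par_def)
  then have rot: "rot (u - t) i = rot (u - t) l" for i l by (rule next_ix_invariant_const)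
  define \<omega> where "\<omega> = rot (u - t) undefined"
  have "u $ i = of_real \<omega> * \<i> * P $ i + (d - of_real \<omega> * \<i> * ctr)" for i
  proof -
    have "(u - t) $ i = Complex 0 \<omega> * z i"
      using vertex_eq[of "u - t" i] rad[of i] rot[of i undefined] by (simp add: \<omega>_def)
    moreover have "Complex 0 \<omega> = of_real \<omega> * \<i>" by (simp add: complex_eq_iff)
    ultimately show ?thesis by (simp add: t_def z_def algebra_simps)
  qed
  then have "u = isom_field P \<omega> (d - of_real \<omega> * \<i> * ctr)" by (simp add: isom_field_def vec_eq_iff)
  then show "u \<in> vertical P" unfolding C.V_eq by blast
qed

text \<open>The factor \<open>R / 2\<close> keeps signs, and the number of positive weights is the
  number of positive edges minus twice the winding number.\<close>

lemma Morse_index_formula: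
  assumes "(\<Sum>i\<in>UNIV. \<tau> i) \<noteq> 0"
  shows "real (Morse_index N P) = 2 * real (card {i. \<tau> i > 0}) - real (card {j. \<tau> (rep j) > 0})
    - 1 - 2 * winding P - (if (\<Sum>i\<in>UNIV. \<tau> i) > 0 then 0 else 1)"
proof -
  obtain m where m: "has_index F.D S m"
    "real m = real (card {i. F.wt i > 0}) + real (card {i. \<tau> i > 0}) - 1
      - real (card {j. \<tau> (rep j) > 0}) - (if (\<Sum>i\<in>UNIV. \<tau> i) > 0 then 0 else 1)"
    using F.has_index_constraint_space[OF surj_bead, of "\<lambda>j. \<tau> (rep j)", OF \<tau>_block assms] by blast
  define C where "C x y = R / 2 * F.D x y" for x y
  have "C x x < 0 \<longleftrightarrow> F.D x x < 0" for x using R_pos by (simp add: C_def mult_less_0_iff)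
  then have "neg_def_on C = neg_def_on F.D" by (simp add: neg_def_on_def fun_eq_iff)
  then have "has_index C S m" using m(1) by (simp add: has_index_def)
  then have "has_index (hess_form P c) T m"
    by (rule has_index_transport[OF linear_coords subspace_T coords_image, rotated 2])
      (simp_all add: hess_form_coords C_def F.D.bil_simps)
  then have "Morse_index N P = m" by (rule C.Morse_index_eq)
  then show ?thesis unfolding m(2) winding_\<tau> by (simp add: m(2) F.card_wt_pos)
qed

end

theorem theorem4p4:
  fixes N :: "('k::{finite,linorder}) necklace"
    and P :: "('n::{finite,linorder}) polygon"
    and c :: "'k \<Rightarrow> 'n"
    and E A :: "'k \<Rightarrow> real"
  assumes "is_necklace N"
    and "(\<Sum>j\<in>UNIV. bd_num N j) = CARD('n)"
    and "realisable N"
    and "P \<in> Msm_tilde N"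
    and "admissible P"
    and "critical_point N P"
    and "\<And>j. c j \<in> block N j"
    and "\<And>j. E j = edge_eps P (c j)"
    and "\<And>j. A j = edge_alpha P (c j)"
  shows "(Morse_point N P \<longleftrightarrow> \<not> bifurcating P) \<and>
    (Morse_point N P \<longrightarrow>
      real (Morse_index N P) =
        1/2 * (\<Sum>j\<in>UNIV. (2 * real (bd_num N j) - 1) * (E j + 1)) - 1 - 2 * winding P
        - (if (\<Sum>j\<in>UNIV. real (bd_num N j) * E j * tan (A j)) > 0 then 0 else 1))"
proof -
  note total = assms(2)
  have "card (range (\<lambda>i. P $ i)) \<ge> 3" using assms(5) by (simp add: admissible_def)
  moreover have "card (range (\<lambda>i. P $ i)) \<le> CARD('n)" by (rule card_image_le) simp
  ultimately have card2: "CARD('n) \<ge> 2" by simp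
  have edge_ne: "edge P i \<noteq> 0" for i
    using nonsingular_edge_nonzero[OF _ total card2] assms(4) by (simp add: Msm_tilde_def)
  interpret adm: admissible_polygon P
    by unfold_locales (use assms(5) edge_ne in auto)
  obtain a b where ab: "cross (edge P a) (edge P b) \<noteq> 0" using adm.exists_nonparallel_edges by blast
  obtain \<nu> where \<nu>: "norm \<nu> = 1" "\<And>i. \<nu> \<bullet> adm.z i \<noteq> 0" using adm.exists_generic_direction by blast
  have bead: "bead N (c j) = j" for j using assms(7) in_block_iff[OF total] by blast
  interpret critical_cyclic P N a b c \<nu>
    by unfold_locales (use assms total card2 ab \<nu> bead in auto)
  \<comment> \<open>Sums over edges become weighted sums over beads, as \<open>\<tau>\<close> is
    constant on each bead.\<close>
  have sum_\<tau>: "(\<Sum>i\<in>UNIV. f (adm.\<tau> i)) = (\<Sum>j\<in>UNIV. real (bd_num N j) * f (adm.\<tau> (c j)))"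
    for f :: "real \<Rightarrow> real"
  proof -
    have "(\<Sum>i\<in>block N j. f (adm.\<tau> i)) = real (bd_num N j) * f (adm.\<tau> (c j))" for j
    proof -
      have "(\<Sum>i\<in>block N j. f (adm.\<tau> i)) = (\<Sum>i\<in>(block N j :: 'n set). f (adm.\<tau> (c j)))"
      proof (rule sum.cong)
        fix i :: 'n assume "i \<in> block N j"
        then have "bead N i = j" by (simp add: in_block_iff[OF total])
        then show "f (adm.\<tau> i) = f (adm.\<tau> (c j))" using \<tau>_block[of i] by simp
      qed simp
      then show ?thesis by (simp add: card_block[OF total])
    qed
    then show ?thesis by (simp flip: sum_blocks[OF total])
  qed
  have EA: "E j * tan (A j) = adm.\<tau> (c j)" for j by (simp add: assms(8,9) adm.edge_eps_tan)
  have sum: "(\<Sum>j\<in>UNIV. real (bd_num N j) * E j * tan (A j)) = (\<Sum>i\<in>UNIV. adm.\<tau> i)"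
    using sum_\<tau>[of "\<lambda>x. x"] by (simp add: EA mult.assoc)
  \<comment> \<open>No \<open>\<tau>\<close> vanishes, so \<open>E j\<close> is 1 or
    \<open>- 1\<close>, and half of \<open>E j + 1\<close> is the indicator of a positive
    bead.\<close>
  have E1: "E j + 1 = (if adm.\<tau> (c j) > 0 then 2 else 0)" for j
    using adm.\<tau>_nonzero[of "c j"] by (simp add: assms(8) adm.edge_eps_eq sgn_if)
  have "real (card {i. adm.\<tau> i > 0}) = (\<Sum>i\<in>UNIV. if adm.\<tau> i > 0 then 1 else 0)"
    by (simp add: sum.If_cases)
  also have "\<dots> = (\<Sum>j\<in>UNIV. real (bd_num N j) * (if adm.\<tau> (c j) > 0 then 1 else 0))"
    by (rule sum_\<tau>)
  \<comment> \<open>Each positive bead contributes twice its number of edges, minus one for the bead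
    itself.\<close>
  finally have "2 * real (card {i. adm.\<tau> i > 0}) - real (card {j. adm.\<tau> (c j) > 0})
      = (\<Sum>j\<in>UNIV. 2 * (real (bd_num N j) * (if adm.\<tau> (c j) > 0 then 1 else 0))
          - (if adm.\<tau> (c j) > 0 then 1 else 0))"
    by (simp add: sum_subtractf sum_distrib_left sum.If_cases)
  also have "\<dots> = 1/2 * (\<Sum>j\<in>UNIV. (2 * real (bd_num N j) - 1) * (E j + 1))"
    unfolding sum_distrib_left E1 by (intro sum.cong) auto
  finally have count: "2 * real (card {i. adm.\<tau> i > 0}) - real (card {j. adm.\<tau> (c j) > 0})
      = 1/2 * (\<Sum>j\<in>UNIV. (2 * real (bd_num N j) - 1) * (E j + 1))" .
  show ?thesis
    unfolding adm.bifurcating_iff sum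
  proof (intro conjI impI)
    show iff: "Morse_point N P \<longleftrightarrow> (\<Sum>i\<in>UNIV. adm.\<tau> i) \<noteq> 0" using Morse not_Morse by blast
    assume "Morse_point N P"
    then show "real (Morse_index N P) = 1/2 * (\<Sum>j\<in>UNIV. (2 * real (bd_num N j) - 1) * (E j + 1)) - 1
        - 2 * winding P - (if (\<Sum>i\<in>UNIV. adm.\<tau> i) > 0 then 0 else 1)"
      using Morse_index_formula[unfolded count] iff by blast
  qed
qed

end
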